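(* The monoidal categories $\mathcal{SC}(S_\star)$ and $\mathcal{SC}_{\mathrm{Webs}}$ are monoidally equivalent.
   Context: For a Coxeter system, $W_I$ is the parabolic subgroup generated by $I\subset S$, and $I$ is finitary if $W_I$ is finite; each double coset $p\in W_J\backslash W/W_I$ ($I,J$ finitary) has a unique Bruhat-maximal element $\overline p$. The $*$-product on $W$ is the associative product with $x*s=xs$ if $xs>x$, $x*s=x$ if $xs<x$. The singular Coxeter monoid $\mathcal{SC}(W)$ is the category with objects the finitary subsets of $S$, $\mathrm{Hom}(I,J)=W_J\backslash W/W_I$, and composition of $p\in W_K\backslash W/W_J$ with $q\in W_J\backslash W/W_I$ given by $W_K(\overline p*\overline q)W_I$. The monoidal category $\mathcal{SC}(S_\star)$: objects are finite sequences $\underline n=(n_1,\dots,n_k)$ of non-negative integers, with concatenation as tensor product. Put $\sum\underline n=n_1+\cdots+n_k$ and $S_{\underline n}=S_{n_1}\times\cdots\times S_{n_k}\subset S_N$ with $N=\sum\underline n$, a parabolic subgroup of the symmetric group $S_N$. There are no morphisms $\underline n\to\underline m$ if $\sum\underline n\ne\sum\underline m$; if both sums equal $N$, then $\mathrm{Hom}(\underline n,\underline m)=S_{\underline m}\backslash S_N/S_{\underline n}$, composed as in $\mathcal{SC}(S_N)$. The tensor product of morphisms $p\in S_{\underline m}\backslash S_N/S_{\underline n}$ and $q\in S_{\underline m'}\backslash S_{N'}/S_{\underline n'}$ is the product double coset $p\times q\subset S_N\times S_{N'}\subset S_{N+N'}$ (regarded as a double coset of $S_{N+N'}$ for the concatenated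 sequences). The (non-linear, strict) monoidal category $\mathcal{SC}_{\mathrm{Webs}}$: same objects and tensor product on objects; the object $0$ is treated as the monoidal identity, and edges labelled $0$ may be erased freely. Morphisms are monoidally generated by merges $m_{a,b}:(a,b)\to(a+b)$ and splits $s_{a,b}:(a+b)\to(a,b)$ for $a,b\ge1$ (trivalent vertices, drawn from bottom to top), subject to the relations (for all valid labels): Bigon: $m_{a,b}\circ s_{a,b}=\mathrm{id}_{a+b}$. Associativity: $m_{a+b,c}(m_{a,b}\otimes\mathrm{id}_c)=m_{a,b+c}(\mathrm{id}_a\otimes m_{b,c})$. Coassociativity: $(s_{a,b}\otimes\mathrm{id}_c)s_{a+b,c}=(\mathrm{id}_a\otimes s_{b,c})s_{a,b+c}$. Square, for $1\le a,b\le N-1$ with $a+b<N$: $(\mathrm{id}_b\otimes m_{a,N-a-b})(s_{b,a}\otimes\mathrm{id}_{N-a-b})(m_{a,b}\otimes\mathrm{id}_{N-a-b})(\mathrm{id}_a\otimes s_{b,N-a-b})=s_{b,N-b}\,m_{a,N-a}$. Square, for $1\le a,b\le N-1$ with $a+b>N$: $(m_{a+b-N,N-a}\otimes\mathrm{id}_{N-b})(\mathrm{id}_{a+b-N}\otimes s_{N-a,N-b})(\mathrm{id}_{a+b-N}\otimes m_{N-b,N-a})(s_{a+b-N,N-b}\otimes\mathrm{id}_{N-a})=s_{b,N-b}\,m_{a,N-a}$. *)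

theory Defs
  imports "HOL-Algebra.Sym_Groups"
begin

section \<open>Strict monoidal categories and monoidal equivalence\<close>

record ('o, 'a) moncat =
  Obj  :: "'o set"
  Arr  :: "'a set"
  Dom  :: "'a \<Rightarrow> 'o"
  Cod  :: "'a \<Rightarrow> 'o"
  Idt  :: "'o \<Rightarrow> 'a"
  Comp :: "'a \<Rightarrow> 'a \<Rightarrow> 'a"  (infixr "\<cdot>\<index>" 70)
  Unit :: "'o"
  TObj :: "'o \<Rightarrow> 'o \<Rightarrow> 'o"  (infixr "\<boxdot>\<index>" 75)
  TArr :: "'a \<Rightarrow> 'a \<Rightarrow> 'a"  (infixr "\<boxtimes>\<index>" 75)

definition Hom :: "('o, 'a) moncat \<Rightarrow> 'o \<Rightarrow> 'o \<Rightarrow> 'a set" where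
  "Hom C X Y = {f \<in> Arr C. Dom C f = X \<and> Cod C f = Y}"

locale strict_monoidal_category =
  fixes C :: "('o, 'a) moncat" (structure)
  assumes Dom_Obj: "f \<in> Arr C \<Longrightarrow> Dom C f \<in> Obj C"
    and Cod_Obj: "f \<in> Arr C \<Longrightarrow> Cod C f \<in> Obj C"
    and Idt_Hom: "X \<in> Obj C \<Longrightarrow> Idt C X \<in> Hom C X X"
    and Comp_Hom: "\<lbrakk>g \<in> Hom C Y Z; f \<in> Hom C X Y\<rbrakk> \<Longrightarrow> g \<cdot> f \<in> Hom C X Z"
    and Comp_Idt: "f \<in> Hom C X Y \<Longrightarrow> f \<cdot> Idt C X = f"
    and Idt_Comp: "f \<in> Hom C X Y \<Longrightarrow> Idt C Y \<cdot> f = f"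
    and Comp_assoc:
      "\<lbrakk>h \<in> Hom C Z W; g \<in> Hom C Y Z; f \<in> Hom C X Y\<rbrakk> \<Longrightarrow> (h \<cdot> g) \<cdot> f = h \<cdot> (g \<cdot> f)"
    and Unit_Obj: "Unit C \<in> Obj C"
    and TObj_Obj: "\<lbrakk>X \<in> Obj C; Y \<in> Obj C\<rbrakk> \<Longrightarrow> X \<boxdot> Y \<in> Obj C"
    and TObj_assoc:
      "\<lbrakk>X \<in> Obj C; Y \<in> Obj C; Z \<in> Obj C\<rbrakk> \<Longrightarrow> (X \<boxdot> Y) \<boxdot> Z = X \<boxdot> (Y \<boxdot> Z)"
    and TObj_Unit: "X \<in> Obj C \<Longrightarrow> X \<boxdot> Unit C = X"
    and Unit_TObj: "X \<in> Obj C \<Longrightarrow> Unit C \<boxdot> X = X"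
    and TArr_Hom:
      "\<lbrakk>f \<in> Hom C X Y; f' \<in> Hom C X' Y'\<rbrakk> \<Longrightarrow> f \<boxtimes> f' \<in> Hom C (X \<boxdot> X') (Y \<boxdot> Y')"
    and TArr_Idt: "\<lbrakk>X \<in> Obj C; Y \<in> Obj C\<rbrakk> \<Longrightarrow> Idt C X \<boxtimes> Idt C Y = Idt C (X \<boxdot> Y)"
    and TArr_Comp:
      "\<lbrakk>g \<in> Hom C Y Z; f \<in> Hom C X Y; g' \<in> Hom C Y' Z'; f' \<in> Hom C X' Y'\<rbrakk>
        \<Longrightarrow> (g \<cdot> f) \<boxtimes> (g' \<cdot> f') = (g \<boxtimes> g') \<cdot> (f \<boxtimes> f')"
    and TArr_assoc:
      "\<lbrakk>f \<in> Arr C; g \<in> Arr C; h \<in> Arr C\<rbrakk> \<Longrightarrow> (f \<boxtimes> g) \<boxtimes> h = f \<boxtimes> (g \<boxtimes> h)"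
    and TArr_Unit: "f \<in> Arr C \<Longrightarrow> f \<boxtimes> Idt C (Unit C) = f"
    and Unit_TArr: "f \<in> Arr C \<Longrightarrow> Idt C (Unit C) \<boxtimes> f = f"

definition iso_in :: "('o, 'a) moncat \<Rightarrow> 'o \<Rightarrow> 'o \<Rightarrow> 'a \<Rightarrow> bool" where
  "iso_in C X Y f \<longleftrightarrow> f \<in> Hom C X Y \<and>
    (\<exists>g \<in> Hom C Y X. g \<cdot>\<^bsub>C\<^esub> f = Idt C X \<and> f \<cdot>\<^bsub>C\<^esub> g = Idt C Y)"

record ('o, 'a, 'p, 'b) monfun =
  FObj  :: "'o \<Rightarrow> 'p"
  FArr  :: "'a \<Rightarrow> 'b"
  FTen  :: "'o \<Rightarrow> 'o \<Rightarrow> 'b"  \<comment> \<open>\<open>F X \<otimes> F Y \<rightarrow> F (X \<otimes> Y)\<close>\<close>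
  FUnit :: "'b"  \<comment> \<open>\<open>1 \<rightarrow> F 1\<close>\<close>

text \<open>Strong monoidal functors; the associators and unitors of the coherence conditions are
  identities, because source and target are strict.\<close>

locale monoidal_functor =
  fixes C :: "('o, 'a) moncat" and D :: "('p, 'b) moncat" and F :: "('o, 'a, 'p, 'b) monfun"
  assumes FObj_Obj: "X \<in> Obj C \<Longrightarrow> FObj F X \<in> Obj D"
    and FArr_Hom: "f \<in> Hom C X Y \<Longrightarrow> FArr F f \<in> Hom D (FObj F X) (FObj F Y)"
    and FArr_Idt: "X \<in> Obj C \<Longrightarrow> FArr F (Idt C X) = Idt D (FObj F X)"
    and FArr_Comp:
      "\<lbrakk>g \<in> Hom C Y Z; f \<in> Hom C X Y\<rbrakk> \<Longrightarrow> FArr F (g \<cdot>\<^bsub>C\<^esub> f) = FArr F g \<cdot>\<^bsub>D\<^esub> FArr F f"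
    and FTen_iso:
      "\<lbrakk>X \<in> Obj C; Y \<in> Obj C\<rbrakk>
        \<Longrightarrow> iso_in D (FObj F X \<boxdot>\<^bsub>D\<^esub> FObj F Y) (FObj F (X \<boxdot>\<^bsub>C\<^esub> Y)) (FTen F X Y)"
    and FUnit_iso: "iso_in D (Unit D) (FObj F (Unit C)) (FUnit F)"
    and FTen_natural:
      "\<lbrakk>f \<in> Hom C X Y; f' \<in> Hom C X' Y'\<rbrakk>
        \<Longrightarrow> FTen F Y Y' \<cdot>\<^bsub>D\<^esub> (FArr F f \<boxtimes>\<^bsub>D\<^esub> FArr F f') = FArr F (f \<boxtimes>\<^bsub>C\<^esub> f') \<cdot>\<^bsub>D\<^esub> FTen F X X'"
    and FTen_assoc:
      "\<lbrakk>X \<in> Obj C; Y \<in> Obj C; Z \<in> Obj C\<rbrakk>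
        \<Longrightarrow> FTen F (X \<boxdot>\<^bsub>C\<^esub> Y) Z \<cdot>\<^bsub>D\<^esub> (FTen F X Y \<boxtimes>\<^bsub>D\<^esub> Idt D (FObj F Z))
          = FTen F X (Y \<boxdot>\<^bsub>C\<^esub> Z) \<cdot>\<^bsub>D\<^esub> (Idt D (FObj F X) \<boxtimes>\<^bsub>D\<^esub> FTen F Y Z)"
    and FTen_Unit_left:
      "X \<in> Obj C \<Longrightarrow> FTen F (Unit C) X \<cdot>\<^bsub>D\<^esub> (FUnit F \<boxtimes>\<^bsub>D\<^esub> Idt D (FObj F X)) = Idt D (FObj F X)"
    and FTen_Unit_right:
      "X \<in> Obj C \<Longrightarrow> FTen F X (Unit C) \<cdot>\<^bsub>D\<^esub> (Idt D (FObj F X) \<boxtimes>\<^bsub>D\<^esub> FUnit F) = Idt D (FObj F X)"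

definition id_monfun :: "('o, 'a) moncat \<Rightarrow> ('o, 'a, 'o, 'a) monfun" where
  "id_monfun C = \<lparr>FObj = (\<lambda>X. X), FArr = (\<lambda>f. f),
     FTen = (\<lambda>X Y. Idt C (X \<boxdot>\<^bsub>C\<^esub> Y)), FUnit = Idt C (Unit C)\<rparr>"

text \<open>The composite \<open>G \<circ> F\<close>, where \<open>E\<close> is the target of \<open>G\<close>.\<close>

definition comp_monfun ::
    "('q, 'c) moncat \<Rightarrow> ('p, 'b, 'q, 'c) monfun \<Rightarrow> ('o, 'a, 'p, 'b) monfun
      \<Rightarrow> ('o, 'a, 'q, 'c) monfun" where
  "comp_monfun E G F = \<lparr>FObj = (\<lambda>X. FObj G (FObj F X)), FArr = (\<lambda>f. FArr G (FArr F f)),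
     FTen = (\<lambda>X Y. FArr G (FTen F X Y) \<cdot>\<^bsub>E\<^esub> FTen G (FObj F X) (FObj F Y)),
     FUnit = FArr G (FUnit F) \<cdot>\<^bsub>E\<^esub> FUnit G\<rparr>"

locale monoidal_nat_iso =
  fixes C :: "('o, 'a) moncat" and D :: "('p, 'b) moncat"
    and F F' :: "('o, 'a, 'p, 'b) monfun" and \<tau> :: "'o \<Rightarrow> 'b"
  assumes component_iso: "X \<in> Obj C \<Longrightarrow> iso_in D (FObj F X) (FObj F' X) (\<tau> X)"
    and natural: "f \<in> Hom C X Y \<Longrightarrow> \<tau> Y \<cdot>\<^bsub>D\<^esub> FArr F f = FArr F' f \<cdot>\<^bsub>D\<^esub> \<tau> X"
    and monoidal_TObj:
      "\<lbrakk>X \<in> Obj C; Y \<in> Obj C\<rbrakk>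
        \<Longrightarrow> \<tau> (X \<boxdot>\<^bsub>C\<^esub> Y) \<cdot>\<^bsub>D\<^esub> FTen F X Y = FTen F' X Y \<cdot>\<^bsub>D\<^esub> (\<tau> X \<boxtimes>\<^bsub>D\<^esub> \<tau> Y)"
    and monoidal_Unit: "\<tau> (Unit C) \<cdot>\<^bsub>D\<^esub> FUnit F = FUnit F'"

definition monoidally_equivalent :: "('o, 'a) moncat \<Rightarrow> ('p, 'b) moncat \<Rightarrow> bool" where
  "monoidally_equivalent C D \<longleftrightarrow>
     strict_monoidal_category C \<and> strict_monoidal_category D \<and>
     (\<exists>F G \<eta> \<theta>. monoidal_functor C D F \<and> monoidal_functor D C G \<and>
        monoidal_nat_iso C C (id_monfun C) (comp_monfun C G F) \<eta> \<and>
        monoidal_nat_iso D D (comp_monfun D F G) (id_monfun D) \<theta>)"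

section \<open>Bruhat order and \<open>*\<close>-product\<close>

text \<open>The definitions make sense for any group \<open>G\<close> with a generating set \<open>S\<close> of involutions and
  are meant for Coxeter systems \<open>(G, S)\<close>.\<close>

definition cox_word :: "('w, 'b) monoid_scheme \<Rightarrow> 'w list \<Rightarrow> 'w" where
  "cox_word G ss = foldr (mult G) ss \<one>\<^bsub>G\<^esub>"

definition cox_length :: "('w, 'b) monoid_scheme \<Rightarrow> 'w set \<Rightarrow> 'w \<Rightarrow> nat" where
  "cox_length G S w = (LEAST k. \<exists>ss. set ss \<subseteq> S \<and> length ss = k \<and> cox_word G ss = w)"

definition reflections :: "('w, 'b) monoid_scheme \<Rightarrow> 'w set \<Rightarrow> 'w set" where
  "reflections G S = {w \<otimes>\<^bsub>G\<^esub> s \<otimes>\<^bsub>G\<^esub> inv\<^bsub>G\<^esub> w | w s. w \<in> carrier G \<and> s \<in> S}"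

definition bruhat_less :: "('w, 'b) monoid_scheme \<Rightarrow> 'w set \<Rightarrow> 'w \<Rightarrow> 'w \<Rightarrow> bool" where
  "bruhat_less G S = tranclp (\<lambda>x y. x \<in> carrier G \<and>
     (\<exists>t \<in> reflections G S. y = x \<otimes>\<^bsub>G\<^esub> t) \<and> cox_length G S x < cox_length G S y)"

definition star_product_on ::
    "('w, 'b) monoid_scheme \<Rightarrow> 'w set \<Rightarrow> ('w \<Rightarrow> 'w \<Rightarrow> 'w) \<Rightarrow> bool" where
  "star_product_on G S f \<longleftrightarrow>
     (\<forall>x\<in>carrier G. \<forall>y\<in>carrier G. f x y \<in> carrier G) \<and>
     (\<forall>x\<in>carrier G. \<forall>y\<in>carrier G. \<forall>z\<in>carrier G. f (f x y) z = f x (f y z)) \<and>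
     (\<forall>x\<in>carrier G. f \<one>\<^bsub>G\<^esub> x = x \<and> f x \<one>\<^bsub>G\<^esub> = x) \<and>
     (\<forall>x\<in>carrier G. \<forall>s\<in>S. f x s = (if bruhat_less G S x (x \<otimes>\<^bsub>G\<^esub> s) then x \<otimes>\<^bsub>G\<^esub> s else x))"

text \<open>The conditions above determine the product on the carrier, but not outside of it; hence the
  description is of the value and not of the operation. Without the condition on \<open>\<one>\<close> the values
  \<open>f x \<one>\<close> would not be determined.\<close>

definition star_product :: "('w, 'b) monoid_scheme \<Rightarrow> 'w set \<Rightarrow> 'w \<Rightarrow> 'w \<Rightarrow> 'w" where
  "star_product G S x y = (THE z. \<exists>f. star_product_on G S f \<and> z = f x y)"

definition bruhat_max :: "('w, 'b) monoid_scheme \<Rightarrow> 'w set \<Rightarrow> 'w set \<Rightarrow> 'w" where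
  "bruhat_max G S p = (THE x. x \<in> p \<and> (\<forall>y\<in>p. \<not> bruhat_less G S x y))"

definition double_coset :: "('w, 'b) monoid_scheme \<Rightarrow> 'w set \<Rightarrow> 'w \<Rightarrow> 'w set \<Rightarrow> 'w set" where
  "double_coset G H w K = H <#>\<^bsub>G\<^esub> {w} <#>\<^bsub>G\<^esub> K"

definition double_cosets :: "('w, 'b) monoid_scheme \<Rightarrow> 'w set \<Rightarrow> 'w set \<Rightarrow> 'w set set" where
  "double_cosets G H K = {double_coset G H w K | w. w \<in> carrier G}"

text \<open>Composition in the singular Coxeter monoid, of \<open>p\<close> in \<open>H\<setminus>G/L\<close> with \<open>q\<close> in \<open>L\<setminus>G/K\<close>, for
  parabolic subgroups \<open>H\<close>, \<open>L\<close>, \<open>K\<close>.\<close>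

definition sc_comp ::
    "('w, 'b) monoid_scheme \<Rightarrow> 'w set \<Rightarrow> 'w set \<Rightarrow> 'w set \<Rightarrow> 'w set \<Rightarrow> 'w set \<Rightarrow> 'w set" where
  "sc_comp G S H K p q =
     double_coset G H (star_product G S (bruhat_max G S p) (bruhat_max G S q)) K"

section \<open>The monoidal category of double cosets of symmetric groups\<close>

definition simple_transpositions :: "nat \<Rightarrow> (nat \<Rightarrow> nat) set" where
  "simple_transpositions N = {transpose i (Suc i) | i. 1 \<le> i \<and> i < N}"

definition young_block :: "nat list \<Rightarrow> nat \<Rightarrow> nat set" where
  "young_block n k = {sum_list (take k n) <.. sum_list (take (Suc k) n)}"

definition young :: "nat list \<Rightarrow> (nat \<Rightarrow> nat) set" where
  "young n = {w \<in> carrier (sym_group (sum_list n)).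
     \<forall>k < length n. w ` young_block n k = young_block n k}"

text \<open>The inclusion of \<open>S\<^sub>N \<times> S\<^sub>M\<close> into \<open>S\<^sub>N\<^sub>+\<^sub>M\<close>.\<close>

definition perm_sum :: "nat \<Rightarrow> (nat \<Rightarrow> nat) \<Rightarrow> (nat \<Rightarrow> nat) \<Rightarrow> nat \<Rightarrow> nat" where
  "perm_sum N x y = (\<lambda>i. if i \<le> N then x i else N + y (i - N))"

text \<open>A morphism is a triple of source, target and double coset. Permutations are composed as
  functions, so the subgroup of the target acts on values, from the left.\<close>

type_synonym sc_arr = "nat list \<times> nat list \<times> (nat \<Rightarrow> nat) set"

definition SC_Sym :: "(nat list, sc_arr) moncat" where
  "SC_Sym = \<lparr>
     Obj = UNIV,
     Arr = {(n, m, p). sum_list n = sum_list m \<and>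
              p \<in> double_cosets (sym_group (sum_list n)) (young m) (young n)},
     Dom = (\<lambda>(n, m, p). n),
     Cod = (\<lambda>(n, m, p). m),
     Idt = (\<lambda>n. (n, n, double_coset (sym_group (sum_list n)) (young n) id (young n))),
     Comp = (\<lambda>(m', k, p) (n, m, q).
       (n, k, sc_comp (sym_group (sum_list n)) (simple_transpositions (sum_list n))
                (young k) (young n) p q)),
     Unit = [],
     TObj = (@),
     TArr = (\<lambda>(n, m, p) (n', m', q).
       (n @ n', m @ m', {perm_sum (sum_list n) x y | x y. x \<in> p \<and> y \<in> q}))\<rparr>"

section \<open>The monoidal category of webs\<close>

text \<open>Terms for diagrams all of whose edges have a positive label, the typing judgement
  \<open>web_hom n m t\<close> (bottom \<open>n\<close>, top \<open>m\<close>), and the congruence that defines the strict monoidal category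
  presented by the merges and splits. \<open>WComp t u\<close> puts \<open>t\<close> on top of \<open>u\<close>.\<close>

datatype web =
    WId "nat list"
  | Merge nat nat
  | Split nat nat
  | WComp web web
  | WTens web web

inductive web_hom :: "nat list \<Rightarrow> nat list \<Rightarrow> web \<Rightarrow> bool" where
  hom_id: "0 \<notin> set n \<Longrightarrow> web_hom n n (WId n)"
| hom_merge: "\<lbrakk>a \<ge> 1; b \<ge> 1\<rbrakk> \<Longrightarrow> web_hom [a, b] [a + b] (Merge a b)"
| hom_split: "\<lbrakk>a \<ge> 1; b \<ge> 1\<rbrakk> \<Longrightarrow> web_hom [a + b] [a, b] (Split a b)"
| hom_comp: "\<lbrakk>web_hom m k t; web_hom n m u\<rbrakk> \<Longrightarrow> web_hom n k (WComp t u)"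
| hom_tens: "\<lbrakk>web_hom n m t; web_hom n' m' t'\<rbrakk> \<Longrightarrow> web_hom (n @ n') (m @ m') (WTens t t')"

inductive web_eq :: "nat list \<Rightarrow> nat list \<Rightarrow> web \<Rightarrow> web \<Rightarrow> bool" where
  eq_refl: "web_hom n m t \<Longrightarrow> web_eq n m t t"
| eq_sym: "web_eq n m t u \<Longrightarrow> web_eq n m u t"
| eq_trans: "\<lbrakk>web_eq n m t u; web_eq n m u v\<rbrakk> \<Longrightarrow> web_eq n m t v"
| cong_comp: "\<lbrakk>web_eq m k t t'; web_eq n m u u'\<rbrakk> \<Longrightarrow> web_eq n k (WComp t u) (WComp t' u')"
| cong_tens:
    "\<lbrakk>web_eq n m t t'; web_eq n' m' u u'\<rbrakk> \<Longrightarrow> web_eq (n @ n') (m @ m') (WTens t u) (WTens t' u')"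

| id_right: "web_hom n m t \<Longrightarrow> web_eq n m (WComp t (WId n)) t"
| id_left: "web_hom n m t \<Longrightarrow> web_eq n m (WComp (WId m) t) t"
| comp_assoc: "\<lbrakk>web_hom m l t; web_hom k m u; web_hom n k v\<rbrakk>
    \<Longrightarrow> web_eq n l (WComp (WComp t u) v) (WComp t (WComp u v))"
| unit_right: "web_hom n m t \<Longrightarrow> web_eq n m (WTens t (WId [])) t"
| unit_left: "web_hom n m t \<Longrightarrow> web_eq n m (WTens (WId []) t) t"
| tens_assoc: "\<lbrakk>web_hom n m t; web_hom n' m' u; web_hom n'' m'' v\<rbrakk>
    \<Longrightarrow> web_eq (n @ n' @ n'') (m @ m' @ m'') (WTens (WTens t u) v) (WTens t (WTens u v))"
| tens_id: "\<lbrakk>0 \<notin> set n; 0 \<notin> set n'\<rbrakk>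
    \<Longrightarrow> web_eq (n @ n') (n @ n') (WTens (WId n) (WId n')) (WId (n @ n'))"
| interchange: "\<lbrakk>web_hom m k t; web_hom n m u; web_hom m' k' t'; web_hom n' m' u'\<rbrakk>
    \<Longrightarrow> web_eq (n @ n') (k @ k') (WTens (WComp t u) (WComp t' u'))
          (WComp (WTens t t') (WTens u u'))"

| bigon: "\<lbrakk>a \<ge> 1; b \<ge> 1\<rbrakk>
    \<Longrightarrow> web_eq [a + b] [a + b] (WComp (Merge a b) (Split a b)) (WId [a + b])"
| assoc: "\<lbrakk>a \<ge> 1; b \<ge> 1; c \<ge> 1\<rbrakk>
    \<Longrightarrow> web_eq [a, b, c] [a + b + c]
          (WComp (Merge (a + b) c) (WTens (Merge a b) (WId [c])))
          (WComp (Merge a (b + c)) (WTens (WId [a]) (Merge b c)))"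
| coassoc: "\<lbrakk>a \<ge> 1; b \<ge> 1; c \<ge> 1\<rbrakk>
    \<Longrightarrow> web_eq [a + b + c] [a, b, c]
          (WComp (WTens (Split a b) (WId [c])) (Split (a + b) c))
          (WComp (WTens (WId [a]) (Split b c)) (Split a (b + c)))"
| square_less: "\<lbrakk>1 \<le> a; a \<le> N - 1; 1 \<le> b; b \<le> N - 1; a + b < N\<rbrakk>
    \<Longrightarrow> web_eq [a, N - a] [b, N - b]
          (WComp (WTens (WId [b]) (Merge a (N - a - b)))
          (WComp (WTens (Split b a) (WId [N - a - b]))
          (WComp (WTens (Merge a b) (WId [N - a - b]))
                 (WTens (WId [a]) (Split b (N - a - b))))))
          (WComp (Split b (N - b)) (Merge a (N - a)))"
| square_greater: "\<lbrakk>1 \<le> a; a \<le> N - 1; 1 \<le> b; b \<le> N - 1; a + b > N\<rbrakk>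
    \<Longrightarrow> web_eq [a, N - a] [b, N - b]
          (WComp (WTens (Merge (a + b - N) (N - a)) (WId [N - b]))
          (WComp (WTens (WId [a + b - N]) (Split (N - a) (N - b)))
          (WComp (WTens (WId [a + b - N]) (Merge (N - b) (N - a)))
                 (WTens (Split (a + b - N) (N - b)) (WId [N - a])))))
          (WComp (Split b (N - b)) (Merge a (N - a)))"

definition web_class :: "nat list \<Rightarrow> nat list \<Rightarrow> web \<Rightarrow> web set" where
  "web_class n m t = {u. web_eq n m t u}"

text \<open>Objects may contain the label \<open>0\<close>, but a diagram does not see it: a morphism between
  arbitrary sequences is a diagram between the sequences with all zeros erased. In particular
  \<open>[0]\<close> is isomorphic to the unit \<open>[]\<close> through the empty diagram.\<close>

definition erase_zeros :: "nat list \<Rightarrow> nat list" where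
  "erase_zeros n = filter (\<lambda>a. a \<noteq> 0) n"

type_synonym web_arr = "nat list \<times> nat list \<times> web set"

definition SC_Webs :: "(nat list, web_arr) moncat" where
  "SC_Webs = \<lparr>
     Obj = UNIV,
     Arr = {(n, m, web_class (erase_zeros n) (erase_zeros m) t) | n m t.
              web_hom (erase_zeros n) (erase_zeros m) t},
     Dom = (\<lambda>(n, m, c). n),
     Cod = (\<lambda>(n, m, c). m),
     Idt = (\<lambda>n. (n, n, web_class (erase_zeros n) (erase_zeros n) (WId (erase_zeros n)))),
     Comp = (\<lambda>(m', k, c) (n, m, d).
       (n, k, \<Union>t\<in>c. \<Union>u\<in>d. web_class (erase_zeros n) (erase_zeros k) (WComp t u))),
     Unit = [],
     TObj = (@),
     TArr = (\<lambda>(n, m, c) (n', m', d).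
       (n @ n', m @ m',
        \<Union>t\<in>c. \<Union>u\<in>d. web_class (erase_zeros (n @ n')) (erase_zeros (m @ m')) (WTens t u)))\<rparr>"

end

theory Submission
  imports Defs
begin

text \<open>A double coset of Young subgroups is determined by its Bruhat-maximal element. For a sequence
  \<open>n\<close> let \<open>w\<^sub>n\<close> be the longest element of the Young subgroup \<open>S\<^sub>n\<close>. The maximal elements of
  \<open>S\<^sub>m\<setminus>S\<^sub>N/S\<^sub>n\<close> are the permutations \<open>x\<close> with \<open>w\<^sub>m * x = x = x * w\<^sub>n\<close>, and the composite of two
  double cosets has the \<open>*\<close>-product of the maximal elements as its own maximal element. So the
  double cosets form the category that arises from the 0-Hecke monoids \<open>H\<^sub>N\<close> (that is, \<open>S\<^sub>N\<close>
  with the \<open>*\<close>-product) by splitting the idempotents \<open>w\<^sub>n\<close>.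

  The category of webs has the same shape. Every sequence \<open>n\<close> of positive integers with sum \<open>N\<close>
  is a retract of \<open>(1,\<dots>,1)\<close>, through the full split and the full merge, so it suffices to
  identify the endomorphisms of \<open>(1,\<dots>,1)\<close> with \<open>H\<^sub>N\<close>.

  Elements of \<open>H\<^sub>N\<close> are handled as words in the adjacent transpositions, up to the congruence
  generated by the idempotent, commutation and braid relations. By the theorem of Matsumoto two
  words are congruent as soon as they have the same value in \<open>H\<^sub>N\<close> (\<open>demazure_eq_imp_hecke\<close>). A
  web is read as a word: an identity gives \<open>w\<^sub>n\<close>, a merge or a split gives the longest element
  of the symmetric group on its strands, composites are concatenated, and tensor factors are put
  side by side. The web relations hold for these words (\<open>web_word_sound\<close>); the squares say that
  the \<open>*\<close>-product of the longest elements of three maximal parabolic subgroups is the longest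
  element of \<open>S\<^sub>N\<close>.

  In the other direction, a merge of two adjacent single strands followed by a split is a
  crossing. The squares on three strands give the braid relation for crossings, and the square
  with \<open>a = b = 1\<close> expands the full merge of \<open>k\<close> strands followed by the full split into the
  crossing diagram of a longest element (\<open>full_split_full_merge\<close>). Consequently a web, composed
  with a full merge below and a full split above, is the crossing diagram of its word
  (\<open>sandwich\<close>). This makes the assignment of double cosets to webs faithful
  (\<open>web_eq_of_demazure_eq\<close>) and full (\<open>web_of_word\<close>). It is the identity on objects and respects
  all operations, so it is an isomorphism of strict monoidal categories, which also carries the
  axioms from webs to double cosets (\<open>monoidally_equivalent_of_bijective\<close>).\<close>

section \<open>Words in the adjacent transpositions and the Demazure product\<close>

abbreviation adj :: "nat \<Rightarrow> nat \<Rightarrow> nat" where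
  "adj i \<equiv> transpose i (Suc i)"

text \<open>This is the product \<open>x * s\<^sub>i\<close>: one step of sorting the one-line notation of \<open>x\<close> into
  descending order.\<close>

definition bubble :: "(nat \<Rightarrow> nat) \<Rightarrow> nat \<Rightarrow> nat \<Rightarrow> nat" where
  "bubble x i = (if x i < x (Suc i) then x \<circ> adj i else x)"

definition demazure :: "nat list \<Rightarrow> nat \<Rightarrow> nat" where
  "demazure u = foldl bubble id u"

lemma demazure_Nil [simp]: "demazure [] = id"
  by (simp add: demazure_def)

lemma demazure_snoc [simp]: "demazure (u @ [i]) = bubble (demazure u) i"
  by (simp add: demazure_def)

lemma demazure_append: "demazure (u @ v) = foldl bubble (demazure u) v"
  by (simp add: demazure_def)

text \<open>The defining relations of the 0-Hecke monoids, for all \<open>N\<close> at once: the relations preserve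
  the letters that occur, so a derivation between words in \<open>{1..<N}\<close> does not leave these
  letters.\<close>

inductive hecke :: "nat list \<Rightarrow> nat list \<Rightarrow> bool" (infix "\<approx>" 50) where
  hecke_refl: "u \<approx> u"
| hecke_sym: "u \<approx> v \<Longrightarrow> v \<approx> u"
| hecke_trans: "u \<approx> v \<Longrightarrow> v \<approx> w \<Longrightarrow> u \<approx> w"
| hecke_ctx: "u \<approx> v \<Longrightarrow> p @ u @ q \<approx> p @ v @ q"
| hecke_idem: "[i, i] \<approx> [i]"
| hecke_far: "Suc i < j \<Longrightarrow> [i, j] \<approx> [j, i]"
| hecke_braid: "[i, Suc i, i] \<approx> [Suc i, i, Suc i]"

lemma bubble_idem: "bubble (bubble x i) i = bubble x i"
  by (simp add: bubble_def)

lemma bubble_far: "Suc i < j \<Longrightarrow> bubble (bubble x i) j = bubble (bubble x j) i"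
proof -
  assume "Suc i < j"
  then have "adj i j = j" "adj i (Suc j) = Suc j" "adj j i = i" "adj j (Suc i) = Suc i"
    and "adj i \<circ> adj j = adj j \<circ> adj i"
    by (auto simp: transpose_def fun_eq_iff)
  then show ?thesis by (simp add: bubble_def Fun.comp_assoc)
qed

lemma bubble_braid:
  "bubble (bubble (bubble x i) (Suc i)) i = bubble (bubble (bubble x (Suc i)) i) (Suc i)"
  by (auto simp: bubble_def fun_eq_iff transpose_def)

text \<open>The action on an arbitrary \<open>x\<close>, and not only on the identity, is what the closure of the
  congruence under contexts requires.\<close>

lemma hecke_foldl_bubble: "u \<approx> v \<Longrightarrow> foldl bubble x u = foldl bubble x v"
  by (induction arbitrary: x rule: hecke.induct) (simp_all add: bubble_idem bubble_far[symmetric] bubble_braid)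

lemma hecke_imp_demazure: "u \<approx> v \<Longrightarrow> demazure u = demazure v"
  by (simp add: demazure_def hecke_foldl_bubble)

lemma hecke_set: "u \<approx> v \<Longrightarrow> set u = set v"
  by (induction rule: hecke.induct) auto

lemma hecke_rev: "u \<approx> v \<Longrightarrow> rev u \<approx> rev v"
proof (induction rule: hecke.induct)
  case (hecke_far i j)
  then show ?case using hecke.hecke_far hecke.hecke_sym by simp
qed (auto intro: hecke.intros)

lemma hecke_append: "u \<approx> u' \<Longrightarrow> v \<approx> v' \<Longrightarrow> u @ v \<approx> u' @ v'"
  by (metis append.left_neutral append.right_neutral hecke_ctx hecke_trans)

section \<open>Inversions and reduced words\<close>

definition inversions :: "(nat \<Rightarrow> nat) \<Rightarrow> (nat \<times> nat) set" where
  "inversions x = {(i, j). i < j \<and> x j < x i}"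

definition ninv :: "(nat \<Rightarrow> nat) \<Rightarrow> nat" where
  "ninv x = card (inversions x)"

lemma finite_inversions:
  assumes "x permutes {1..N}"
  shows "finite (inversions x)"
proof (rule finite_subset)
  show "inversions x \<subseteq> {..N} \<times> {..N}"
  proof clarify
    fix i j assume "(i, j) \<in> inversions x"
    then have ij: "i < j" "x j < x i" by (auto simp: inversions_def)
    have "j \<le> N"
    proof (rule ccontr)
      assume "\<not> j \<le> N"
      then have "x j = j" using assms by (simp add: permutes_not_in)
      then have "x i \<notin> {1..N}" using ij \<open>\<not> j \<le> N\<close> by simp
      then have "i \<notin> {1..N}" using assms by (metis permutes_in_image)
      then have "x i = i" using assms by (simp add: permutes_not_in)
      then show False using ij \<open>x j = j\<close> by simp
    qed
    then show "i \<in> {..N} \<and> j \<in> {..N}" using ij by simp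
  qed
qed simp

lemma adj_less: "a < b \<Longrightarrow> (a, b) \<noteq> (i, Suc i) \<Longrightarrow> adj i a < adj i b"
  by (auto simp: transpose_def)

text \<open>The transposition of \<open>i\<close> and \<open>i + 1\<close> keeps the order of every other pair of positions, so
  it matches the inversions of \<open>x\<close> with those of \<open>x \<circ> s\<^sub>i\<close> other than \<open>(i, i + 1)\<close> itself.\<close>

lemma ninv_ascent:
  assumes x: "x permutes {1..N}" and i: "x i < x (Suc i)"
  shows "ninv (x \<circ> adj i) = Suc (ninv x)"
proof -
  let ?f = "map_prod (adj i) (adj i)"
  have "inversions (x \<circ> adj i) = insert (i, Suc i) (?f ` inversions x)"
  proof (rule Set.set_eqI)
    fix q :: "nat \<times> nat"
    obtain a b where q: "q = (a, b)" by (cases q)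
    have im: "q \<in> ?f ` inversions x \<longleftrightarrow> (adj i a, adj i b) \<in> inversions x"
    proof
      assume "q \<in> ?f ` inversions x"
      then show "(adj i a, adj i b) \<in> inversions x" by (auto simp: q)
    next
      assume "(adj i a, adj i b) \<in> inversions x"
      then have "?f (adj i a, adj i b) \<in> ?f ` inversions x" by (rule imageI)
      then show "q \<in> ?f ` inversions x" by (simp add: q)
    qed
    have ne: "(adj i a, adj i b) \<in> inversions x \<Longrightarrow> a < b"
    proof -
      assume *: "(adj i a, adj i b) \<in> inversions x"
      then have "(adj i a, adj i b) \<noteq> (i, Suc i)" using i by (auto simp: inversions_def)
      then show "a < b" using adj_less[of "adj i a" "adj i b" i] * by (auto simp: inversions_def)
    qed
    show "q \<in> inversions (x \<circ> adj i) \<longleftrightarrow> q \<in> insert (i, Suc i) (?f ` inversions x)"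
    proof (cases "q = (i, Suc i)")
      case True
      then show ?thesis using i by (auto simp: inversions_def)
    next
      case False
      have "q \<in> inversions (x \<circ> adj i) \<longleftrightarrow> (adj i a, adj i b) \<in> inversions x"
        using adj_less[of a b i] False ne by (auto simp: q inversions_def)
      then show ?thesis using False im by simp
    qed
  qed
  moreover have "(i, Suc i) \<notin> ?f ` inversions x"
    using i by (auto simp: inversions_def transpose_def split: if_splits)
  moreover have "inj ?f" by (simp add: prod.inj_map)
  ultimately show ?thesis
    using finite_inversions[OF x] unfolding ninv_def
    by (simp add: card_image inj_on_subset[OF _ subset_UNIV])
qed

lemma adj_permutes: "1 \<le> i \<Longrightarrow> i < N \<Longrightarrow> adj i permutes {1..N}"
  by (rule permutes_swap_id) auto

lemma adj_adj [simp]: "x \<circ> adj i \<circ> adj i = x"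
  by (simp add: fun_eq_iff)

lemma permutes_neq: "x permutes A \<Longrightarrow> x i \<noteq> x (Suc i)"
  by (metis n_not_Suc_n permutes_inj injD)

lemma ninv_descent:
  assumes x: "x permutes {1..N}" and "1 \<le> i" "i < N" and i: "x (Suc i) < x i"
  shows "ninv x = Suc (ninv (x \<circ> adj i))"
proof -
  have "(x \<circ> adj i) permutes {1..N}" using x adj_permutes assms permutes_compose by blast
  from ninv_ascent[OF this, of i] i show ?thesis by simp
qed

lemma bubble_permutes: "x permutes {1..N} \<Longrightarrow> 1 \<le> i \<Longrightarrow> i < N \<Longrightarrow> bubble x i permutes {1..N}"
  using permutes_compose[OF adj_permutes, of i N x] by (simp add: bubble_def)

lemma foldl_bubble_permutes:
  "x permutes {1..N} \<Longrightarrow> set u \<subseteq> {1..<N} \<Longrightarrow> foldl bubble x u permutes {1..N}"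
proof (induction u arbitrary: x)
  case (Cons i u)
  then show ?case using bubble_permutes[of x N i] by simp
qed simp

lemma demazure_permutes: "set u \<subseteq> {1..<N} \<Longrightarrow> demazure u permutes {1..N}"
  unfolding demazure_def by (rule foldl_bubble_permutes) (rule permutes_id)

lemma ninv_id [simp]: "ninv id = 0"
  by (auto simp: ninv_def inversions_def card_eq_0_iff)

text \<open>A permutation without descents is increasing, so \<open>i \<le> x i\<close> for all \<open>i\<close>, which only the
  identity satisfies.\<close>

lemma exists_descent:
  assumes x: "x permutes {1..N}" and "x \<noteq> id"
  shows "\<exists>i. 1 \<le> i \<and> i < N \<and> x (Suc i) < x i"
proof (rule ccontr)
  assume no: "\<not> ?thesis"
  have "x i < x (Suc i)" for i
  proof -
    consider "i = 0" | "1 \<le> i" "i < N" | "N \<le> i" by linarith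
    then show ?thesis
    proof cases
      case 1
      then have "x i = 0" using x by (simp add: permutes_not_in)
      then show ?thesis using permutes_neq[OF x, of i] by simp
    next
      case 2
      then show ?thesis using no permutes_neq[OF x, of i] by (meson linorder_neqE_nat)
    next
      case 3
      have "x (Suc i) = Suc i" using x 3 by (simp add: permutes_not_in)
      moreover have "x i \<le> i"
        using permutes_in_image[OF x, of i] permutes_not_in[OF x, of i] 3 by force
      ultimately show ?thesis by simp
    qed
  qed
  then have "i \<le> x i" for i by (simp add: strict_mono_Suc_iff strict_mono_imp_increasing)
  then have "x = id" using permutes_natset_ge[OF x] by simp
  with assms show False by simp
qed

lemma bubble_ascent_iff: "bubble x i = x \<longleftrightarrow> \<not> x i < x (Suc i)"
proof
  assume "bubble x i = x"
  then have "bubble x i i = x i" by simp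
  then show "\<not> x i < x (Suc i)" by (auto simp: bubble_def)
qed (simp add: bubble_def)

definition reduced :: "nat list \<Rightarrow> bool" where
  "reduced u \<longleftrightarrow> ninv (demazure u) = length u"

text \<open>Descents are removed one at a time. If \<open>x\<close> preserves the initial segment that ends at \<open>c\<close>,
  then \<open>c\<close> is not a descent, so the letter \<open>c\<close> does not occur. With this control of the letters,
  the lemma also shows that a Young subgroup is generated by the adjacent transpositions in it.\<close>

lemma exists_reduced_within:
  assumes "x permutes {1..N}" and "\<And>c. 1 \<le> c \<Longrightarrow> c < N \<Longrightarrow> c \<notin> A \<Longrightarrow> x ` {..c} = {..c}"
  shows "\<exists>u. set u \<subseteq> A \<inter> {1..<N} \<and> reduced u \<and> demazure u = x"
  using assms
proof (induction "ninv x" arbitrary: x rule: less_induct)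
  case less
  show ?case
  proof (cases "x = id")
    case True
    then show ?thesis by (intro exI[of _ "[]"]) (simp add: reduced_def)
  next
    case False
    then obtain i where i: "1 \<le> i" "i < N" "x (Suc i) < x i"
      using exists_descent less.prems by blast
    have iA: "i \<in> A"
    proof (rule ccontr)
      assume "i \<notin> A"
      then have im: "x ` {..i} = {..i}" using less.prems i by simp
      then have "x i \<le> i" by (metis atMost_iff imageI order_refl)
      moreover have "x (Suc i) \<notin> x ` {..i}"
        using permutes_inj[OF less.prems(1)] by (simp add: inj_image_mem_iff)
      ultimately show False using i im by auto
    qed
    let ?y = "x \<circ> adj i"
    have y: "?y permutes {1..N}" using less.prems i adj_permutes permutes_compose by blast
    have n: "ninv x = Suc (ninv ?y)" using ninv_descent less.prems i by blast
    have "?y ` {..c} = {..c}" if "1 \<le> c" "c < N" "c \<notin> A" for c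
    proof -
      have "i \<noteq> c" using iA that by blast
      then have "adj i ` {..c} = {..c}" by (intro transpose_image_eq) auto
      then show ?thesis using less.prems(2)[OF that] by (metis image_comp)
    qed
    with less.hyps[of ?y] y n obtain u where
      u: "set u \<subseteq> A \<inter> {1..<N}" "reduced u" "demazure u = ?y" by auto
    have "demazure (u @ [i]) = x" using i u by (simp add: bubble_def)
    then show ?thesis using u iA i n by (intro exI[of _ "u @ [i]"]) (simp add: reduced_def)
  qed
qed

lemma exists_reduced:
  assumes "x permutes {1..N}"
  shows "\<exists>u. set u \<subseteq> {1..<N} \<and> reduced u \<and> demazure u = x"
  using exists_reduced_within[OF assms, of UNIV] by auto

lemma ninv_bubble_le:
  "x permutes {1..N} \<Longrightarrow> ninv (bubble x i) \<le> Suc (ninv x) \<and> ninv x \<le> ninv (bubble x i)"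
  using ninv_ascent[of x N i] by (simp add: bubble_def)

lemma ninv_demazure_le: "set u \<subseteq> {1..<N} \<Longrightarrow> ninv (demazure u) \<le> length u"
proof (induction u rule: rev_induct)
  case (snoc i u)
  then show ?case using ninv_bubble_le[OF demazure_permutes[of u N], of i] by simp
qed simp

lemma reduced_snocD:
  assumes "reduced (u @ [i])" "set (u @ [i]) \<subseteq> {1..<N}"
  shows "reduced u" "demazure u i < demazure u (Suc i)"
    "demazure (u @ [i]) (Suc i) < demazure (u @ [i]) i" "demazure u = demazure (u @ [i]) \<circ> adj i"
proof -
  have x: "demazure u permutes {1..N}" using assms demazure_permutes by simp
  have *: "ninv (bubble (demazure u) i) = Suc (length u)" using assms by (simp add: reduced_def)
  have le: "ninv (demazure u) \<le> length u" using assms by (intro ninv_demazure_le[of _ N]) simp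
  show a: "demazure u i < demazure u (Suc i)"
    using * le by (auto simp: bubble_def split: if_splits)
  show "reduced u" using * ninv_ascent[OF x a] a by (simp add: reduced_def bubble_def)
  show "demazure (u @ [i]) (Suc i) < demazure (u @ [i]) i" "demazure u = demazure (u @ [i]) \<circ> adj i"
    using a by (simp_all add: bubble_def)
qed

lemma reduced_snocI:
  assumes "reduced u" "set (u @ [i]) \<subseteq> {1..<N}" "demazure u i < demazure u (Suc i)"
  shows "reduced (u @ [i])"
  using assms ninv_ascent[OF demazure_permutes[of u N], of i] by (simp add: reduced_def bubble_def)

section \<open>The theorem of Matsumoto\<close>

text \<open>Let the two reduced words of \<open>x\<close> end in \<open>i\<close> and \<open>j\<close>. Both letters are descents of \<open>x\<close>, so
  \<open>x\<close> also has reduced words that end in the two words for the longest element of the subgroup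
  generated by \<open>s\<^sub>i\<close> and \<open>s\<^sub>j\<close>. These are related by one commutation or braid, and the induction
  hypothesis relates each of them to one of the given words after the common last letter is
  removed.\<close>

lemma matsumoto:
  assumes "reduced u" "reduced v" "demazure u = demazure v" "set u \<subseteq> {1..<N}" "set v \<subseteq> {1..<N}"
  shows "u \<approx> v"
  using assms
proof (induction "length u" arbitrary: u v rule: less_induct)
  case less
  have len: "length u = length v" using less.prems by (simp add: reduced_def)
  show ?case
  proof (cases u rule: rev_cases)
    case Nil
    then show ?thesis using len by (simp add: hecke_refl)
  next
    case u: (snoc u0 i)
    then obtain v0 j where v: "v = v0 @ [j]" using len by (cases v rule: rev_cases) auto
    let ?x = "demazure u"
    have x: "?x permutes {1..N}" using less.prems demazure_permutes by blast
    note U = reduced_snocD[of u0 i N, folded u] and V = reduced_snocD[of v0 j N, folded v]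
    have ij: "1 \<le> i" "i < N" "1 \<le> j" "j < N" using less.prems u v by auto
    have u0: "reduced u0" "demazure u0 = ?x \<circ> adj i" "set u0 \<subseteq> {1..<N}"
      and di: "?x (Suc i) < ?x i"
      using U(1,3,4)[OF less.prems(1,4)] less.prems(4)[unfolded u] by simp_all
    have v0: "reduced v0" "demazure v0 = ?x \<circ> adj j" "set v0 \<subseteq> {1..<N}"
      and dj: "?x (Suc j) < ?x j"
      using V(1,3,4)[OF less.prems(2,5), folded less.prems(3)] less.prems(5)[unfolded v] by simp_all
    have ux: "reduced (t @ [k]) \<and> demazure (t @ [k]) = y"
      if "reduced t" "demazure t = y \<circ> adj k" "y (Suc k) < y k" "set t \<subseteq> {1..<N}" "1 \<le> k" "k < N" for t y k
      using that reduced_snocI[of t k N] by (simp add: bubble_def)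
    have red0: "\<exists>t. set t \<subseteq> {1..<N} \<and> reduced t \<and> demazure t = y" if "y permutes {1..N}" for y
      using exists_reduced that by blast
    have IH: "a \<approx> b" if "reduced a" "reduced b" "demazure a = demazure b" "set a \<subseteq> {1..<N}" "set b \<subseteq> {1..<N}"
        "length a < length u" for a b
      using less.hyps[of a b] that by blast
    have lens: "length u0 < length u" "length v0 < length u" using u v len by auto
    \<comment> \<open>the candidates for the common initial part of the reduced words: \<open>x\<close> without the two,
      respectively three, last letters\<close>
    have sp: "adj a permutes {1..N}" if "a \<in> {i, j}" for a
      using that ij adj_permutes by auto
    have p2: "(?x \<circ> adj a \<circ> adj b) permutes {1..N}" if "a \<in> {i, j}" "b \<in> {i, j}" for a b
      using permutes_compose[OF sp[OF that(2)] permutes_compose[OF sp[OF that(1)] x]] .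
    have p3: "(?x \<circ> adj a \<circ> adj b \<circ> adj a) permutes {1..N}" if "a \<in> {i, j}" "b \<in> {i, j}" for a b
      using permutes_compose[OF sp[OF that(1)] p2[OF that]] .
    have far: "u0 @ [i] \<approx> v0 @ [j]"
      if far: "Suc i < j \<or> Suc j < i"
    proof -
      have c: "?x \<circ> adj i \<circ> adj j = ?x \<circ> adj j \<circ> adj i"
        using far by (auto simp: fun_eq_iff transpose_def)
      obtain t where t: "set t \<subseteq> {1..<N}" "reduced t" "demazure t = ?x \<circ> adj i \<circ> adj j"
        using red0[OF p2[of i j]] by blast
      have "reduced (t @ [j]) \<and> demazure (t @ [j]) = ?x \<circ> adj i"
        by (rule ux) (use t ij dj far in \<open>auto simp: transpose_def\<close>)
      then have "u0 \<approx> t @ [j]" using IH[of u0 "t @ [j]"] u0 t ij lens by simp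
      moreover have "reduced (t @ [i]) \<and> demazure (t @ [i]) = ?x \<circ> adj j"
        by (rule ux) (use t ij di far c in \<open>auto simp: transpose_def\<close>)
      then have "v0 \<approx> t @ [i]" using IH[of v0 "t @ [i]"] v0 t ij lens by simp
      moreover have "[j, i] \<approx> [i, j]" using far hecke_far hecke_sym by blast
      then have "t @ [j, i] \<approx> t @ [i, j]" using hecke_append hecke_refl by blast
      ultimately show ?thesis
        using hecke_append[of u0 "t @ [j]" "[i]" "[i]"] hecke_append[of v0 "t @ [i]" "[j]" "[j]"]
        by (simp add: hecke_refl) (meson hecke_sym hecke_trans)
    qed
    have near: "u' @ [k] \<approx> v' @ [Suc k]"
      if "reduced u'" "reduced v'" "demazure u' = ?x \<circ> adj k" "demazure v' = ?x \<circ> adj (Suc k)"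
        "set u' \<subseteq> {1..<N}" "set v' \<subseteq> {1..<N}" "length u' < length u" "length v' < length u"
        "k \<in> {i, j}" "Suc k \<in> {i, j}" "?x (Suc k) < ?x k" "?x (Suc (Suc k)) < ?x (Suc k)" for u' v' k
    proof -
      have kij: "k \<in> {i, j}" "Suc k \<in> {i, j}" using that by auto
      then have k: "1 \<le> k" "k < N" "Suc k < N" using ij by auto
      have c: "?x \<circ> adj k \<circ> adj (Suc k) \<circ> adj k = ?x \<circ> adj (Suc k) \<circ> adj k \<circ> adj (Suc k)"
        by (auto simp: fun_eq_iff transpose_def)
      obtain t where t: "set t \<subseteq> {1..<N}" "reduced t" "demazure t = ?x \<circ> adj k \<circ> adj (Suc k) \<circ> adj k"
        using red0[OF p3[of k "Suc k"]] kij by blast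
      have 1: "reduced (t @ [k]) \<and> demazure (t @ [k]) = ?x \<circ> adj k \<circ> adj (Suc k)"
        by (rule ux) (use t k that in \<open>auto simp: transpose_def\<close>)
      have 2: "reduced ((t @ [k]) @ [Suc k]) \<and> demazure ((t @ [k]) @ [Suc k]) = ?x \<circ> adj k"
        by (rule ux) (use 1 t k that in \<open>auto simp: transpose_def\<close>)
      have 3: "reduced (t @ [Suc k]) \<and> demazure (t @ [Suc k]) = ?x \<circ> adj (Suc k) \<circ> adj k"
        by (rule ux) (use t c k that in \<open>auto simp: transpose_def\<close>)
      have 4: "reduced ((t @ [Suc k]) @ [k]) \<and> demazure ((t @ [Suc k]) @ [k]) = ?x \<circ> adj (Suc k)"
        by (rule ux) (use 3 t k that in \<open>auto simp: transpose_def\<close>)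
      have "u' \<approx> t @ [k, Suc k]" using IH[of u' "t @ [k, Suc k]"] that 2 t k by simp
      moreover have "v' \<approx> t @ [Suc k, k]" using IH[of v' "t @ [Suc k, k]"] that 4 t k by simp
      moreover have "t @ [k, Suc k, k] \<approx> t @ [Suc k, k, Suc k]"
        using hecke_append hecke_refl hecke_braid by blast
      ultimately have "u' @ [k] \<approx> t @ [k, Suc k, k]" "t @ [k, Suc k, k] \<approx> t @ [Suc k, k, Suc k]"
        "t @ [Suc k, k, Suc k] \<approx> v' @ [Suc k]"
        using hecke_append[of u' "t @ [k, Suc k]" "[k]" "[k]"]
          hecke_append[of v' "t @ [Suc k, k]" "[Suc k]" "[Suc k]"] hecke_sym
        by (simp_all add: hecke_refl)
      then show ?thesis using hecke_trans by blast
    qed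
    consider "i = j" | "Suc i < j \<or> Suc j < i" | "j = Suc i" | "i = Suc j" by linarith
    then show ?thesis
    proof cases
      case 1
      then have "u0 \<approx> v0" using IH u0 v0 lens by simp
      then show ?thesis using 1 u v hecke_append hecke_refl by simp
    next
      case 2
      then show ?thesis using far u v by simp
    next
      case 3
      have "u0 @ [i] \<approx> v0 @ [Suc i]" by (rule near) (use 3 u0 v0 lens di dj in simp_all)
      then show ?thesis using 3 u v by simp
    next
      case 4
      have "v0 @ [j] \<approx> u0 @ [Suc j]" by (rule near) (use 4 u0 v0 lens di dj in simp_all)
      then show ?thesis using 4 u v hecke_sym by simp
    qed
  qed
qed

text \<open>If a letter is appended to a reduced word and is a descent, then the reduced word is
  congruent to one that ends in the same letter, and idempotence absorbs it.\<close>

lemma hecke_reduced: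
  assumes "set u \<subseteq> {1..<N}"
  shows "\<exists>v. reduced v \<and> u \<approx> v"
  using assms
proof (induction u rule: rev_induct)
  case Nil
  then show ?case by (intro exI[of _ "[]"]) (simp add: reduced_def hecke_refl)
next
  case (snoc i u)
  then obtain v where v: "reduced v" "u \<approx> v" by auto
  have sv: "set v \<subseteq> {1..<N}" using v snoc.prems hecke_set by fastforce
  have i: "1 \<le> i" "i < N" using snoc.prems by auto
  have uv: "u @ [i] \<approx> v @ [i]" using v hecke_append hecke_refl by blast
  show ?case
  proof (cases "demazure v i < demazure v (Suc i)")
    case True
    then show ?thesis using reduced_snocI[of v i N] v sv i uv by auto
  next
    case False
    have x: "demazure v permutes {1..N}" using sv demazure_permutes by blast
    have d: "demazure v (Suc i) < demazure v i" using False permutes_neq[OF x, of i] by linarith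
    obtain t where t: "set t \<subseteq> {1..<N}" "reduced t" "demazure t = demazure v \<circ> adj i"
      using exists_reduced[of "demazure v \<circ> adj i" N] permutes_compose[OF adj_permutes[OF i] x] by blast
    have 1: "demazure (t @ [i]) = demazure v" using t d by (simp add: bubble_def)
    have "reduced (t @ [i])" using reduced_snocI[of t i N] t d i by simp
    then have e: "v \<approx> t @ [i]" using matsumoto[of v "t @ [i]" N] v sv t i 1 by simp
    then have "v @ [i] \<approx> t @ [i, i]" using hecke_append[OF e hecke_refl, of "[i]"] by simp
    moreover have "t @ [i, i] \<approx> t @ [i]" using hecke_append hecke_refl hecke_idem by blast
    ultimately have "v @ [i] \<approx> v" using e hecke_sym hecke_trans by meson
    then show ?thesis using uv v hecke_trans by blast
  qed
qed

text \<open>Equality of values is therefore a congruence for concatenation on both sides.\<close>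

theorem demazure_eq_imp_hecke:
  assumes "demazure u = demazure v" "set u \<subseteq> {1..<N}" "set v \<subseteq> {1..<N}"
  shows "u \<approx> v"
proof -
  obtain u' v' where *: "reduced u'" "u \<approx> u'" "reduced v'" "v \<approx> v'"
    using hecke_reduced assms by metis
  then have "u' \<approx> v'"
    using matsumoto[of u' v' N] assms hecke_imp_demazure[of u u'] hecke_imp_demazure[of v v']
      hecke_set[of u u'] hecke_set[of v v'] by simp
  then show ?thesis using * hecke_sym hecke_trans by meson
qed

section \<open>Ordinary products, inverses and reversed words\<close>

definition word_prod :: "nat list \<Rightarrow> nat \<Rightarrow> nat" where
  "word_prod u = foldr (\<lambda>i y. adj i \<circ> y) u id"

lemma word_prod_Nil [simp]: "word_prod [] = id"
  by (simp add: word_prod_def)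

lemma word_prod_Cons [simp]: "word_prod (i # u) = adj i \<circ> word_prod u"
  by (simp add: word_prod_def)

lemma word_prod_append: "word_prod (u @ v) = word_prod u \<circ> word_prod v"
  by (induction u) (simp_all add: Fun.comp_assoc)

lemma word_prod_snoc [simp]: "word_prod (u @ [i]) = word_prod u \<circ> adj i"
  by (simp only: word_prod_append word_prod_Cons word_prod_Nil comp_id)

lemma word_prod_permutes: "set u \<subseteq> {1..<N} \<Longrightarrow> word_prod u permutes {1..N}"
proof (induction u)
  case Nil
  show ?case by (simp only: word_prod_Nil permutes_id)
next
  case (Cons i u)
  then have "word_prod u permutes {1..N}" "adj i permutes {1..N}" using adj_permutes by auto
  then show ?case unfolding word_prod_Cons by (rule permutes_compose)
qed

lemma ninv_adj_cases:
  assumes "x permutes {1..N}" "1 \<le> i" "i < N"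
  obtains "x i < x (Suc i)" "ninv (x \<circ> adj i) = Suc (ninv x)"
  | "x (Suc i) < x i" "ninv x = Suc (ninv (x \<circ> adj i))"
  using ninv_ascent[OF assms(1), of i] ninv_descent[OF assms] permutes_neq[OF assms(1), of i]
  by (metis nat_neq_iff)

lemma ninv_word_prod_le: "set u \<subseteq> {1..<N} \<Longrightarrow> ninv (word_prod u) \<le> length u"
proof (induction u rule: rev_induct)
  case (snoc i u)
  then have "ninv (word_prod u \<circ> adj i) \<le> Suc (ninv (word_prod u))"
    using ninv_adj_cases[OF word_prod_permutes[of u N], of i] by force
  then show ?case using snoc by (simp del: comp_apply)
qed simp

text \<open>Each factor raises the number of inversions by at most one, so if the total is maximal
  then every letter is an ascent at its turn.\<close>

lemma reduced_of_word_prod: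
  assumes "ninv (word_prod u) = length u" "set u \<subseteq> {1..<N}"
  shows "reduced u \<and> demazure u = word_prod u"
  using assms
proof (induction u rule: rev_induct)
  case Nil
  then show ?case by (simp add: reduced_def)
next
  case (snoc i u)
  have i: "1 \<le> i" "i < N" and u: "set u \<subseteq> {1..<N}" using snoc.prems by auto
  have len: "ninv (word_prod u \<circ> adj i) = Suc (length u)"
    using snoc.prems(1) by (simp del: comp_apply)
  show ?case
    using word_prod_permutes[OF u] i
  proof (cases rule: ninv_adj_cases)
    case 1
    then have "reduced u \<and> demazure u = word_prod u" using len snoc.IH u by simp
    then show ?thesis using 1 reduced_snocI[of u i N] snoc.prems by (simp add: bubble_def)
  next
    case 2
    then show ?thesis using len ninv_word_prod_le[OF u] by simp
  qed
qed

lemma reduced_demazure_word_prod: "reduced u \<Longrightarrow> set u \<subseteq> {1..<N} \<Longrightarrow> demazure u = word_prod u"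
proof (induction u rule: rev_induct)
  case (snoc i u)
  then show ?case using reduced_snocD[of u i N] by (simp add: bubble_def)
qed simp

lemma word_prod_rev: "word_prod (rev u) = inv' (word_prod u)"
proof -
  have "word_prod (rev v) \<circ> word_prod v = id" for v
  proof (induction v)
    case (Cons i v)
    have "word_prod (rev (i # v)) \<circ> word_prod (i # v) = word_prod (rev v) \<circ> adj i \<circ> adj i \<circ> word_prod v"
      unfolding rev.simps word_prod_snoc word_prod_Cons by (simp only: Fun.comp_assoc)
    then show ?case using Cons by (simp only: adj_adj)
  qed simp
  from this[of u] this[of "rev u"] show ?thesis by (simp add: inv_unique_comp)
qed

lemma ninv_inverse:
  assumes x: "x permutes {1..N}"
  shows "ninv (inv' x) = ninv x"
proof -
  have le: "ninv (inv' y) \<le> ninv y" if y: "y permutes {1..N}" for y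
  proof -
    obtain u where u: "set u \<subseteq> {1..<N}" "reduced u" "demazure u = y" using exists_reduced[OF y] by blast
    then have "inv' y = word_prod (rev u)" using word_prod_rev reduced_demazure_word_prod by simp
    then show ?thesis using ninv_word_prod_le[of "rev u" N] u by (simp add: reduced_def)
  qed
  from le[OF x] le[OF permutes_inv[OF x]] x show ?thesis
    by (simp add: permutes_inv_inv)
qed

text \<open>The relations are stable under reversal, so the word may be assumed reduced; then the
  value is the ordinary product. The lemma turns statements about multiplication from the right
  into statements about multiplication from the left.\<close>

lemma demazure_rev:
  assumes "set u \<subseteq> {1..<N}"
  shows "demazure (rev u) = inv' (demazure u)"
proof -
  obtain v where v: "reduced v" "u \<approx> v" using hecke_reduced assms by blast
  have sv: "set v \<subseteq> {1..<N}" using assms hecke_set v(2) by simp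
  have "word_prod (rev v) = inv' (demazure v)" using word_prod_rev reduced_demazure_word_prod v sv by simp
  moreover have "ninv (inv' (demazure v)) = length v"
    using ninv_inverse[OF demazure_permutes[OF sv]] v(1) by (simp add: reduced_def)
  ultimately have "demazure (rev v) = inv' (demazure v)" using reduced_of_word_prod[of "rev v" N] sv by simp
  then show ?thesis using hecke_imp_demazure v(2) hecke_rev by metis
qed

section \<open>Coxeter length and the \<open>*\<close>-product\<close>

lemma cox_word_map_adj: "cox_word (sym_group N) (map adj u) = word_prod u"
  by (induction u) (simp_all add: cox_word_def sym_group_mult sym_group_one)

lemma simple_transpositions_eq: "simple_transpositions N = adj ` {1..<N}"
  by (auto simp: simple_transpositions_def)

lemma cox_length_eq_ninv:
  assumes x: "x permutes {1..N}"
  shows "cox_length (sym_group N) (simple_transpositions N) x = ninv x"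
  unfolding cox_length_def
proof (rule Least_equality)
  obtain u where u: "set u \<subseteq> {1..<N}" "reduced u" "demazure u = x" using exists_reduced[OF x] by blast
  show "\<exists>ss. set ss \<subseteq> simple_transpositions N \<and> length ss = ninv x \<and> cox_word (sym_group N) ss = x"
  proof (intro exI conjI)
    show "set (map adj u) \<subseteq> simple_transpositions N"
      using u by (auto simp: simple_transpositions_eq)
    show "length (map adj u) = ninv x" using u by (auto simp: reduced_def)
    show "cox_word (sym_group N) (map adj u) = x" using u reduced_demazure_word_prod by (simp add: cox_word_map_adj)
  qed
next
  fix k assume "\<exists>ss. set ss \<subseteq> simple_transpositions N \<and> length ss = k \<and> cox_word (sym_group N) ss = x"
  then obtain ss where ss: "set ss \<subseteq> adj ` {1..<N}" "length ss = k" "cox_word (sym_group N) ss = x"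
    by (auto simp: simple_transpositions_eq)
  then have "ss \<in> lists (adj ` {1..<N})" by (simp add: in_lists_conv_set subset_iff)
  then obtain u where u: "ss = map adj u" "set u \<subseteq> {1..<N}"
    by (auto simp: lists_image in_lists_conv_set)
  then show "ninv x \<le> k" using ss ninv_word_prod_le[OF u(2)] by (simp add: cox_word_map_adj)
qed

lemma bruhat_less_imp_length:
  "bruhat_less G S x y \<Longrightarrow> cox_length G S x < cox_length G S y"
  unfolding bruhat_less_def by (induction rule: tranclp_induct) auto

lemma inv_sym_group:
  assumes "x permutes {1..N}"
  shows "inv\<^bsub>sym_group N\<^esub> x = inv' x"
proof -
  interpret group "sym_group N" by (rule sym_group_is_group)
  show ?thesis
    using permutes_inv_o[OF assms] permutes_inv[OF assms] assms
    by (intro inv_equality) (simp_all add: sym_group_def)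
qed

text \<open>With \<open>w = id\<close> this is multiplication of \<open>x\<close> by \<open>s\<^sub>i\<close> from the right, and with \<open>w\<close> the
  inverse of \<open>x\<close> it is multiplication from the left.\<close>

lemma bruhat_less_conjugate:
  assumes "x permutes {1..N}" "w permutes {1..N}" "1 \<le> i" "i < N"
    and "ninv x < ninv (x \<circ> (w \<circ> adj i \<circ> inv' w))"
  shows "bruhat_less (sym_group N) (simple_transpositions N) x (x \<circ> (w \<circ> adj i \<circ> inv' w))"
proof -
  let ?t = "w \<circ> adj i \<circ> inv' w"
  have "?t permutes {1..N}"
    using assms adj_permutes by (intro permutes_compose permutes_inv) auto
  then have "x \<circ> ?t permutes {1..N}" using assms permutes_compose by blast
  moreover have "?t \<in> reflections (sym_group N) (simple_transpositions N)"
    unfolding reflections_def simple_transpositions_eq sym_group_mult mem_Collect_eq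
    using assms by (intro exI[of _ w] exI[of _ "adj i"]) (simp add: sym_group_carrier inv_sym_group)
  ultimately show ?thesis
    unfolding bruhat_less_def using assms
    by (intro tranclp.r_into_trancl) (auto simp: sym_group_mult sym_group_carrier cox_length_eq_ninv)
qed

lemma bruhat_less_adj_iff:
  assumes x: "x permutes {1..N}" and i: "1 \<le> i" "i < N"
  shows "bruhat_less (sym_group N) (simple_transpositions N) x (x \<circ> adj i) \<longleftrightarrow> x i < x (Suc i)"
proof -
  have y: "x \<circ> adj i permutes {1..N}" using permutes_compose[OF adj_permutes[OF i] x] .
  show ?thesis
    using x i
  proof (cases rule: ninv_adj_cases)
    case 1
    then show ?thesis
      using bruhat_less_conjugate[OF x permutes_id i] by simp
  next
    case 2
    then show ?thesis
      using bruhat_less_imp_length[of "sym_group N" "simple_transpositions N" x "x \<circ> adj i"]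
      by (auto simp: cox_length_eq_ninv[OF x] cox_length_eq_ninv[OF y])
  qed
qed

lemma demazure_append_cong:
  assumes "demazure u = demazure u'" "demazure v = demazure v'"
    and "set u \<subseteq> {1..<N}" "set u' \<subseteq> {1..<N}" "set v \<subseteq> {1..<N}" "set v' \<subseteq> {1..<N}"
  shows "demazure (u @ v) = demazure (u' @ v')"
  using assms demazure_eq_imp_hecke[of u u' N] demazure_eq_imp_hecke[of v v' N]
  by (intro hecke_imp_demazure hecke_append) auto

text \<open>The defining conditions determine the product \<open>f x y\<close> by recursion along a word for \<open>y\<close>.\<close>

lemma star_product_on_demazure:
  assumes f: "star_product_on (sym_group N) (simple_transpositions N) f"
    and x: "x permutes {1..N}" and v: "set v \<subseteq> {1..<N}"
  shows "f x (demazure v) = foldl bubble x v"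
  using v
proof (induction v rule: rev_induct)
  case Nil
  have "f x id = x"
    using f x unfolding star_product_on_def sym_group_carrier[symmetric] sym_group_one by blast
  then show ?case by (simp only: demazure_Nil foldl.simps)
next
  case (snoc i v)
  have v: "set v \<subseteq> {1..<N}" and i: "1 \<le> i" "i < N" using snoc.prems by auto
  have s: "f y (adj i) = bubble y i" if y: "y permutes {1..N}" for y
    using f y i bruhat_less_adj_iff[OF y i] unfolding star_product_on_def bubble_def
    by (simp add: sym_group_carrier sym_group_mult simple_transpositions_eq)
  have "f x (demazure (v @ [i])) = f x (f (demazure v) (adj i))" using s demazure_permutes[OF v] by simp
  also have "\<dots> = f (f x (demazure v)) (adj i)"
    using f x demazure_permutes[OF v] adj_permutes[OF i]
    by (simp add: star_product_on_def sym_group_carrier)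
  also have "\<dots> = foldl bubble x (v @ [i])"
    using snoc.IH v s foldl_bubble_permutes[OF x v] by simp
  finally show ?case .
qed

text \<open>Chosen words are concatenated. The value does not depend on the choice because equality of
  values is a congruence, and associativity is that of concatenation.\<close>

lemma star_product_on_exists:
  "\<exists>f. star_product_on (sym_group N) (simple_transpositions N) f"
proof -
  define wd where "wd y = (SOME v. set v \<subseteq> {1..<N} \<and> demazure v = y)" for y
  have wd: "set (wd y) \<subseteq> {1..<N}" "demazure (wd y) = y" if "y permutes {1..N}" for y
  proof -
    have "\<exists>v. set v \<subseteq> {1..<N} \<and> demazure v = y" using exists_reduced[OF that] by blast
    then have "set (wd y) \<subseteq> {1..<N} \<and> demazure (wd y) = y" unfolding wd_def by (rule someI_ex)
    then show "set (wd y) \<subseteq> {1..<N}" "demazure (wd y) = y" by auto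
  qed
  define f where "f x y = demazure (wd x @ wd y)" for x y
  have fd: "f (demazure u) (demazure v) = demazure (u @ v)" if u: "set u \<subseteq> {1..<N}" and v: "set v \<subseteq> {1..<N}" for u v
    unfolding f_def
    by (rule demazure_append_cong[of _ _ _ _ N]) (use u v wd demazure_permutes in auto)
  have ex: "\<exists>v. set v \<subseteq> {1..<N} \<and> y = demazure v" if "y \<in> carrier (sym_group N)" for y
    using that exists_reduced[of y N] unfolding sym_group_carrier by metis
  have "star_product_on (sym_group N) (simple_transpositions N) f"
    unfolding star_product_on_def sym_group_one
  proof (intro conjI ballI)
    fix x y assume "x \<in> carrier (sym_group N)" "y \<in> carrier (sym_group N)"
    then obtain u v where "set u \<subseteq> {1..<N}" "x = demazure u" "set v \<subseteq> {1..<N}" "y = demazure v"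
      using ex by meson
    then show "f x y \<in> carrier (sym_group N)" using demazure_permutes[of "u @ v" N] fd by (simp add: sym_group_carrier)
  next
    fix x y z assume "x \<in> carrier (sym_group N)" "y \<in> carrier (sym_group N)" "z \<in> carrier (sym_group N)"
    then obtain u v w where "set u \<subseteq> {1..<N}" "x = demazure u" "set v \<subseteq> {1..<N}" "y = demazure v"
      "set w \<subseteq> {1..<N}" "z = demazure w" using ex by meson
    then show "f (f x y) z = f x (f y z)" using fd[of u v] fd[of v w] fd[of "u @ v" w] fd[of u "v @ w"] by simp
  next
    fix x assume "x \<in> carrier (sym_group N)"
    then obtain u where "set u \<subseteq> {1..<N}" "x = demazure u" using ex by meson
    then show "f id x = x" "f x id = x" using fd[of "[]" u] fd[of u "[]"] by simp_all
  next
    fix x s assume x: "x \<in> carrier (sym_group N)" and "s \<in> simple_transpositions N"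
    then obtain i where i: "1 \<le> i" "i < N" "s = adj i" by (auto simp: simple_transpositions_eq)
    obtain u where u: "set u \<subseteq> {1..<N}" "x = demazure u" using x ex by meson
    have "demazure [i] = s" using demazure_snoc[of "[]" i] i by (simp add: bubble_def)
    then have "f x s = bubble x i" using fd[of u "[i]"] u i by simp
    then show "f x s = (if bruhat_less (sym_group N) (simple_transpositions N) x (x \<otimes>\<^bsub>sym_group N\<^esub> s)
        then x \<otimes>\<^bsub>sym_group N\<^esub> s else x)"
      using bruhat_less_adj_iff[of x N i] i x by (simp add: sym_group_mult bubble_def sym_group_carrier)
  qed
  then show ?thesis by blast
qed

lemma star_product_demazure:
  assumes u: "set u \<subseteq> {1..<N}" and v: "set v \<subseteq> {1..<N}"
  shows "star_product (sym_group N) (simple_transpositions N) (demazure u) (demazure v) = demazure (u @ v)"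
  unfolding star_product_def
  using star_product_on_exists[of N] star_product_on_demazure[OF _ demazure_permutes[OF u] v]
  by (intro the_equality) (metis demazure_append)+

section \<open>Longest words of Young subgroups\<close>

lemma hecke_shift: "u \<approx> v \<Longrightarrow> map ((+) a) u \<approx> map ((+) a) v"
  by (induction rule: hecke.induct) (auto intro: hecke.intros)

declare hecke_trans [trans]

lemma hecke_far_letter: "\<forall>j\<in>set u. Suc i < j \<Longrightarrow> i # u \<approx> u @ [i]"
proof (induction u)
  case (Cons j u)
  have "[i, j] @ u \<approx> [j, i] @ u" using Cons.prems by (intro hecke_append hecke_far hecke_refl) auto
  also have "[j, i] @ u \<approx> [j] @ (u @ [i])"
    using hecke_append[OF hecke_refl Cons.IH, of "[j]"] Cons.prems by simp
  finally show ?case by simp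
qed (simp add: hecke_refl)

lemma hecke_far_words: "\<forall>i\<in>set u. \<forall>j\<in>set v. Suc i < j \<Longrightarrow> u @ v \<approx> v @ u"
proof (induction u)
  case (Cons i u)
  have "u @ v \<approx> v @ u" using Cons by auto
  then have "[i] @ (u @ v) \<approx> [i] @ (v @ u)" by (rule hecke_append[OF hecke_refl])
  also have "[i] @ (v @ u) \<approx> (v @ [i]) @ u"
    using hecke_append[OF hecke_far_letter hecke_refl, of v i u] Cons.prems by simp
  finally show ?case by simp
qed (simp add: hecke_refl)

lemma hecke_absorb_word: "\<forall>i\<in>set v. u @ [i] \<approx> u \<Longrightarrow> u @ v \<approx> u"
proof (induction v)
  case (Cons i v)
  have "(u @ [i]) @ v \<approx> u @ v" using Cons.prems by (intro hecke_append hecke_refl) auto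
  also have "u @ v \<approx> u" using Cons by simp
  finally show ?case by simp
qed (simp add: hecke_refl)

lemma hecke_absorb_word_left: "\<forall>i\<in>set v. i # u \<approx> u \<Longrightarrow> v @ u \<approx> u"
proof (induction v)
  case (Cons i v)
  have "[i] @ (v @ u) \<approx> [i] @ u" using Cons by (intro hecke_append hecke_refl) auto
  also have "[i] @ u \<approx> u" using Cons by simp
  finally show ?case by simp
qed (simp add: hecke_refl)

text \<open>A word for the longest element of the symmetric group on \<open>k\<close> letters. It is far from
  reduced; the shape is the one in which the square relation expands a full merge followed by a
  full split.\<close>

fun w0 :: "nat \<Rightarrow> nat list" where
  "w0 0 = []"
| "w0 (Suc 0) = []"
| "w0 (Suc (Suc k)) = map Suc (w0 (Suc k)) @ [1] @ map Suc (w0 (Suc k))"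

lemma set_w0: "set (w0 k) \<subseteq> {1..<k}"
  by (induction k rule: w0.induct) auto

lemma rev_w0: "rev (w0 k) = w0 k"
  by (induction k rule: w0.induct) (simp_all add: rev_map)

lemma hecke_map_Suc: "u \<approx> v \<Longrightarrow> map Suc u \<approx> map Suc v"
  using hecke_shift[of u v "Suc 0"] by (simp only: plus_1_eq_Suc[unfolded One_nat_def])

text \<open>A letter \<open>i \<ge> 2\<close> is absorbed by the last block. The letter \<open>1\<close> commutes with all of the
  last block except for a single \<open>2\<close>, and with the middle letter of the word this makes \<open>1 2 1\<close>.
  The braid relation gives \<open>2 1 2\<close>, and the first block absorbs the leading \<open>2\<close>.\<close>

lemma w0_absorb: "1 \<le> i \<Longrightarrow> i < k \<Longrightarrow> w0 k @ [i] \<approx> w0 k"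
proof (induction k arbitrary: i rule: w0.induct)
  case (3 k)
  define W where "W = map Suc (w0 (Suc k))"
  have w0: "w0 (Suc (Suc k)) = W @ [1] @ W" by (simp add: W_def)
  have abs: "W @ [j] \<approx> W" if "2 \<le> j" "j < Suc (Suc k)" for j
  proof -
    have "w0 (Suc k) @ [j - 1] \<approx> w0 (Suc k)" using that by (intro "3.IH") auto
    from hecke_map_Suc[OF this] that show ?thesis by (simp add: W_def)
  qed
  show ?case
  proof (cases "i = 1")
    case False
    then have "W @ [i] \<approx> W" using 3 by (intro abs) auto
    then have "(W @ [1]) @ (W @ [i]) \<approx> (W @ [1]) @ W"
      by (rule hecke_append[OF hecke_refl])
    then show ?thesis unfolding w0 by simp
  next
    case i: True
    show ?thesis
    proof (cases k)
      case 0
      then show ?thesis using i hecke_idem[of 1] by simp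
    next
      case (Suc l)
      define V where "V = map Suc (map Suc (w0 (Suc l)))"
      have W: "W = V @ [2] @ V" using Suc by (simp add: numeral_2_eq_2 W_def V_def)
      have V: "j \<in> {3..<Suc (Suc k)}" if "j \<in> set V" for j
        using set_w0[of "Suc l"] Suc that unfolding V_def by fastforce
      have c: "[1] @ V \<approx> V @ [1]" using hecke_far_letter[of V 1] V by force
      have WV: "W @ V \<approx> W"
      proof (rule hecke_absorb_word, rule ballI)
        fix j assume "j \<in> set V"
        then show "W @ [j] \<approx> W" using V[of j] by (intro abs) auto
      qed
      have eq: "W @ [1] @ W \<approx> W @ [1, 2] @ V"
      proof -
        have "W @ [1] @ W = W @ ([1] @ V) @ [2] @ V" unfolding W by simp
        also have "\<dots> \<approx> W @ (V @ [1]) @ [2] @ V"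
          by (intro hecke_append hecke_refl c)
        also have "W @ (V @ [1]) @ [2] @ V = (W @ V) @ [1, 2] @ V" by simp
        also have "\<dots> \<approx> W @ [1, 2] @ V" by (intro hecke_append hecke_refl WV)
        finally show ?thesis .
      qed
      have "(W @ [1] @ W) @ [1] \<approx> (W @ [1, 2] @ V) @ [1]" by (intro hecke_append hecke_refl eq)
      also have "\<dots> = (W @ [1, 2]) @ V @ [1]" by simp
      also have "\<dots> \<approx> (W @ [1, 2]) @ [1] @ V" by (intro hecke_append hecke_refl hecke_sym[OF c])
      also have "(W @ [1, 2]) @ [1] @ V = W @ [1, Suc 1, 1] @ V" by (simp add: numeral_2_eq_2)
      also have "\<dots> \<approx> W @ [Suc 1, 1, Suc 1] @ V" by (intro hecke_append hecke_refl hecke_braid)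
      also have "W @ [Suc 1, 1, Suc 1] @ V = (W @ [2]) @ [1, 2] @ V" by (simp add: numeral_2_eq_2)
      also have "\<dots> \<approx> W @ [1, 2] @ V" using Suc by (intro hecke_append hecke_refl abs) auto
      also have "\<dots> \<approx> W @ [1] @ W" by (rule hecke_sym[OF eq])
      finally show ?thesis unfolding i w0 .
    qed
  qed
qed auto

fun young_word :: "nat list \<Rightarrow> nat list" where
  "young_word [] = []"
| "young_word (a # n) = w0 a @ map ((+) a) (young_word n)"

definition cuts :: "nat list \<Rightarrow> nat set" where
  "cuts n = (\<lambda>k. sum_list (take k n)) ` {..length n}"

lemma cuts_Nil [simp]: "cuts [] = {0}"
  by (simp add: cuts_def)

lemma cuts_Cons [simp]: "cuts (a # n) = insert 0 ((+) a ` cuts n)"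
  unfolding cuts_def by (simp add: atMost_Suc_eq_insert_0 image_image)

lemma zero_in_cuts [simp]: "0 \<in> cuts n"
  by (cases n) auto

lemma cuts_append: "cuts (n @ n') = cuts n \<union> (+) (sum_list n) ` cuts n'"
proof (induction n)
  case (Cons a n)
  then show ?case by (simp add: image_Un image_image add.assoc)
qed (simp add: insert_absorb)

text \<open>The indices of the adjacent transpositions in the Young subgroup.\<close>

definition letters :: "nat list \<Rightarrow> nat set" where
  "letters n = {1..<sum_list n} - cuts n"

lemma letters_subset: "letters n \<subseteq> {1..<sum_list n}"
  by (auto simp: letters_def)

lemma letters_Cons_cases:
  assumes "i \<in> letters (a # n)"
  obtains "1 \<le> i" "i < a" | j where "i = a + j" "j \<in> letters n"
proof -
  have i: "1 \<le> i" "i < a + sum_list n" "i \<notin> (+) a ` cuts n" using assms by (auto simp: letters_def)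
  have "i \<noteq> a" using i by (metis add_0_right image_eqI zero_in_cuts)
  show ?thesis
  proof (cases "i < a")
    case False
    then have "i = a + (i - a)" "i - a \<in> letters n" using i \<open>i \<noteq> a\<close>
      by (auto simp: letters_def image_iff)
    then show ?thesis using that by blast
  qed (use that i in blast)
qed

lemma letters_ConsI: "1 \<le> i \<Longrightarrow> i < a \<Longrightarrow> i \<in> letters (a # n)"
  by (auto simp: letters_def)

lemma letters_shiftI: "j \<in> letters n \<Longrightarrow> a + j \<in> letters (a # n)"
  by (auto simp: letters_def)

lemma set_young_word: "set (young_word n) \<subseteq> letters n"
proof (induction n)
  case (Cons a n)
  then show ?case using set_w0[of a] letters_ConsI[of _ a n] letters_shiftI[of _ n a] by fastforce
qed simp

lemma young_word_absorb: "i \<in> letters n \<Longrightarrow> young_word n @ [i] \<approx> young_word n"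
proof (induction n arbitrary: i)
  case Nil
  then show ?case by (simp add: letters_def)
next
  case (Cons a n)
  let ?V = "map ((+) a) (young_word n)"
  have V: "set ?V \<subseteq> {Suc a..}" using set_young_word[of n] letters_subset[of n] by fastforce
  from Cons.prems show ?case
  proof (cases rule: letters_Cons_cases)
    case 1
    have "w0 a @ (?V @ [i]) \<approx> w0 a @ (i # ?V)"
      using V 1 by (intro hecke_append hecke_refl hecke_sym[OF hecke_far_letter]) auto
    also have "w0 a @ (i # ?V) \<approx> (w0 a @ [i]) @ ?V" by (simp add: hecke_refl)
    also have "\<dots> \<approx> w0 a @ ?V" using 1 by (intro hecke_append hecke_refl w0_absorb)
    finally show ?thesis by simp
  next
    case (2 j)
    from hecke_shift[OF Cons.IH[OF 2(2)], of a] have "?V @ [i] \<approx> ?V" using 2 by simp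
    then have "w0 a @ (?V @ [i]) \<approx> w0 a @ ?V" by (intro hecke_append hecke_refl)
    then show ?thesis by simp
  qed
qed

lemma rev_young_word: "rev (young_word n) \<approx> young_word n"
proof (induction n)
  case (Cons a n)
  let ?V = "map ((+) a) (young_word n)"
  have V: "set ?V \<subseteq> {Suc a..}" using set_young_word[of n] letters_subset[of n] by fastforce
  have "rev (young_word (a # n)) \<approx> map ((+) a) (rev (young_word n)) @ w0 a" by (simp add: rev_w0 rev_map hecke_refl)
  also have "\<dots> \<approx> ?V @ w0 a" by (intro hecke_append hecke_refl hecke_shift Cons.IH)
  also have "\<dots> \<approx> w0 a @ ?V" using V set_w0[of a] by (intro hecke_sym[OF hecke_far_words]) fastforce
  finally show ?case by simp
qed (simp add: hecke_refl)

lemma young_word_absorb_left: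
  assumes "i \<in> letters n"
  shows "i # young_word n \<approx> young_word n"
proof -
  have "[i] @ young_word n \<approx> [i] @ rev (young_word n)" by (intro hecke_append hecke_refl hecke_sym[OF rev_young_word])
  also have "\<dots> \<approx> rev (young_word n)" using hecke_rev[OF young_word_absorb[OF assms]] by simp
  also have "\<dots> \<approx> young_word n" by (rule rev_young_word)
  finally show ?thesis by simp
qed

lemma young_word_append: "young_word (n @ n') = young_word n @ map ((+) (sum_list n)) (young_word n')"
  by (induction n) (simp_all add: add.assoc)

lemma w0_absorb_left: "1 \<le> i \<Longrightarrow> i < k \<Longrightarrow> i # w0 k \<approx> w0 k"
  using hecke_rev[OF w0_absorb[of i k]] by (simp add: rev_w0)

section \<open>Young subgroups\<close>

lemma letters_append: "letters (n @ n') = letters n \<union> (+) (sum_list n) ` letters n'"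
proof -
  have c: "c \<le> sum_list n" if "c \<in> cuts n" for c
    using that unfolding cuts_def
    by (auto simp: sum_list_append[symmetric] simp flip: append_take_drop_id)
       (metis append_take_drop_id le_add1 sum_list_append)
  have "sum_list n \<in> cuts n" unfolding cuts_def by (rule image_eqI[of _ _ "length n"]) auto
  have "i \<in> letters (n @ n') \<longleftrightarrow> i \<in> letters n \<union> (+) (sum_list n) ` letters n'" for i
  proof (cases "i < sum_list n")
    case True
    then have "i \<notin> (+) (sum_list n) ` X" for X by auto
    then show ?thesis using True by (auto simp: letters_def cuts_append)
  next
    case False
    then obtain j where j: "i = sum_list n + j" using le_Suc_ex not_less by blast
    have im: "i \<in> (+) (sum_list n) ` X \<longleftrightarrow> j \<in> X" for X using j by auto
    have "i \<notin> letters n" using False by (auto simp: letters_def)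
    moreover have "i \<in> cuts n \<longleftrightarrow> j = 0" using c[of i] j \<open>sum_list n \<in> cuts n\<close> by auto
    ultimately show ?thesis
      unfolding Un_iff im using j by (cases "j = 0") (auto simp: letters_def cuts_append im)
  qed
  then show ?thesis by blast
qed

text \<open>Unions of blocks are initial segments, which an element of the subgroup preserves as well.
  Segments suit induction better than blocks and do not see blocks of size zero.\<close>

lemma young_eq_cuts:
  "young n = {w. w permutes {1..sum_list n} \<and> (\<forall>c\<in>cuts n. w ` {..c} = {..c})}"
proof -
  let ?S = "\<lambda>k. sum_list (take k n)"
  have 1: "(\<forall>k < length n. w ` young_block n k = young_block n k) \<longleftrightarrow> (\<forall>k\<le>length n. w ` {..?S k} = {..?S k})"
    if w: "w permutes {1..sum_list n}" for w
  proof (intro iffI allI impI)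
    fix k assume b: "\<forall>k < length n. w ` young_block n k = young_block n k" and "k \<le> length n"
    then show "w ` {..?S k} = {..?S k}"
    proof (induction k)
      case 0
      then show ?case using w by (simp add: permutes_not_in)
    next
      case (Suc k)
      have "?S k \<le> ?S (Suc k)" using Suc.prems by (simp add: take_Suc_conv_app_nth)
      then have "{..?S (Suc k)} = {..?S k} \<union> young_block n k" by (auto simp: young_block_def)
      then show ?case using Suc by (simp add: image_Un)
    qed
  next
    fix k assume b: "\<forall>k\<le>length n. w ` {..?S k} = {..?S k}" and k: "k < length n"
    have "young_block n k = {..?S (Suc k)} - {..?S k}" by (auto simp: young_block_def)
    then show "w ` young_block n k = young_block n k"
      using b k by (simp add: image_set_diff[OF permutes_inj[OF w]])
  qed
  have 2: "(\<forall>c\<in>cuts n. w ` {..c} = {..c}) \<longleftrightarrow> (\<forall>k\<le>length n. w ` {..?S k} = {..?S k})" for w :: "nat \<Rightarrow> nat"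
    unfolding cuts_def by blast
  show ?thesis
    unfolding young_def sym_group_carrier
    by (rule Collect_cong, rule conj_cong[OF refl]) (simp only: 1 2)
qed

lemma young_permutes: "w \<in> young n \<Longrightarrow> w permutes {1..sum_list n}"
  by (simp add: young_eq_cuts)

lemma id_young: "id \<in> young n"
  by (simp add: young_eq_cuts permutes_id)

lemma young_comp:
  assumes "v \<in> young n" "w \<in> young n"
  shows "v \<circ> w \<in> young n"
proof -
  have "(v \<circ> w) ` A = v ` (w ` A)" for A by (simp only: image_comp)
  then show ?thesis using assms permutes_compose[of w _ v] by (simp add: young_eq_cuts del: comp_apply)
qed

lemma young_inv:
  assumes "w \<in> young n"
  shows "inv' w \<in> young n"
proof -
  have w: "w permutes {1..sum_list n}" using assms by (rule young_permutes)
  have "inv' w ` {..c} = {..c}" if "c \<in> cuts n" for c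
  proof -
    have "w ` {..c} = {..c}" using assms that by (simp add: young_eq_cuts)
    then have "inv' w ` {..c} = inv' w ` (w ` {..c})" by simp
    then show ?thesis using inj_imp_inv_eq permutes_inj[OF w] by (simp add: image_comp)
  qed
  then show ?thesis using permutes_inv[OF w] by (simp add: young_eq_cuts)
qed

lemma adj_young:
  assumes "i \<in> letters n"
  shows "adj i \<in> young n"
proof -
  have "adj i ` {..c} = {..c}" if "c \<in> cuts n" for c
  proof -
    have "i \<noteq> c" using assms that by (auto simp: letters_def)
    then show ?thesis by (intro transpose_image_eq) auto
  qed
  then show ?thesis using adj_permutes[of i "sum_list n"] assms
    by (simp add: young_eq_cuts letters_def)
qed

lemma young_bubble: "w \<in> young n \<Longrightarrow> i \<in> letters n \<Longrightarrow> bubble w i \<in> young n"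
  using young_comp adj_young by (simp add: bubble_def)

lemma demazure_young: "set u \<subseteq> letters n \<Longrightarrow> demazure u \<in> young n"
proof (induction u rule: rev_induct)
  case Nil
  then show ?case by (simp only: demazure_Nil id_young)
next
  case (snoc i u)
  then show ?case using young_bubble by simp
qed

lemma young_imp_word:
  assumes "w \<in> young n"
  obtains u where "set u \<subseteq> letters n" "reduced u" "demazure u = w"
proof -
  have "w ` {..c} = {..c}" if "c \<notin> - cuts n" for c
    using assms that by (simp add: young_eq_cuts)
  then obtain u where "set u \<subseteq> - cuts n \<inter> {1..<sum_list n}" "reduced u" "demazure u = w"
    using exists_reduced_within[OF young_permutes[OF assms], of "- cuts n"] by blast
  then show ?thesis using that[of u] by (auto simp: letters_def)
qed

text \<open>Of \<open>x\<close> and \<open>x \<circ> s\<^sub>i\<close> one is obtained from the other by \<open>*\<close>-multiplication with \<open>s\<^sub>i\<close>,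
  which \<open>v\<close> absorbs.\<close>

lemma foldl_bubble_letter:
  assumes "i # v \<approx> v"
  shows "foldl bubble (x \<circ> adj i) v = foldl bubble x v"
proof -
  have a: "foldl bubble (bubble y i) v = foldl bubble y v" for y
    using hecke_foldl_bubble[OF assms, of y] by simp
  show ?thesis
  proof (cases "x i < x (Suc i)")
    case True
    then show ?thesis using a[of x] by (simp add: bubble_def)
  next
    case False
    then have "bubble (x \<circ> adj i) i = x \<or> x i = x (Suc i)" by (auto simp: bubble_def)
    then show ?thesis
    proof
      assume "bubble (x \<circ> adj i) i = x"
      then show ?thesis using a[of "x \<circ> adj i"] by simp
    next
      assume "x i = x (Suc i)"
      then have "x \<circ> adj i = x" by (auto simp: fun_eq_iff transpose_def)
      then show ?thesis by simp
    qed
  qed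
qed

lemma foldl_bubble_young:
  assumes "\<And>i. i \<in> letters n \<Longrightarrow> i # v \<approx> v" "w \<in> young n"
  shows "foldl bubble (x \<circ> w) v = foldl bubble x v"
proof -
  obtain u where u: "set u \<subseteq> letters n" "reduced u" "demazure u = w" using assms(2) young_imp_word by blast
  have "foldl bubble (x \<circ> word_prod u) v = foldl bubble x v"
    using u(1)
  proof (induction u arbitrary: x)
    case Nil
    then show ?case by (simp only: word_prod_Nil comp_id)
  next
    case (Cons i u)
    have "x \<circ> word_prod (i # u) = (x \<circ> adj i) \<circ> word_prod u" unfolding word_prod_Cons by (simp only: Fun.comp_assoc)
    then have "foldl bubble (x \<circ> word_prod (i # u)) v = foldl bubble ((x \<circ> adj i) \<circ> word_prod u) v" by (rule arg_cong)
    also have "\<dots> = foldl bubble (x \<circ> adj i) v" using Cons.prems by (intro Cons.IH) simp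
    also have "\<dots> = foldl bubble x v" using Cons.prems by (intro foldl_bubble_letter assms) simp
    finally show ?case .
  qed
  moreover have "word_prod u = w" using u letters_subset[of n] reduced_demazure_word_prod[of u "sum_list n"] by auto
  ultimately show ?thesis by simp
qed

lemma demazure_append_young:
  assumes "set v \<subseteq> letters n"
  shows "\<exists>w\<in>young n. demazure (u @ v) = demazure u \<circ> w"
  using assms
proof (induction v rule: rev_induct)
  case Nil
  show ?case by (intro bexI[of _ id] id_young) simp
next
  case (snoc i v)
  from snoc.prems have "set v \<subseteq> letters n" by simp
  then obtain w where w: "w \<in> young n" "demazure (u @ v) = demazure u \<circ> w" using snoc.IH by blast
  have "demazure (u @ v @ [i]) = bubble (demazure (u @ v)) i" using demazure_snoc[of "u @ v" i] by simp
  then have "demazure (u @ v @ [i]) = demazure u \<circ> w \<or> demazure (u @ v @ [i]) = demazure u \<circ> (w \<circ> adj i)"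
    using w by (simp add: bubble_def Fun.comp_assoc)
  moreover have "w \<circ> adj i \<in> young n" using snoc.prems by (intro young_comp[OF w(1)] adj_young) simp
  ultimately show ?case using w(1) by blast
qed

section \<open>Double cosets\<close>

lemma set_young_word_subset: "set (young_word n) \<subseteq> {1..<sum_list n}"
  using set_young_word letters_subset by blast

lemma double_coset_eq:
  "double_coset (sym_group N) H w K = {a \<circ> w \<circ> b | a b. a \<in> H \<and> b \<in> K}"
  unfolding double_coset_def set_mult_def sym_group_mult by auto

text \<open>A word for \<open>w\<^sub>m * u * w\<^sub>n\<close>.\<close>

definition coset_max :: "nat list \<Rightarrow> nat list \<Rightarrow> nat list \<Rightarrow> nat list" where
  "coset_max m n u = young_word m @ u @ young_word n"

text \<open>Absorption from the right, applied to reversed words.\<close>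

lemma demazure_left:
  assumes "demazure v = a \<circ> demazure u" "a \<in> young m" "set u \<subseteq> {1..<sum_list m}" "set v \<subseteq> {1..<sum_list m}"
  shows "demazure (young_word m @ v) = demazure (young_word m @ u)"
proof -
  let ?N = "sum_list m"
  have l: "set (young_word m) \<subseteq> {1..<?N}" using set_young_word letters_subset by blast
  have a: "a permutes {1..?N}" using assms young_permutes by blast
  have abs: "i # rev (young_word m) \<approx> rev (young_word m)" if "i \<in> letters m" for i
    using hecke_rev[OF young_word_absorb[OF that]] by simp
  have "demazure (rev v) = inv' (a \<circ> demazure u)" using demazure_rev[OF assms(4)] assms(1) by simp
  also have "\<dots> = inv' (demazure u) \<circ> inv' a"
    using permutes_bij[OF a] permutes_bij[OF demazure_permutes[OF assms(3)]] by (intro o_inv_distrib)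
  also have "inv' (demazure u) = demazure (rev u)" using demazure_rev[OF assms(3)] by simp
  finally have "demazure (rev v @ rev (young_word m)) = foldl bubble (demazure (rev u) \<circ> inv' a) (rev (young_word m))"
    by (simp only: demazure_append)
  also have "\<dots> = demazure (rev u @ rev (young_word m))"
    using foldl_bubble_young[OF abs young_inv[OF assms(2)]] by (simp add: demazure_append)
  finally have "demazure (rev (rev v @ rev (young_word m))) = demazure (rev (rev u @ rev (young_word m)))"
    using demazure_rev[of "rev v @ rev (young_word m)" ?N] demazure_rev[of "rev u @ rev (young_word m)" ?N] l assms by simp
  then show ?thesis by simp
qed

text \<open>The value of \<open>w\<^sub>m * x * w\<^sub>n\<close> is constant on double cosets. So a double coset contains at
  most one element that absorbs \<open>w\<^sub>m\<close> and \<open>w\<^sub>n\<close>.\<close>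

lemma demazure_coset_max_cong:
  assumes "demazure v = a \<circ> demazure u \<circ> b" "a \<in> young m" "b \<in> young n" "sum_list m = sum_list n"
    "set u \<subseteq> {1..<sum_list n}" "set v \<subseteq> {1..<sum_list n}"
  shows "demazure (coset_max m n v) = demazure (coset_max m n u)"
proof -
  let ?N = "sum_list n"
  have l: "set (young_word m) \<subseteq> {1..<?N}" "set (young_word n) \<subseteq> {1..<?N}"
    using set_young_word_subset[of m] set_young_word_subset[of n] assms(4) by simp_all
  have b: "b permutes {1..?N}" using assms young_permutes by blast
  then have "demazure u \<circ> b permutes {1..?N}" using permutes_compose demazure_permutes[OF assms(5)] by blast
  then obtain t where t: "set t \<subseteq> {1..<?N}" "demazure t = demazure u \<circ> b" using exists_reduced by blast
  have "demazure (young_word m @ v) = demazure (young_word m @ t)"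
    using t assms by (intro demazure_left[of _ a]) (simp_all add: Fun.comp_assoc)
  then have "demazure ((young_word m @ v) @ young_word n) = demazure ((young_word m @ t) @ young_word n)" unfolding demazure_append[of _ "young_word n"] by simp
  moreover have "demazure (t @ young_word n) = demazure (u @ young_word n)"
    unfolding demazure_append t(2)
    using young_word_absorb_left assms(3) by (rule foldl_bubble_young)
  then have "demazure (young_word m @ t @ young_word n) = demazure (young_word m @ u @ young_word n)"
    by (rule demazure_append_cong[OF refl _ l(1) l(1), of "t @ young_word n" "u @ young_word n"])
      (use t(1) l(2) assms in simp_all)
  ultimately show ?thesis by (simp add: coset_max_def)
qed

lemma demazure_coset_max_in:
  assumes "sum_list m = sum_list n" "set u \<subseteq> {1..<sum_list n}"
  shows "demazure (coset_max m n u) \<in> double_coset (sym_group N) (young m) (demazure u) (young n)"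
proof -
  have l: "set (young_word m) \<subseteq> {1..<sum_list n}" using set_young_word_subset[of m] assms(1) by simp
  obtain b where b: "b \<in> young n" "demazure ((young_word m @ u) @ young_word n) = demazure (young_word m @ u) \<circ> b"
    using demazure_append_young[OF set_young_word] by blast
  obtain a where a: "a \<in> young m" "demazure (rev u @ rev (young_word m)) = demazure (rev u) \<circ> a"
    using demazure_append_young[of "rev (young_word m)" m "rev u"] set_young_word[of m] unfolding set_rev by blast
  have ap: "a permutes {1..sum_list n}" using a young_permutes assms(1) by metis
  have "demazure (young_word m @ u) = inv' (demazure (rev u) \<circ> a)"
    using demazure_rev[of "rev u @ rev (young_word m)" "sum_list n"] a l assms by simp
  also have "\<dots> = inv' a \<circ> inv' (demazure (rev u))"
    using permutes_bij[OF ap] permutes_bij[OF demazure_permutes[of "rev u" "sum_list n"]] assms(2)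
    by (intro o_inv_distrib) auto
  also have "inv' (demazure (rev u)) = demazure u" using demazure_rev[of "rev u" "sum_list n"] assms(2) by simp
  finally have "demazure (coset_max m n u) = inv' a \<circ> demazure u \<circ> b" using b(2) by (simp only: coset_max_def append_assoc)
  then show ?thesis using young_inv[OF a(1)] b(1) unfolding double_coset_eq by blast
qed

lemma in_double_coset_word:
  assumes "y \<in> double_coset (sym_group N) (young m) (demazure u) (young n)"
    "sum_list m = sum_list n" "set u \<subseteq> {1..<sum_list n}"
  obtains v where "set v \<subseteq> {1..<sum_list n}" "y = demazure v" "demazure (coset_max m n v) = demazure (coset_max m n u)"
proof -
  obtain a b where ab: "y = a \<circ> demazure u \<circ> b" "a \<in> young m" "b \<in> young n"
    using assms(1) by (auto simp: double_coset_eq)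
  then have "a permutes {1..sum_list n}" "b permutes {1..sum_list n}" using young_permutes assms(2) by metis+
  then have "y permutes {1..sum_list n}" using ab demazure_permutes[OF assms(3)] by (auto intro: permutes_compose)
  then obtain v where "set v \<subseteq> {1..<sum_list n}" "y = demazure v" using exists_reduced by blast
  then show ?thesis using that[of v] ab assms demazure_coset_max_cong[of v a u b m n] by simp
qed

text \<open>Multiplication from the left is treated through inverses, which have the same number of
  inversions.\<close>

lemma ninv_demazure_append:
  assumes "set u \<subseteq> {1..<N}" "set v \<subseteq> {1..<N}"
  shows "ninv (demazure u) \<le> ninv (demazure (u @ v))" "ninv (demazure v) \<le> ninv (demazure (u @ v))"
proof -
  have R: "ninv (demazure p) \<le> ninv (demazure (p @ q))" if "set p \<subseteq> {1..<N}" "set q \<subseteq> {1..<N}" for p q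
    using that(2)
  proof (induction q rule: rev_induct)
    case (snoc i q)
    then show ?case
      using ninv_bubble_le[OF demazure_permutes[of "p @ q" N], of i] that(1) demazure_snoc[of "p @ q" i] by simp
  qed simp
  show "ninv (demazure u) \<le> ninv (demazure (u @ v))" using R assms by blast
  have "ninv (demazure (rev v)) \<le> ninv (demazure (rev v @ rev u))" using R assms by simp
  moreover have "demazure (rev v) = inv' (demazure v)" "demazure (rev v @ rev u) = inv' (demazure (u @ v))"
    using demazure_rev[of v N] demazure_rev[of "u @ v" N] assms by simp_all
  moreover have "demazure v permutes {1..N}" "demazure (u @ v) permutes {1..N}"
    using assms demazure_permutes[of "u @ v" N] demazure_permutes[of v N] by auto
  ultimately show "ninv (demazure v) \<le> ninv (demazure (u @ v))" by (simp add: ninv_inverse)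
qed

lemma demazure_absorb_word:
  "\<forall>i\<in>set v. demazure (u @ [i]) = demazure u \<Longrightarrow> demazure (u @ v) = demazure u"
proof (induction v)
  case (Cons i v)
  then have "demazure ((u @ [i]) @ v) = demazure (u @ v)" unfolding demazure_append[of _ v] by simp
  then show ?case using Cons by simp
qed simp

text \<open>The element \<open>w\<^sub>m * u * w\<^sub>n\<close> is also \<open>w\<^sub>m * v * w\<^sub>n\<close> for every \<open>v\<close> in the double coset, and
  it is at least as long as \<open>v\<close>. Conversely a maximal element cannot be lengthened from either
  side within the double coset; so it absorbs \<open>w\<^sub>m\<close> and \<open>w\<^sub>n\<close>, and only one element does.\<close>

theorem bruhat_max_double_coset:
  assumes mn: "sum_list m = sum_list n" and u: "set u \<subseteq> {1..<sum_list n}"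
  shows "bruhat_max (sym_group (sum_list n)) (simple_transpositions (sum_list n))
    (double_coset (sym_group (sum_list n)) (young m) (demazure u) (young n)) = demazure (coset_max m n u)"
proof -
  let ?N = "sum_list n" and ?G = "sym_group (sum_list n)" and ?S = "simple_transpositions (sum_list n)"
  let ?p = "double_coset ?G (young m) (demazure u) (young n)"
  have l: "set (young_word m) \<subseteq> {1..<?N}" "set (young_word n) \<subseteq> {1..<?N}"
    using set_young_word_subset[of m] set_young_word_subset[of n] mn by simp_all
  have cs: "set (coset_max m n v) \<subseteq> {1..<?N}" if "set v \<subseteq> {1..<?N}" for v
    using l that by (simp add: coset_max_def)
  have cl: "a \<circ> y \<circ> b \<in> ?p" if "y \<in> ?p" "a \<in> young m" "b \<in> young n" for a b y
  proof -
    obtain c d where "y = c \<circ> demazure u \<circ> d" "c \<in> young m" "d \<in> young n"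
      using \<open>y \<in> ?p\<close> by (auto simp: double_coset_eq)
    then have "a \<circ> y \<circ> b = (a \<circ> c) \<circ> demazure u \<circ> (d \<circ> b)" "a \<circ> c \<in> young m" "d \<circ> b \<in> young n"
      using young_comp that by (auto simp: Fun.comp_assoc)
    then show ?thesis unfolding double_coset_eq by blast
  qed
  show ?thesis
    unfolding bruhat_max_def
  proof (rule the_equality)
    show "demazure (coset_max m n u) \<in> ?p \<and> (\<forall>y\<in>?p. \<not> bruhat_less ?G ?S (demazure (coset_max m n u)) y)"
    proof (intro conjI ballI notI)
      show "demazure (coset_max m n u) \<in> ?p" using mn u by (rule demazure_coset_max_in)
      fix y assume "y \<in> ?p" and less: "bruhat_less ?G ?S (demazure (coset_max m n u)) y"
      then obtain v where v: "set v \<subseteq> {1..<?N}" "y = demazure v" "demazure (coset_max m n v) = demazure (coset_max m n u)"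
        using in_double_coset_word[OF _ mn u] by metis
      have "ninv (demazure v) \<le> ninv (demazure (v @ young_word n))" using v l by (intro ninv_demazure_append)
      also have "\<dots> \<le> ninv (demazure (young_word m @ v @ young_word n))" using v l by (intro ninv_demazure_append[of _ ?N]) auto
      finally have "ninv y \<le> ninv (demazure (coset_max m n u))" using v by (simp add: coset_max_def)
      then show False
        using bruhat_less_imp_length[OF less] cox_length_eq_ninv[OF demazure_permutes[OF cs[OF u]]]
          cox_length_eq_ninv[OF demazure_permutes[OF v(1)]] v(2) by simp
    qed
  next
    fix x assume "x \<in> ?p \<and> (\<forall>y\<in>?p. \<not> bruhat_less ?G ?S x y)"
    then have x: "x \<in> ?p" and max: "\<And>y. y \<in> ?p \<Longrightarrow> \<not> bruhat_less ?G ?S x y" by auto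
    obtain v where v: "set v \<subseteq> {1..<?N}" "x = demazure v" "demazure (coset_max m n v) = demazure (coset_max m n u)"
      using in_double_coset_word[OF x mn u] by metis
    have xp: "x permutes {1..?N}" using v demazure_permutes by simp
    have R: "demazure (v @ [i]) = demazure v" if i: "i \<in> letters n" for i
    proof -
      have "x \<circ> adj i \<in> ?p" using cl[OF x id_young adj_young[OF i]] by simp
      then have "\<not> x i < x (Suc i)" using max bruhat_less_adj_iff[OF xp, of i] letters_subset[of n] i by auto
      then show ?thesis using v by (simp add: bubble_def)
    qed
    have L: "demazure (rev v @ [i]) = demazure (rev v)" if i: "i \<in> letters m" for i
    proof (rule ccontr)
      assume ne: "demazure (rev v @ [i]) \<noteq> demazure (rev v)"
      have iN: "1 \<le> i" "i < ?N" using i letters_subset[of m] mn by auto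
      let ?y = "inv' x"
      have y: "demazure (rev v) = ?y" using demazure_rev v by simp
      have yp: "?y permutes {1..?N}" using xp by (rule permutes_inv)
      have "?y i < ?y (Suc i)" using ne y by (simp add: bubble_def split: if_splits)
      then have "ninv (?y \<circ> adj i) = Suc (ninv ?y)" using ninv_ascent[OF yp] by simp
      moreover have "adj i \<circ> x = x \<circ> (?y \<circ> adj i \<circ> inv' ?y)"
        using permutes_inv_o[OF xp] permutes_inv_inv[OF xp] by (simp add: Fun.comp_assoc[symmetric])
      moreover have "inv' (?y \<circ> adj i) = adj i \<circ> x"
        using o_inv_distrib[OF permutes_bij[OF yp] permutes_bij[OF adj_permutes[OF iN]]]
          permutes_inv_inv[OF xp] by simp
      moreover have "ninv (inv' (?y \<circ> adj i)) = ninv (?y \<circ> adj i)"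
        by (rule ninv_inverse[OF permutes_compose[OF adj_permutes[OF iN] yp]])
      ultimately have "bruhat_less ?G ?S x (adj i \<circ> x)"
        using bruhat_less_conjugate[OF xp yp iN] ninv_inverse[OF xp] by simp
      moreover have "adj i \<circ> x \<in> ?p" using cl[OF x adj_young[OF i] id_young] by simp
      ultimately show False using max by blast
    qed
    have R': "demazure (v @ young_word n) = demazure v" using R set_young_word[of n] by (intro demazure_absorb_word) auto
    have "demazure (rev v @ rev (young_word m)) = demazure (rev v)" using L set_young_word[of m] by (intro demazure_absorb_word) auto
    then have "inv' (demazure (rev v @ rev (young_word m))) = inv' (demazure (rev v))" by simp
    then have L': "demazure (young_word m @ v) = demazure v"
      using demazure_rev[of "rev v @ rev (young_word m)" ?N] demazure_rev[of "rev v" ?N] v l by simp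
    have "demazure (coset_max m n v) = demazure ((young_word m @ v) @ young_word n)" by (simp add: coset_max_def)
    also have "\<dots> = demazure (v @ young_word n)" unfolding demazure_append[of _ "young_word n"] L' ..
    finally show "x = demazure (coset_max m n u)" using R' v by simp
  qed
qed

section \<open>Products of double cosets\<close>

lemma perm_sum_bubble:
  assumes "1 \<le> i"
  shows "perm_sum N x (bubble y i) = bubble (perm_sum N x y) (N + i)"
proof -
  have "perm_sum N x (y \<circ> adj i) = perm_sum N x y \<circ> adj (N + i)"
    using assms by (auto simp: perm_sum_def fun_eq_iff transpose_def)
  then show ?thesis using assms by (auto simp: bubble_def perm_sum_def)
qed

lemma perm_sum_bubble_left:
  assumes "i < N"
  shows "perm_sum N (bubble x i) y = bubble (perm_sum N x y) i"
proof -
  have "perm_sum N (x \<circ> adj i) y = perm_sum N x y \<circ> adj i"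
    using assms by (auto simp: perm_sum_def fun_eq_iff transpose_def)
  then show ?thesis using assms by (auto simp: bubble_def perm_sum_def)
qed

lemma perm_sum_id_right: "x permutes {1..N} \<Longrightarrow> perm_sum N x id = x"
  by (auto simp: perm_sum_def fun_eq_iff permutes_not_in)

lemma perm_sum_demazure:
  assumes "set u \<subseteq> {1..<N}" "0 \<notin> set v"
  shows "perm_sum N (demazure u) (demazure v) = demazure (u @ map ((+) N) v)"
  using assms(2)
proof (induction v rule: rev_induct)
  case Nil
  show ?case unfolding list.map append_Nil2 demazure_Nil by (rule perm_sum_id_right[OF demazure_permutes[OF assms(1)]])
next
  case (snoc i v)
  then have "1 \<le> i" by auto
  then show ?case using snoc demazure_snoc[of "u @ map ((+) N) v" "N + i"] by (simp add: perm_sum_bubble)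
qed

lemma perm_sum_comp:
  assumes "b permutes {1..N}" "d permutes {1..M}"
  shows "perm_sum N (a \<circ> b) (c \<circ> d) = perm_sum N a c \<circ> perm_sum N b d"
proof
  fix i
  show "perm_sum N (a \<circ> b) (c \<circ> d) i = (perm_sum N a c \<circ> perm_sum N b d) i"
  proof (cases "i \<le> N")
    case True
    then have "b i \<le> N" using assms(1) by (cases "i = 0") (auto simp: permutes_not_in dest: permutes_in_image[of b _ i])
    then show ?thesis using True by (simp add: perm_sum_def)
  next
    case False
    have "d (i - N) \<noteq> d 0" using inj_eq[OF permutes_inj[OF assms(2)]] False by simp
    moreover have "d 0 = 0" using assms(2) by (simp add: permutes_not_in)
    ultimately show ?thesis using False by (simp add: perm_sum_def)
  qed
qed

lemma letters_not_0: "0 \<notin> letters n"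
  by (auto simp: letters_def)

lemma young_append:
  "young (n @ n') = {perm_sum (sum_list n) x y | x y. x \<in> young n \<and> y \<in> young n'}"
proof (intro Set.equalityI subsetI)
  fix w assume "w \<in> young (n @ n')"
  then obtain u where u: "set u \<subseteq> letters (n @ n')" "demazure u = w" by (rule young_imp_word)
  have "\<exists>x y. demazure u = perm_sum (sum_list n) x y \<and> x \<in> young n \<and> y \<in> young n'"
    using u(1)
  proof (induction u rule: rev_induct)
    case Nil
    show ?case
      by (intro exI[of _ id] conjI id_young)
        (simp only: demazure_Nil perm_sum_id_right[OF permutes_id, of "sum_list n"])
  next
    case (snoc i u)
    then obtain x y where xy: "demazure u = perm_sum (sum_list n) x y" "x \<in> young n" "y \<in> young n'" by auto
    have "i \<in> letters n \<union> (+) (sum_list n) ` letters n'" using snoc.prems by (simp add: letters_append)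
    then consider "i \<in> letters n" | j where "i = sum_list n + j" "j \<in> letters n'" by auto
    then show ?case
    proof cases
      case 1
      then have "demazure (u @ [i]) = perm_sum (sum_list n) (bubble x i) y"
        using perm_sum_bubble_left[of i "sum_list n"] letters_subset[of n] xy by auto
      then show ?thesis using young_bubble[OF xy(2) 1] xy by blast
    next
      case 2
      then have "demazure (u @ [i]) = perm_sum (sum_list n) x (bubble y j)"
        using perm_sum_bubble[of j "sum_list n"] letters_subset[of n'] xy by auto
      then show ?thesis using young_bubble[OF xy(3) 2(2)] xy by blast
    qed
  qed
  then show "w \<in> {perm_sum (sum_list n) x y | x y. x \<in> young n \<and> y \<in> young n'}" using u by simp
next
  fix w assume "w \<in> {perm_sum (sum_list n) x y | x y. x \<in> young n \<and> y \<in> young n'}"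
  then obtain x y where w: "w = perm_sum (sum_list n) x y" and xy: "x \<in> young n" "y \<in> young n'" by auto
  obtain u where u: "set u \<subseteq> letters n" "demazure u = x" using xy(1) by (rule young_imp_word)
  obtain v where v: "set v \<subseteq> letters n'" "demazure v = y" using xy(2) by (rule young_imp_word)
  have "w = demazure (u @ map ((+) (sum_list n)) v)"
    unfolding w using perm_sum_demazure[of u "sum_list n" v] u v letters_subset[of n] letters_not_0[of n'] by blast
  moreover have "set (u @ map ((+) (sum_list n)) v) \<subseteq> letters (n @ n')"
    using u v by (auto simp: letters_append)
  ultimately show "w \<in> young (n @ n')" using demazure_young by metis
qed

lemma double_coset_perm_sum:
  assumes mn: "sum_list m = sum_list n" "sum_list m' = sum_list n'"
    and x: "x permutes {1..sum_list n}" and y: "y permutes {1..sum_list n'}"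
  shows "{perm_sum (sum_list n) p q | p q.
      p \<in> double_coset (sym_group N) (young m) x (young n) \<and>
      q \<in> double_coset (sym_group M) (young m') y (young n')}
    = double_coset (sym_group L) (young (m @ m')) (perm_sum (sum_list n) x y) (young (n @ n'))"
    (is "?A = ?B")
proof -
  have eq: "perm_sum (sum_list n) (a \<circ> x \<circ> b) (c \<circ> y \<circ> d)
      = perm_sum (sum_list n) a c \<circ> perm_sum (sum_list n) x y \<circ> perm_sum (sum_list n) b d"
    if "b \<in> young n" "d \<in> young n'" for a b c d
    using perm_sum_comp[OF young_permutes[OF that(1)] young_permutes[OF that(2)]]
      perm_sum_comp[OF x y] by simp
  have "?A = {perm_sum (sum_list n) (a \<circ> x \<circ> b) (c \<circ> y \<circ> d) | a b c d.
      a \<in> young m \<and> b \<in> young n \<and> c \<in> young m' \<and> d \<in> young n'}"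
    unfolding double_coset_eq by blast
  also have "\<dots> = {perm_sum (sum_list n) a c \<circ> perm_sum (sum_list n) x y \<circ> perm_sum (sum_list n) b d | a b c d.
      a \<in> young m \<and> b \<in> young n \<and> c \<in> young m' \<and> d \<in> young n'}"
    by (rule Collect_cong) (use eq in metis)
  also have "\<dots> = ?B"
    unfolding double_coset_eq young_append mn(1) by blast
  finally show ?thesis .
qed

section \<open>The square relations between longest elements\<close>

lemma demazure_descent:
  assumes "set u \<subseteq> {1..<N}" "u @ [i] \<approx> u"
  shows "demazure u (Suc i) < demazure u i"
proof -
  have "bubble (demazure u) i = demazure u" using hecke_imp_demazure[OF assms(2)] by simp
  then have "\<not> demazure u i < demazure u (Suc i)" by (rule iffD1[OF bubble_ascent_iff])
  then show ?thesis using permutes_neq[OF demazure_permutes[OF assms(1)], of i] by linarith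
qed

lemma descents_antimono:
  fixes x :: "nat \<Rightarrow> nat"
  assumes "\<And>i. l \<le> i \<Longrightarrow> i < r \<Longrightarrow> x (Suc i) < x i" "l \<le> i" "i < j" "j \<le> r"
  shows "x j < x i"
  using assms(3,4)
proof (induction j)
  case (Suc j)
  show ?case
  proof (cases "i = j")
    case True
    then show ?thesis using assms(1)[of j] assms(2) Suc by simp
  next
    case False
    then have "x j < x i" using Suc by simp
    then show ?thesis using assms(1)[of j] assms(2) Suc by force
  qed
qed simp

text \<open>If \<open>x j\<close> exceeds \<open>t\<close>, then so do the values at \<open>l, \<dots>, j\<close>, but only \<open>N - t\<close> values do.\<close>

lemma descending_above:
  fixes x :: "nat \<Rightarrow> nat"
  assumes x: "x permutes {1..N}" and d: "\<And>i. l \<le> i \<Longrightarrow> i < r \<Longrightarrow> x (Suc i) < x i"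
    and lr: "1 \<le> l" "r \<le> N" "l \<le> j" "j \<le> r" "l + (N - t) \<le> j"
  shows "x j \<le> t"
proof (rule ccontr)
  assume t: "\<not> x j \<le> t"
  have "x ` {l..j} \<subseteq> {t<..N}"
  proof
    fix y assume "y \<in> x ` {l..j}"
    then obtain i where i: "y = x i" "l \<le> i" "i \<le> j" by auto
    have "x j \<le> x i" using descents_antimono[of l r x i j, OF d] i lr by (cases "i = j") auto
    moreover have "x i \<le> N" using permutes_in_image[OF x, of i] i lr by auto
    ultimately show "y \<in> {t<..N}" using t i by simp
  qed
  then have "card (x ` {l..j}) \<le> card {t<..N}" by (intro card_mono) auto
  moreover have "card (x ` {l..j}) = Suc j - l" by (simp add: card_image inj_on_subset[OF permutes_inj[OF x]])
  ultimately show False using lr by simp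
qed

text \<open>The mirror image: if \<open>x j\<close> is at most \<open>t\<close>, then so are the values at \<open>j, \<dots>, r\<close>.\<close>

lemma descending_below:
  fixes x :: "nat \<Rightarrow> nat"
  assumes x: "x permutes {1..N}" and d: "\<And>i. l \<le> i \<Longrightarrow> i < r \<Longrightarrow> x (Suc i) < x i"
    and lr: "1 \<le> l" "r \<le> N" "l \<le> j" "j \<le> r" "j + t \<le> r"
  shows "t < x j"
proof (rule ccontr)
  assume t: "\<not> t < x j"
  have "x ` {j..r} \<subseteq> {1..t}"
  proof
    fix y assume "y \<in> x ` {j..r}"
    then obtain i where i: "y = x i" "j \<le> i" "i \<le> r" by auto
    have "x i \<le> x j" using descents_antimono[of l r x j i, OF d] i lr by (cases "i = j") auto
    moreover have "1 \<le> x i" using permutes_in_image[OF x, of i] i lr by auto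
    ultimately show "y \<in> {1..t}" using t i by simp
  qed
  then have "card (x ` {j..r}) \<le> card {1..t}" by (intro card_mono) auto
  moreover have "card (x ` {j..r}) = Suc r - j" by (simp add: card_image inj_on_subset[OF permutes_inj[OF x]])
  ultimately show False using lr by simp
qed

lemma demazure_append_image:
  assumes "\<And>i. i \<in> set v \<Longrightarrow> i \<in> A \<longleftrightarrow> Suc i \<in> A"
  shows "demazure (u @ v) ` A = demazure u ` A"
  using assms
proof (induction v rule: rev_induct)
  case (snoc i v)
  have "adj i ` A = A" using snoc.prems by (intro transpose_image_eq) simp
  then have "(demazure (u @ v) \<circ> adj i) ` A = demazure (u @ v) ` A" unfolding image_comp[symmetric] by simp
  then show ?case using snoc demazure_snoc[of "u @ v" i] by (simp add: bubble_def)
qed simp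

text \<open>A word that absorbs all letters equals its product with the longest element, which in turn
  absorbs the word from the other side.\<close>

lemma hecke_w0I:
  assumes X: "set X \<subseteq> {1..<N}" and "\<And>i. 1 \<le> i \<Longrightarrow> i < N \<Longrightarrow> X @ [i] \<approx> X"
  shows "X \<approx> w0 N"
proof -
  have "X @ w0 N \<approx> X" using assms set_w0[of N] by (intro hecke_absorb_word) auto
  moreover have "X @ w0 N \<approx> w0 N" using X w0_absorb_left by (intro hecke_absorb_word_left) auto
  ultimately show ?thesis using hecke_sym hecke_trans by blast
qed

lemma letters_pair: "letters [a, b] = {1..<a + b} - {a}"
  by (auto simp: letters_def)

lemma hecke_absorbI:
  assumes "set u \<subseteq> {1..<N}" "1 \<le> i" "i < N" "demazure u (Suc i) < demazure u i"
  shows "u @ [i] \<approx> u"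
  by (rule demazure_eq_imp_hecke[of _ _ N]) (use assms in \<open>auto simp: bubble_def\<close>)

text \<open>Multiplication by the longest element of \<open>S\<^sub>a \<times> S\<^sub>N\<^sub>-\<^sub>a\<close> sorts the positions up to \<open>a\<close> and
  those beyond \<open>a\<close> separately. If the large values already precede the small ones, the result is
  descending throughout.\<close>

lemma hecke_w0_of_sorted:
  assumes u: "set u \<subseteq> {1..<N}" and a: "1 \<le> a" "a < N" and le: "\<And>j. a < j \<Longrightarrow> j \<le> N \<Longrightarrow> demazure u j \<le> N - a"
  shows "u @ young_word [a, N - a] \<approx> w0 N"
proof (rule hecke_w0I)
  let ?X = "u @ young_word [a, N - a]"
  have l: "letters [a, N - a] = {1..<N} - {a}" using a by (simp add: letters_pair)
  then have w: "set (young_word [a, N - a]) \<subseteq> {1..<N} - {a}" using set_young_word by metis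
  show X: "set ?X \<subseteq> {1..<N}" unfolding set_append using u w by blast
  fix i assume i: "1 \<le> i" "i < N"
  show "?X @ [i] \<approx> ?X"
  proof (cases "i = a")
    case False
    then have "young_word [a, N - a] @ [i] \<approx> young_word [a, N - a]" using i by (intro young_word_absorb) (simp add: l)
    then have "u @ (young_word [a, N - a] @ [i]) \<approx> u @ young_word [a, N - a]" by (rule hecke_append[OF hecke_refl])
    then show ?thesis by (simp only: append_assoc)
  next
    case True
    let ?x = "demazure ?X"
    have xp: "?x permutes {1..N}" using demazure_permutes[OF X] .
    have im: "?x ` {a<..N} = demazure u ` {a<..N}" by (rule demazure_append_image) (use w in force)
    have "?x ` {a<..N} \<subseteq> {1..N - a}"
    proof
      fix y assume y: "y \<in> ?x ` {a<..N}"
      then have "1 \<le> y" using permutes_in_image[OF xp] by force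
      moreover have "y \<le> N - a" using y le unfolding im by force
      ultimately show "y \<in> {1..N - a}" by simp
    qed
    moreover have "card (?x ` {a<..N}) = card {1..N - a}"
      by (subst card_image) (simp_all add: inj_on_subset[OF permutes_inj[OF xp]] del: young_word.simps)
    ultimately have eq: "?x ` {a<..N} = {1..N - a}" by (intro card_subset_eq) auto
    have "?x a \<notin> ?x ` {a<..N}" using inj_image_mem_iff[OF permutes_inj[OF xp]] by simp
    moreover have "1 \<le> ?x a" using permutes_in_image[OF xp, of a] a by simp
    moreover have "?x (Suc a) \<in> {1..N - a}" unfolding eq[symmetric] using a by (intro imageI) simp
    ultimately have "?x (Suc a) < ?x a" unfolding eq by simp
    then show ?thesis using True i X by (intro hecke_absorbI[of _ N]) auto
  qed
qed

lemma set_young_word_pair: "c \<le> N \<Longrightarrow> set (young_word [c, N - c]) \<subseteq> {1..<N} - {c}"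
  using set_young_word[of "[c, N - c]"] by (simp add: letters_pair)

lemma young_word_pair_absorb:
  "c \<le> N \<Longrightarrow> 1 \<le> i \<Longrightarrow> i < N \<Longrightarrow> i \<noteq> c \<Longrightarrow> young_word [c, N - c] @ [i] \<approx> young_word [c, N - c]"
  by (rule young_word_absorb) (simp add: letters_pair)

lemma young_word_pair_descent:
  assumes "set u \<subseteq> {1..<N}" "c \<le> N" "1 \<le> i" "i < N" "i \<noteq> c"
  shows "demazure (u @ young_word [c, N - c]) (Suc i) < demazure (u @ young_word [c, N - c]) i"
proof (rule demazure_descent)
  show "set (u @ young_word [c, N - c]) \<subseteq> {1..<N}"
    unfolding set_append using assms set_young_word_pair by blast
  have "u @ (young_word [c, N - c] @ [i]) \<approx> u @ young_word [c, N - c]"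
    using assms by (intro hecke_append hecke_refl young_word_pair_absorb)
  then show "(u @ young_word [c, N - c]) @ [i] \<approx> u @ young_word [c, N - c]" by (simp only: append_assoc)
qed

text \<open>In one-line notation the first factor is \<open>b \<dots> 1 N \<dots> b+1\<close>. The second factor sorts the
  first \<open>a + b\<close> positions, which brings the \<open>a\<close> largest values to the front.\<close>

lemma square_less_word:
  assumes "1 \<le> a" "1 \<le> b" "a + b < N"
  shows "young_word [b, N - b] @ young_word [a + b, N - (a + b)] @ young_word [a, N - a] \<approx> w0 N"
proof -
  let ?A = "young_word [b, N - b]" and ?B = "young_word [a + b, N - (a + b)]"
  have A: "set ?A \<subseteq> {1..<N}" and B: "set ?B \<subseteq> {1..<N} - {a + b}"
    using set_young_word_pair[of b N] set_young_word_pair[of "a + b" N] assms by auto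
  have AB: "set (?A @ ?B) \<subseteq> {1..<N}" unfolding set_append using A B by blast
  have dA: "demazure ?A (Suc i) < demazure ?A i" if "b + 1 \<le> i" "i < N" for i
    using young_word_pair_descent[of "[]" N b i] that assms unfolding append_Nil by simp
  have dB: "demazure (?A @ ?B) (Suc i) < demazure (?A @ ?B) i" if "1 \<le> i" "i < a + b" for i
    using that assms by (intro young_word_pair_descent[OF A]) auto
  have im: "demazure (?A @ ?B) ` {a + b<..N} = demazure ?A ` {a + b<..N}"
    by (rule demazure_append_image) (use B in force)
  have "(?A @ ?B) @ young_word [a, N - a] \<approx> w0 N"
  proof (rule hecke_w0_of_sorted[OF AB])
    fix j assume j: "a < j" "j \<le> N"
    show "demazure (?A @ ?B) j \<le> N - a"
    proof (cases "j \<le> a + b")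
      case True
      show ?thesis
        by (rule descending_above[OF demazure_permutes[OF AB], where l = 1 and r = "a + b"], rule dB) (use True j assms in auto)
    next
      case False
      have "demazure ?A k \<le> N - a" if "a + b < k" "k \<le> N" for k
        by (rule descending_above[OF demazure_permutes[OF A], where l = "b + 1" and r = N], rule dA) (use that assms in auto)
      then have "demazure ?A ` {a + b<..N} \<subseteq> {..N - a}" by auto
      moreover have "demazure (?A @ ?B) j \<in> demazure (?A @ ?B) ` {a + b<..N}" using False j by (intro imageI) simp
      ultimately show ?thesis unfolding im by blast
    qed
  qed (use assms in auto)
  then show ?thesis by (simp only: append_assoc)
qed

text \<open>Now the second factor sorts the positions beyond \<open>c = a + b - N\<close>. In \<open>b \<dots> 1 N \<dots> b+1\<close> the
  values before them, \<open>b, \<dots>, b-c+1\<close>, all exceed \<open>N - a\<close>, and after sorting so do the values up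
  to position \<open>a\<close>.\<close>

lemma square_greater_word:
  assumes "a < N" "b < N" "N < a + b"
  shows "young_word [b, N - b] @ young_word [a + b - N, N - (a + b - N)] @ young_word [a, N - a] \<approx> w0 N"
proof -
  define c where "c = a + b - N"
  have c: "1 \<le> c" "c < a" "c < b" "c + N = a + b" using assms by (auto simp: c_def)
  let ?A = "young_word [b, N - b]" and ?B = "young_word [c, N - c]"
  have A: "set ?A \<subseteq> {1..<N}" and B: "set ?B \<subseteq> {1..<N} - {c}"
    using set_young_word_pair[of b N] set_young_word_pair[of c N] assms c by auto
  have AB: "set (?A @ ?B) \<subseteq> {1..<N}" unfolding set_append using A B by blast
  let ?y = "demazure (?A @ ?B)"
  have yp: "?y permutes {1..N}" using demazure_permutes[OF AB] .
  have dA: "demazure ?A (Suc i) < demazure ?A i" if "1 \<le> i" "i < b" for i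
    using young_word_pair_descent[of "[]" N b i] that assms unfolding append_Nil by simp
  have dB: "?y (Suc i) < ?y i" if "c + 1 \<le> i" "i < N" for i
    using that c assms by (intro young_word_pair_descent[OF A]) auto
  have im: "?y ` {1..c} = demazure ?A ` {1..c}"
    by (rule demazure_append_image) (use B in force)
  have gt: "N - a < ?y j" if j: "1 \<le> j" "j \<le> a" for j
  proof (cases "j \<le> c")
    case False
    show ?thesis by (rule descending_below[OF yp, where l = "c + 1" and r = N], rule dB) (use False j assms c in auto)
  next
    case True
    have "N - a < demazure ?A k" if "1 \<le> k" "k \<le> c" for k
      by (rule descending_below[OF demazure_permutes[OF A], where l = 1 and r = b], rule dA) (use that assms c in auto)
    then have "demazure ?A ` {1..c} \<subseteq> {N - a<..}" by auto
    moreover have "?y j \<in> ?y ` {1..c}" using True j by (intro imageI) simp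
    ultimately show ?thesis unfolding im by blast
  qed
  have "?y ` {1..a} \<subseteq> {N - a<..N}"
  proof
    fix z assume "z \<in> ?y ` {1..a}"
    then obtain k where "z = ?y k" "1 \<le> k" "k \<le> a" by auto
    then show "z \<in> {N - a<..N}" using gt[of k] permutes_in_image[OF yp, of k] assms by auto
  qed
  moreover have "card (?y ` {1..a}) = card {N - a<..N}"
    using assms by (subst card_image) (simp_all add: inj_on_subset[OF permutes_inj[OF yp]] del: young_word.simps)
  ultimately have eq: "?y ` {1..a} = {N - a<..N}" by (intro card_subset_eq) auto
  have "(?A @ ?B) @ young_word [a, N - a] \<approx> w0 N"
  proof (rule hecke_w0_of_sorted[OF AB])
    fix j assume j: "a < j" "j \<le> N"
    have "?y j \<notin> ?y ` {1..a}" using inj_image_mem_iff[OF permutes_inj[OF yp]] j by simp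
    moreover have "?y j \<le> N" using permutes_in_image[OF yp, of j] j by simp
    ultimately show "?y j \<le> N - a" unfolding eq by simp
  qed (use assms c in auto)
  then show ?thesis unfolding c_def by (simp only: append_assoc)
qed

section \<open>Strict monoidal categories\<close>

context strict_monoidal_category
begin

text \<open>The rules for composites are restated with source and target as functions, so that they
  serve as conditional rewrite rules.\<close>

lemma Comp_arr:
  assumes "g \<in> Arr C" "f \<in> Arr C" "Dom C g = Cod C f"
  shows "g \<cdot> f \<in> Arr C" "Dom C (g \<cdot> f) = Dom C f" "Cod C (g \<cdot> f) = Cod C g"
  using Comp_Hom[of g "Cod C f" "Cod C g" f "Dom C f"] assms by (auto simp: Hom_def)

lemma TArr_arr:
  assumes "f \<in> Arr C" "g \<in> Arr C"
  shows "f \<boxtimes> g \<in> Arr C" "Dom C (f \<boxtimes> g) = Dom C f \<boxdot> Dom C g" "Cod C (f \<boxtimes> g) = Cod C f \<boxdot> Cod C g"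
  using TArr_Hom[of f "Dom C f" "Cod C f" g "Dom C g" "Cod C g"] assms by (auto simp: Hom_def)

lemma Idt_arr:
  assumes "X \<in> Obj C"
  shows "Idt C X \<in> Arr C" "Dom C (Idt C X) = X" "Cod C (Idt C X) = X"
  using Idt_Hom[OF assms] by (auto simp: Hom_def)

lemma comp_assoc':
  "h \<in> Arr C \<Longrightarrow> g \<in> Arr C \<Longrightarrow> f \<in> Arr C \<Longrightarrow> Dom C h = Cod C g \<Longrightarrow> Dom C g = Cod C f
    \<Longrightarrow> (h \<cdot> g) \<cdot> f = h \<cdot> (g \<cdot> f)"
  by (rule Comp_assoc) (auto simp: Hom_def)

text \<open>Composites of tensor products are merged into tensor products of composites wherever the
  sources and targets match. As a rewrite system this, together with the unit laws, normalizes
  the diagrams below.\<close>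

lemma tens_comp:
  "g \<in> Arr C \<Longrightarrow> f \<in> Arr C \<Longrightarrow> g' \<in> Arr C \<Longrightarrow> f' \<in> Arr C \<Longrightarrow> Dom C g = Cod C f \<Longrightarrow> Dom C g' = Cod C f'
    \<Longrightarrow> (g \<boxtimes> g') \<cdot> (f \<boxtimes> f') = (g \<cdot> f) \<boxtimes> (g' \<cdot> f')"
  by (rule TArr_Comp[symmetric]) (auto simp: Hom_def)

lemma tens_comp_assoc:
  assumes "g \<in> Arr C" "f \<in> Arr C" "g' \<in> Arr C" "f' \<in> Arr C" "Dom C g = Cod C f" "Dom C g' = Cod C f'"
    "h \<in> Arr C" "Cod C h = Dom C f \<boxdot> Dom C f'"
  shows "(g \<boxtimes> g') \<cdot> ((f \<boxtimes> f') \<cdot> h) = ((g \<cdot> f) \<boxtimes> (g' \<cdot> f')) \<cdot> h"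
  using assms comp_assoc'[of "g \<boxtimes> g'" "f \<boxtimes> f'" h] by (simp add: TArr_arr tens_comp)

lemma idt_left: "f \<in> Arr C \<Longrightarrow> X = Cod C f \<Longrightarrow> Idt C X \<cdot> f = f"
  by (rule Idt_Comp) (auto simp: Hom_def)

lemma idt_right: "f \<in> Arr C \<Longrightarrow> X = Dom C f \<Longrightarrow> f \<cdot> Idt C X = f"
  by (rule Comp_Idt) (auto simp: Hom_def)

lemma iso_in_Idt: "X \<in> Obj C \<Longrightarrow> iso_in C X X (Idt C X)"
  unfolding iso_in_def using Idt_Hom[of X] Comp_Idt[of "Idt C X" X X] by blast

end

definition strict_monfun :: "('o, 'b) moncat \<Rightarrow> ('a \<Rightarrow> 'b) \<Rightarrow> ('o, 'a, 'o, 'b) monfun" where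
  "strict_monfun D \<Phi> = \<lparr>FObj = (\<lambda>X. X), FArr = \<Phi>, FTen = (\<lambda>X Y. Idt D (X \<boxdot>\<^bsub>D\<^esub> Y)), FUnit = Idt D (Unit D)\<rparr>"

locale identity_on_objects_functor =
  fixes C :: "('o, 'a) moncat" and D :: "('o, 'b) moncat" and \<Phi> :: "'a \<Rightarrow> 'b"
  assumes Obj_eq: "Obj D = Obj C" and Unit_eq: "Unit D = Unit C" and TObj_eq: "TObj D = TObj C"
    and map_Hom: "f \<in> Hom C X Y \<Longrightarrow> \<Phi> f \<in> Hom D X Y"
    and map_Idt: "X \<in> Obj C \<Longrightarrow> \<Phi> (Idt C X) = Idt D X"
    and map_Comp: "\<lbrakk>g \<in> Hom C Y Z; f \<in> Hom C X Y\<rbrakk> \<Longrightarrow> \<Phi> (g \<cdot>\<^bsub>C\<^esub> f) = \<Phi> g \<cdot>\<^bsub>D\<^esub> \<Phi> f"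
    and map_TArr: "\<lbrakk>f \<in> Hom C X Y; f' \<in> Hom C X' Y'\<rbrakk> \<Longrightarrow> \<Phi> (f \<boxtimes>\<^bsub>C\<^esub> f') = \<Phi> f \<boxtimes>\<^bsub>D\<^esub> \<Phi> f'"

text \<open>All structure maps are identities, so the coherence conditions reduce to unit laws.\<close>

lemma monoidal_functor_strict:
  assumes "strict_monoidal_category C" "strict_monoidal_category D" "identity_on_objects_functor C D \<Phi>"
  shows "monoidal_functor C D (strict_monfun D \<Phi>)"
proof -
  interpret C: strict_monoidal_category C by fact
  interpret D: strict_monoidal_category D by fact
  interpret identity_on_objects_functor C D \<Phi> by fact
  have T: "X \<boxdot>\<^bsub>C\<^esub> Y \<in> Obj C" if "X \<in> Obj C" "Y \<in> Obj C" for X Y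
    using C.TObj_Obj that .
  have obj: "X \<in> Obj C \<and> Y \<in> Obj C" if "f \<in> Hom C X Y" for f X Y
    using that C.Dom_Obj C.Cod_Obj by (auto simp: Hom_def)
  have idc: "Idt D X \<cdot>\<^bsub>D\<^esub> Idt D X = Idt D X" if "X \<in> Obj C" for X
    using D.Comp_Idt D.Idt_Hom that Obj_eq by metis
  have nat: "Idt D (Y \<boxdot>\<^bsub>C\<^esub> Y') \<cdot>\<^bsub>D\<^esub> (\<Phi> f \<boxtimes>\<^bsub>D\<^esub> \<Phi> f') = \<Phi> (f \<boxtimes>\<^bsub>C\<^esub> f') \<cdot>\<^bsub>D\<^esub> Idt D (X \<boxdot>\<^bsub>C\<^esub> X')"
    if f: "f \<in> Hom C X Y" "f' \<in> Hom C X' Y'" for f f' X Y X' Y'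
  proof -
    have h: "\<Phi> (f \<boxtimes>\<^bsub>C\<^esub> f') \<in> Hom D (X \<boxdot>\<^bsub>C\<^esub> X') (Y \<boxdot>\<^bsub>C\<^esub> Y')"
      using map_Hom[OF C.TArr_Hom[OF f]] .
    show ?thesis unfolding map_TArr[OF f, symmetric] D.Idt_Comp[OF h] D.Comp_Idt[OF h] ..
  qed
  show ?thesis
  proof (unfold_locales, unfold strict_monfun_def monfun.select_convs Obj_eq TObj_eq Unit_eq)
    show "\<And>X. X \<in> Obj C \<Longrightarrow> X \<in> Obj C" .
    show "\<And>f X Y. f \<in> Hom C X Y \<Longrightarrow> \<Phi> f \<in> Hom D X Y" by (rule map_Hom)
    show "\<And>X. X \<in> Obj C \<Longrightarrow> \<Phi> (Idt C X) = Idt D X" by (rule map_Idt)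
    show "\<And>g Y Z f X. g \<in> Hom C Y Z \<Longrightarrow> f \<in> Hom C X Y \<Longrightarrow> \<Phi> (g \<cdot>\<^bsub>C\<^esub> f) = \<Phi> g \<cdot>\<^bsub>D\<^esub> \<Phi> f"
      by (rule map_Comp)
    show "\<And>X Y. X \<in> Obj C \<Longrightarrow> Y \<in> Obj C \<Longrightarrow> iso_in D (X \<boxdot>\<^bsub>C\<^esub> Y) (X \<boxdot>\<^bsub>C\<^esub> Y) (Idt D (X \<boxdot>\<^bsub>C\<^esub> Y))"
      using D.iso_in_Idt T Obj_eq by simp
    show "iso_in D (Unit C) (Unit C) (Idt D (Unit C))"
      using D.iso_in_Idt C.Unit_Obj Obj_eq by simp
    show "\<And>f X Y f' X' Y'. f \<in> Hom C X Y \<Longrightarrow> f' \<in> Hom C X' Y' \<Longrightarrow>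
      Idt D (Y \<boxdot>\<^bsub>C\<^esub> Y') \<cdot>\<^bsub>D\<^esub> (\<Phi> f \<boxtimes>\<^bsub>D\<^esub> \<Phi> f') = \<Phi> (f \<boxtimes>\<^bsub>C\<^esub> f') \<cdot>\<^bsub>D\<^esub> Idt D (X \<boxdot>\<^bsub>C\<^esub> X')"
      by (rule nat)
    show "Idt D ((X \<boxdot>\<^bsub>C\<^esub> Y) \<boxdot>\<^bsub>C\<^esub> Z) \<cdot>\<^bsub>D\<^esub> (Idt D (X \<boxdot>\<^bsub>C\<^esub> Y) \<boxtimes>\<^bsub>D\<^esub> Idt D Z)
        = Idt D (X \<boxdot>\<^bsub>C\<^esub> Y \<boxdot>\<^bsub>C\<^esub> Z) \<cdot>\<^bsub>D\<^esub> (Idt D X \<boxtimes>\<^bsub>D\<^esub> Idt D (Y \<boxdot>\<^bsub>C\<^esub> Z))"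
      if "X \<in> Obj C" "Y \<in> Obj C" "Z \<in> Obj C" for X Y Z
      using that T D.TArr_Idt[of _ _, unfolded Obj_eq TObj_eq] C.TObj_assoc by simp
    show "Idt D (Unit C \<boxdot>\<^bsub>C\<^esub> X) \<cdot>\<^bsub>D\<^esub> (Idt D (Unit C) \<boxtimes>\<^bsub>D\<^esub> Idt D X) = Idt D X"
      "Idt D (X \<boxdot>\<^bsub>C\<^esub> Unit C) \<cdot>\<^bsub>D\<^esub> (Idt D X \<boxtimes>\<^bsub>D\<^esub> Idt D (Unit C)) = Idt D X"
      if "X \<in> Obj C" for X
      using that idc C.Unit_Obj D.TArr_Idt[of _ _, unfolded Obj_eq TObj_eq] C.Unit_TObj C.TObj_Unit by simp_all
  qed
qed

lemma nat_iso_identity: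
  assumes "strict_monoidal_category C"
    and "\<And>X. X \<in> Obj C \<Longrightarrow> FObj F X = X" "\<And>X. X \<in> Obj C \<Longrightarrow> FObj F' X = X"
    and "\<And>f. f \<in> Arr C \<Longrightarrow> FArr F f = f" "\<And>f. f \<in> Arr C \<Longrightarrow> FArr F' f = f"
    and "\<And>X Y. X \<in> Obj C \<Longrightarrow> Y \<in> Obj C \<Longrightarrow> FTen F X Y = Idt C (X \<boxdot>\<^bsub>C\<^esub> Y)"
      "\<And>X Y. X \<in> Obj C \<Longrightarrow> Y \<in> Obj C \<Longrightarrow> FTen F' X Y = Idt C (X \<boxdot>\<^bsub>C\<^esub> Y)"
    and "FUnit F = Idt C (Unit C)" "FUnit F' = Idt C (Unit C)"
  shows "monoidal_nat_iso C C F F' (Idt C)"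
proof -
  interpret C: strict_monoidal_category C by fact
  show ?thesis
  proof
    show "iso_in C (FObj F X) (FObj F' X) (Idt C X)" if "X \<in> Obj C" for X
      using that assms C.iso_in_Idt by simp
    show "Idt C Y \<cdot>\<^bsub>C\<^esub> FArr F f = FArr F' f \<cdot>\<^bsub>C\<^esub> Idt C X" if "f \<in> Hom C X Y" for f X Y
      using that assms(4,5) C.Idt_Comp[OF that] C.Comp_Idt[OF that] by (simp add: Hom_def)
    show "Idt C (X \<boxdot>\<^bsub>C\<^esub> Y) \<cdot>\<^bsub>C\<^esub> FTen F X Y = FTen F' X Y \<cdot>\<^bsub>C\<^esub> (Idt C X \<boxtimes>\<^bsub>C\<^esub> Idt C Y)"
      if "X \<in> Obj C" "Y \<in> Obj C" for X Y
      using that assms C.TArr_Idt by simp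
    show "Idt C (Unit C) \<cdot>\<^bsub>C\<^esub> FUnit F = FUnit F'"
      using assms C.Comp_Idt[OF C.Idt_Hom[OF C.Unit_Obj]] by simp
  qed
qed

text \<open>Only \<open>C\<close> has to be known to be strict monoidal: each axiom for \<open>D\<close> is the image of the
  same axiom for \<open>C\<close>. The inverse of \<open>\<Phi>\<close> gives the functor in the other direction, and both
  composites are identities, so the identities serve as natural isomorphisms.\<close>

theorem monoidally_equivalent_of_bijective:
  assumes C: "strict_monoidal_category C" and F: "identity_on_objects_functor C D \<Phi>"
    and bij: "bij_betw \<Phi> (Arr C) (Arr D)"
  shows "monoidally_equivalent D C"
proof -
  interpret C: strict_monoidal_category C by fact
  interpret F: identity_on_objects_functor C D \<Phi> by fact
  define \<Psi> where "\<Psi> = inv_into (Arr C) \<Phi>"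
  have \<Phi>\<Psi>: "\<Phi> (\<Psi> g) = g" if "g \<in> Arr D" for g
    using bij that by (simp add: \<Psi>_def bij_betw_inv_into_right)
  have \<Psi>\<Phi>: "\<Psi> (\<Phi> f) = f" if "f \<in> Arr C" for f
    using bij that by (simp add: \<Psi>_def bij_betw_inv_into_left)
  have \<Psi>A: "\<Psi> g \<in> Arr C" if "g \<in> Arr D" for g
    using bij that by (metis \<Psi>_def bij_betw_def inv_into_into)
  have ex: "\<exists>f. f \<in> Hom C X Y \<and> \<Phi> f = g" if g: "g \<in> Hom D X Y" for g X Y
  proof -
    have "\<Phi> (\<Psi> g) \<in> Hom D (Dom C (\<Psi> g)) (Cod C (\<Psi> g))"
      using g \<Psi>A by (intro F.map_Hom) (simp add: Hom_def)
    then show ?thesis using g \<Phi>\<Psi>[of g] \<Psi>A[of g] by (intro exI[of _ "\<Psi> g"]) (auto simp: Hom_def)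
  qed
  have exA: "\<exists>f X Y. f \<in> Hom C X Y \<and> \<Phi> f = g" if g: "g \<in> Arr D" for g
    using ex[of g "Dom D g" "Cod D g"] g by (auto simp: Hom_def)
  have D: "strict_monoidal_category D"
  proof (unfold_locales, unfold F.Obj_eq F.Unit_eq F.TObj_eq)
    fix f assume "f \<in> Arr D"
    then obtain f0 X Y where f: "f0 \<in> Hom C X Y" "f = \<Phi> f0" using exA by blast
    have "f \<in> Hom D X Y" using F.map_Hom f by blast
    then show "Dom D f \<in> Obj C" "Cod D f \<in> Obj C"
      using f C.Dom_Obj[of f0] C.Cod_Obj[of f0] by (auto simp: Hom_def)
    show "f \<boxtimes>\<^bsub>D\<^esub> Idt D (Unit C) = f" "Idt D (Unit C) \<boxtimes>\<^bsub>D\<^esub> f = f"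
      using f(1) C.TArr_Unit[of f0] C.Unit_TArr[of f0]
        F.map_TArr[OF f(1) C.Idt_Hom[OF C.Unit_Obj]] F.map_TArr[OF C.Idt_Hom[OF C.Unit_Obj] f(1)]
      unfolding f(2) F.map_Idt[OF C.Unit_Obj, symmetric] by (simp_all add: Hom_def)
  next
    show "\<And>X. X \<in> Obj C \<Longrightarrow> Idt D X \<in> Hom D X X" using F.map_Hom[OF C.Idt_Hom] F.map_Idt by metis
    show "\<And>X Y. X \<in> Obj C \<Longrightarrow> Y \<in> Obj C \<Longrightarrow> X \<boxdot>\<^bsub>C\<^esub> Y \<in> Obj C" by (rule C.TObj_Obj)
    show "Unit C \<in> Obj C" by (rule C.Unit_Obj)
    show "\<And>X Y Z. X \<in> Obj C \<Longrightarrow> Y \<in> Obj C \<Longrightarrow> Z \<in> Obj C \<Longrightarrow> (X \<boxdot>\<^bsub>C\<^esub> Y) \<boxdot>\<^bsub>C\<^esub> Z = X \<boxdot>\<^bsub>C\<^esub> Y \<boxdot>\<^bsub>C\<^esub> Z"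
      by (rule C.TObj_assoc)
    show "\<And>X. X \<in> Obj C \<Longrightarrow> X \<boxdot>\<^bsub>C\<^esub> Unit C = X" by (rule C.TObj_Unit)
    show "\<And>X. X \<in> Obj C \<Longrightarrow> Unit C \<boxdot>\<^bsub>C\<^esub> X = X" by (rule C.Unit_TObj)
    fix X Y assume XY: "X \<in> Obj C" "Y \<in> Obj C"
    then show "Idt D X \<boxtimes>\<^bsub>D\<^esub> Idt D Y = Idt D (X \<boxdot>\<^bsub>C\<^esub> Y)"
      using F.map_TArr[OF C.Idt_Hom[OF XY(1)] C.Idt_Hom[OF XY(2)]] C.TArr_Idt[OF XY]
        F.map_Idt C.TObj_Obj by simp
  next
    fix f X Y assume "f \<in> Hom D X Y"
    then obtain f0 where f: "f0 \<in> Hom C X Y" "f = \<Phi> f0" using ex by blast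
    have "X \<in> Obj C" "Y \<in> Obj C" using f C.Dom_Obj C.Cod_Obj by (auto simp: Hom_def)
    then show "f \<cdot>\<^bsub>D\<^esub> Idt D X = f" "Idt D Y \<cdot>\<^bsub>D\<^esub> f = f"
      using F.map_Comp[OF f(1) C.Idt_Hom[of X]] F.map_Comp[OF C.Idt_Hom[of Y] f(1)] f(2)
        C.Comp_Idt[OF f(1)] C.Idt_Comp[OF f(1)] F.map_Idt by simp_all
  next
    fix f X Y g Z assume "g \<in> Hom D Y Z" "f \<in> Hom D X Y"
    then obtain f0 g0 where f: "f0 \<in> Hom C X Y" "f = \<Phi> f0" and g: "g0 \<in> Hom C Y Z" "g = \<Phi> g0"
      using ex by metis
    show "g \<cdot>\<^bsub>D\<^esub> f \<in> Hom D X Z"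
      using F.map_Comp[OF g(1) f(1)] F.map_Hom[OF C.Comp_Hom[OF g(1) f(1)]] f g by simp
  next
    fix h Z W g Y f X assume "h \<in> Hom D Z W" "g \<in> Hom D Y Z" "f \<in> Hom D X Y"
    then obtain f0 g0 h0 where f: "f0 \<in> Hom C X Y" "f = \<Phi> f0" and g: "g0 \<in> Hom C Y Z" "g = \<Phi> g0"
      and h: "h0 \<in> Hom C Z W" "h = \<Phi> h0"
      using ex by metis
    show "(h \<cdot>\<^bsub>D\<^esub> g) \<cdot>\<^bsub>D\<^esub> f = h \<cdot>\<^bsub>D\<^esub> g \<cdot>\<^bsub>D\<^esub> f"
      using F.map_Comp[OF C.Comp_Hom[OF h(1) g(1)] f(1)] F.map_Comp[OF h(1) C.Comp_Hom[OF g(1) f(1)]]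
        F.map_Comp[OF h(1) g(1)] F.map_Comp[OF g(1) f(1)] C.Comp_assoc[OF h(1) g(1) f(1)] f g h by simp
  next
    fix f X Y f' X' Y' assume "f \<in> Hom D X Y" "f' \<in> Hom D X' Y'"
    then obtain f0 g0 where f: "f0 \<in> Hom C X Y" "f = \<Phi> f0" and g: "g0 \<in> Hom C X' Y'" "f' = \<Phi> g0"
      using ex by metis
    show "f \<boxtimes>\<^bsub>D\<^esub> f' \<in> Hom D (X \<boxdot>\<^bsub>C\<^esub> X') (Y \<boxdot>\<^bsub>C\<^esub> Y')"
      using F.map_TArr[OF f(1) g(1)] F.map_Hom[OF C.TArr_Hom[OF f(1) g(1)]] f g by simp
  next
    fix g Y Z f X g' Y' Z' f' X'
    assume "g \<in> Hom D Y Z" "f \<in> Hom D X Y" "g' \<in> Hom D Y' Z'" "f' \<in> Hom D X' Y'"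
    then obtain f0 g0 f1 g1 where f: "f0 \<in> Hom C X Y" "f = \<Phi> f0" and g: "g0 \<in> Hom C Y Z" "g = \<Phi> g0"
      and f': "f1 \<in> Hom C X' Y'" "f' = \<Phi> f1" and g': "g1 \<in> Hom C Y' Z'" "g' = \<Phi> g1"
      using ex by metis
    have "\<Phi> ((g0 \<cdot>\<^bsub>C\<^esub> f0) \<boxtimes>\<^bsub>C\<^esub> (g1 \<cdot>\<^bsub>C\<^esub> f1)) = \<Phi> ((g0 \<boxtimes>\<^bsub>C\<^esub> g1) \<cdot>\<^bsub>C\<^esub> (f0 \<boxtimes>\<^bsub>C\<^esub> f1))"
      using C.TArr_Comp[OF g(1) f(1) g'(1) f'(1)] by simp
    then show "(g \<cdot>\<^bsub>D\<^esub> f) \<boxtimes>\<^bsub>D\<^esub> (g' \<cdot>\<^bsub>D\<^esub> f') = (g \<boxtimes>\<^bsub>D\<^esub> g') \<cdot>\<^bsub>D\<^esub> (f \<boxtimes>\<^bsub>D\<^esub> f')"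
      unfolding F.map_TArr[OF C.Comp_Hom[OF g(1) f(1)] C.Comp_Hom[OF g'(1) f'(1)]]
        F.map_Comp[OF g(1) f(1)] F.map_Comp[OF g'(1) f'(1)]
        F.map_Comp[OF C.TArr_Hom[OF g(1) g'(1)] C.TArr_Hom[OF f(1) f'(1)]]
        F.map_TArr[OF g(1) g'(1)] F.map_TArr[OF f(1) f'(1)] f(2) g(2) f'(2) g'(2) .
  next
    fix f g h assume "f \<in> Arr D" "g \<in> Arr D" "h \<in> Arr D"
    then obtain f0 X Y g0 X' Y' h0 X'' Y'' where f: "f0 \<in> Hom C X Y" "f = \<Phi> f0"
      and g: "g0 \<in> Hom C X' Y'" "g = \<Phi> g0" and h: "h0 \<in> Hom C X'' Y''" "h = \<Phi> h0"
      using exA by metis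
    have "\<Phi> ((f0 \<boxtimes>\<^bsub>C\<^esub> g0) \<boxtimes>\<^bsub>C\<^esub> h0) = \<Phi> (f0 \<boxtimes>\<^bsub>C\<^esub> g0 \<boxtimes>\<^bsub>C\<^esub> h0)"
      using C.TArr_assoc[of f0 g0 h0] f g h by (simp add: Hom_def)
    then show "(f \<boxtimes>\<^bsub>D\<^esub> g) \<boxtimes>\<^bsub>D\<^esub> h = f \<boxtimes>\<^bsub>D\<^esub> g \<boxtimes>\<^bsub>D\<^esub> h"
      unfolding F.map_TArr[OF C.TArr_Hom[OF f(1) g(1)] h(1)] F.map_TArr[OF f(1) C.TArr_Hom[OF g(1) h(1)]]
        F.map_TArr[OF f(1) g(1)] F.map_TArr[OF g(1) h(1)] f(2) g(2) h(2) .
  qed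
  interpret D: strict_monoidal_category D by fact
  have G: "identity_on_objects_functor D C \<Psi>"
  proof (unfold_locales, unfold F.Obj_eq F.Unit_eq F.TObj_eq)
    have map: "\<Psi> g \<in> Hom C X Y" if "g \<in> Hom D X Y" for g X Y
      using ex[OF that] \<Psi>\<Phi> by (auto simp: Hom_def)
    show "\<And>f X Y. f \<in> Hom D X Y \<Longrightarrow> \<Psi> f \<in> Hom C X Y" by (rule map)
    have A: "f \<in> Arr C" if "f \<in> Hom C X Y" for f X Y using that by (simp add: Hom_def)
    have B: "f \<in> Arr D" if "f \<in> Hom D X Y" for f X Y using that by (simp add: Hom_def)
    show "\<And>X. X \<in> Obj C \<Longrightarrow> \<Psi> (Idt D X) = Idt C X"
      using F.map_Idt \<Psi>\<Phi> A C.Idt_Hom by metis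
    show "\<Psi> (g \<cdot>\<^bsub>D\<^esub> f) = \<Psi> g \<cdot>\<^bsub>C\<^esub> \<Psi> f" if "g \<in> Hom D Y Z" "f \<in> Hom D X Y" for g Y Z f X
    proof -
      have "g \<cdot>\<^bsub>D\<^esub> f = \<Phi> (\<Psi> g \<cdot>\<^bsub>C\<^esub> \<Psi> f)"
        using F.map_Comp[OF map[OF that(1)] map[OF that(2)]] \<Phi>\<Psi> B[OF that(1)] B[OF that(2)] by simp
      then show ?thesis using \<Psi>\<Phi> A[OF C.Comp_Hom[OF map[OF that(1)] map[OF that(2)]]] by simp
    qed
    show "\<Psi> (f \<boxtimes>\<^bsub>D\<^esub> f') = \<Psi> f \<boxtimes>\<^bsub>C\<^esub> \<Psi> f'" if "f \<in> Hom D X Y" "f' \<in> Hom D X' Y'" for f X Y f' X' Y'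
    proof -
      have "f \<boxtimes>\<^bsub>D\<^esub> f' = \<Phi> (\<Psi> f \<boxtimes>\<^bsub>C\<^esub> \<Psi> f')"
        using F.map_TArr[OF map[OF that(1)] map[OF that(2)]] \<Phi>\<Psi> B[OF that(1)] B[OF that(2)] by simp
      then show ?thesis using \<Psi>\<Phi> A[OF C.TArr_Hom[OF map[OF that(1)] map[OF that(2)]]] by simp
    qed
  qed auto
  have unitC: "Idt C (Unit C) \<cdot>\<^bsub>C\<^esub> Idt C (Unit C) = Idt C (Unit C)"
    using C.Comp_Idt[OF C.Idt_Hom[OF C.Unit_Obj]] .
  have unitD: "Idt D (Unit D) \<cdot>\<^bsub>D\<^esub> Idt D (Unit D) = Idt D (Unit D)"
    using D.Comp_Idt[OF D.Idt_Hom[OF D.Unit_Obj]] .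
  have TC: "Idt C (X \<boxdot>\<^bsub>C\<^esub> Y) \<cdot>\<^bsub>C\<^esub> Idt C (X \<boxdot>\<^bsub>C\<^esub> Y) = Idt C (X \<boxdot>\<^bsub>C\<^esub> Y)"
    if "X \<in> Obj C" "Y \<in> Obj C" for X Y
    using C.Comp_Idt[OF C.Idt_Hom[OF C.TObj_Obj[OF that]]] .
  have TD: "Idt D (X \<boxdot>\<^bsub>D\<^esub> Y) \<cdot>\<^bsub>D\<^esub> Idt D (X \<boxdot>\<^bsub>D\<^esub> Y) = Idt D (X \<boxdot>\<^bsub>D\<^esub> Y)"
    if "X \<in> Obj D" "Y \<in> Obj D" for X Y
    using D.Comp_Idt[OF D.Idt_Hom[OF D.TObj_Obj[OF that]]] .
  interpret G: identity_on_objects_functor D C \<Psi> by fact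
  have "monoidal_nat_iso D D (id_monfun D) (comp_monfun D (strict_monfun D \<Phi>) (strict_monfun C \<Psi>)) (Idt D)"
    by (rule nat_iso_identity[OF D])
      (simp_all add: id_monfun_def comp_monfun_def strict_monfun_def \<Phi>\<Psi> TD unitD
        F.Obj_eq[symmetric] F.Unit_eq[symmetric] F.TObj_eq[symmetric] F.map_Idt D.TObj_Obj D.Unit_Obj
        G.Obj_eq G.Unit_eq G.TObj_eq)
  moreover have "monoidal_nat_iso C C (comp_monfun C (strict_monfun C \<Psi>) (strict_monfun D \<Phi>)) (id_monfun C) (Idt C)"
    by (rule nat_iso_identity[OF C])
      (simp_all add: id_monfun_def comp_monfun_def strict_monfun_def \<Psi>\<Phi> TC unitC
        F.Obj_eq F.Unit_eq F.TObj_eq G.map_Idt C.TObj_Obj C.Unit_Obj)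
  ultimately show ?thesis
    unfolding monoidally_equivalent_def
    using C D monoidal_functor_strict[OF D C G] monoidal_functor_strict[OF C D F] by blast
qed

section \<open>The category of webs\<close>

lemma web_hom_nonzero: "web_hom n m t \<Longrightarrow> 0 \<notin> set n \<and> 0 \<notin> set m"
  by (induction rule: web_hom.induct) auto

lemma web_hom_sum: "web_hom n m t \<Longrightarrow> sum_list n = sum_list m"
  by (induction rule: web_hom.induct) auto

lemma web_hom_Id1: "a \<ge> 1 \<Longrightarrow> web_hom [a] [a] (WId [a])"
  by (intro hom_id) simp

lemma web_hom_tens': "web_hom n m t \<Longrightarrow> web_hom n' m' t' \<Longrightarrow> X = n @ n' \<Longrightarrow> Y = m @ m' \<Longrightarrow> web_hom X Y (WTens t t')"
  using hom_tens by blast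

lemma web_eq_hom: "web_eq n m t u \<Longrightarrow> web_hom n m t \<and> web_hom n m u"
proof (induction rule: web_eq.induct)
  case (tens_assoc n m t n' m' u n'' m'' v)
  then show ?case using hom_tens[OF hom_tens] hom_tens[OF _ hom_tens] by fastforce
next
  case (bigon a b)
  then show ?case using hom_comp[OF hom_merge hom_split] hom_id[of "[a + b]"] by simp
next
  case (assoc a b c)
  have "web_hom ([a, b] @ [c]) ([a + b] @ [c]) (WTens (Merge a b) (WId [c]))"
    "web_hom ([a] @ [b, c]) ([a] @ [b + c]) (WTens (WId [a]) (Merge b c))"
    using assoc by (auto intro!: web_hom_Id1 hom_merge hom_tens simp del: append.simps)
  then show ?case using assoc hom_comp[of "[a + b, c]" "[a + b + c]" _ "[a, b, c]"]
      hom_comp[of "[a, b + c]" "[a + b + c]" _ "[a, b, c]"] hom_merge[of "a + b" c] hom_merge[of a "b + c"]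
    by (simp add: add.assoc)
next
  case (coassoc a b c)
  have "web_hom ([a + b] @ [c]) ([a, b] @ [c]) (WTens (Split a b) (WId [c]))"
    "web_hom ([a] @ [b + c]) ([a] @ [b, c]) (WTens (WId [a]) (Split b c))"
    using coassoc by (auto intro!: web_hom_Id1 hom_split hom_tens simp del: append.simps)
  then show ?case using coassoc hom_comp[of "[a + b, c]" "[a, b, c]" _ "[a + b + c]"]
      hom_comp[of "[a, b + c]" "[a, b, c]" _ "[a + b + c]"] hom_split[of "a + b" c] hom_split[of a "b + c"]
    by (simp add: add.assoc)
next
  case (square_less a N b)
  define c where "c = N - a - b"
  have N: "N = a + b + c" "c \<ge> 1" using square_less by (auto simp: c_def)
  have 1: "web_hom [a, b + c] [a, b, c] (WTens (WId [a]) (Split b c))"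
    using square_less N by (intro web_hom_tens'[OF web_hom_Id1 hom_split]) auto
  have 2: "web_hom [a, b, c] [a + b, c] (WTens (Merge a b) (WId [c]))"
    using square_less N by (intro web_hom_tens'[OF hom_merge web_hom_Id1]) auto
  have 3: "web_hom [a + b, c] [b, a, c] (WTens (Split b a) (WId [c]))"
    using square_less N by (intro web_hom_tens'[OF hom_split web_hom_Id1]) auto
  have 4: "web_hom [b, a, c] [b, a + c] (WTens (WId [b]) (Merge a c))"
    using square_less N by (intro web_hom_tens'[OF web_hom_Id1 hom_merge]) auto
  have 5: "web_hom [a, b + c] [N] (Merge a (b + c))" "web_hom [N] [b, a + c] (Split b (a + c))"
    using square_less N hom_merge[of a "b + c"] hom_split[of b "a + c"] by (auto simp: add_ac)
  have e: "N - a = b + c" "N - b = a + c" "N - a - b = c" using N by auto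
  show ?case unfolding e
    using hom_comp[OF 4 hom_comp[OF 3 hom_comp[OF 2 1]]] hom_comp[OF 5(2,1)] by (simp add: e)
next
  case (square_greater a N b)
  define c where "c = a + b - N"
  define d where "d = N - a"
  define e where "e = N - b"
  have N: "a = c + e" "b = c + d" "N = c + d + e" "c \<ge> 1" "d \<ge> 1" "e \<ge> 1"
    using square_greater by (auto simp: c_def d_def e_def)
  have 1: "web_hom [c + e, d] [c, e, d] (WTens (Split c e) (WId [d]))"
    using N by (intro web_hom_tens'[OF hom_split web_hom_Id1]) auto
  have 2: "web_hom [c, e, d] [c, e + d] (WTens (WId [c]) (Merge e d))"
    using N by (intro web_hom_tens'[OF web_hom_Id1 hom_merge]) auto
  have 3: "web_hom [c, e + d] [c, d, e] (WTens (WId [c]) (Split d e))"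
    using N by (intro web_hom_tens'[OF web_hom_Id1 hom_split]) (auto simp: add_ac)
  have 4: "web_hom [c, d, e] [c + d, e] (WTens (Merge c d) (WId [e]))"
    using N by (intro web_hom_tens'[OF hom_merge web_hom_Id1]) auto
  have 5: "web_hom [c + e, d] [N] (Merge (c + e) d)" "web_hom [N] [c + d, e] (Split (c + d) e)"
    using N hom_merge[of "c + e" d] hom_split[of "c + d" e] by (auto simp: add_ac)
  show ?case
    unfolding c_def[symmetric] d_def[symmetric] e_def[symmetric]
    using hom_comp[OF 4 hom_comp[OF 3 hom_comp[OF 2 1]]] hom_comp[OF 5(2,1)] N(1,2) by simp
next
  case (id_right n m t)
  then show ?case using web_hom_nonzero hom_comp[OF _ hom_id] by blast
next
  case (id_left n m t)
  then show ?case using web_hom_nonzero hom_comp[OF hom_id] by blast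
next
  case (unit_right n m t)
  then show ?case using hom_tens[OF _ hom_id[of "[]"]] by force
next
  case (unit_left n m t)
  then show ?case using hom_tens[OF hom_id[of "[]"]] by force
qed (auto intro: web_hom.intros)

lemma web_class_eq_iff:
  "web_hom n m t \<Longrightarrow> web_class n m t = web_class n m u \<longleftrightarrow> web_eq n m t u"
  unfolding web_class_def
  by (auto intro: web_eq.eq_refl web_eq.eq_sym web_eq.eq_trans dest: web_eq_hom)

text \<open>The morphism of webs that a diagram represents between sequences that may contain zeros.\<close>

definition web_arrow :: "nat list \<Rightarrow> nat list \<Rightarrow> web \<Rightarrow> web_arr" where
  "web_arrow n m t = (n, m, web_class (erase_zeros n) (erase_zeros m) t)"

abbreviation (input) ez :: "nat list \<Rightarrow> nat list" where
  "ez \<equiv> erase_zeros"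

abbreviation (input) Wb :: "(nat list, web_arr) moncat" where
  "Wb \<equiv> SC_Webs"

lemma ez_append [simp]: "ez (n @ m) = ez n @ ez m"
  by (simp add: erase_zeros_def)

lemma ez_nonzero [simp]: "0 \<notin> set (ez n)"
  by (simp add: erase_zeros_def)

lemma ez_id: "0 \<notin> set n \<Longrightarrow> ez n = n"
  unfolding erase_zeros_def by (rule filter_True) metis

lemma SC_Webs_Obj [simp]: "Obj Wb = UNIV" and SC_Webs_Unit [simp]: "Unit Wb = []"
  and SC_Webs_TObj [simp]: "TObj Wb = (@)"
  and SC_Webs_Idt: "Idt Wb n = web_arrow n n (WId (ez n))"
  and SC_Webs_Dom: "Dom Wb (web_arrow n m t) = n" and SC_Webs_Cod: "Cod Wb (web_arrow n m t) = m"
  and SC_Webs_Arr: "Arr Wb = {web_arrow n m t | n m t. web_hom (ez n) (ez m) t}"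
  by (simp_all add: SC_Webs_def web_arrow_def)

lemma web_arrow_Hom: "web_hom (ez n) (ez m) t \<Longrightarrow> web_arrow n m t \<in> Hom Wb n m"
  unfolding Hom_def SC_Webs_Arr by (auto simp: SC_Webs_Dom SC_Webs_Cod)

lemma HomE_web_arrow:
  assumes "f \<in> Hom Wb n m"
  obtains t where "f = web_arrow n m t" "web_hom (ez n) (ez m) t"
  using assms unfolding Hom_def SC_Webs_Arr by (auto simp: SC_Webs_Dom SC_Webs_Cod)

lemma web_arrow_eq_iff: "web_hom (ez n) (ez m) t \<Longrightarrow> web_arrow n m t = web_arrow n m u \<longleftrightarrow> web_eq (ez n) (ez m) t u"
  by (simp add: web_arrow_def web_class_eq_iff)

lemma web_arrow_eqI: "web_eq (ez n) (ez m) t u \<Longrightarrow> web_arrow n m t = web_arrow n m u"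
  using web_arrow_eq_iff web_eq_hom by blast

lemma web_arrow_Comp:
  assumes "web_hom (ez m) (ez k) t" "web_hom (ez n) (ez m) u"
  shows "web_arrow m k t \<cdot>\<^bsub>Wb\<^esub> web_arrow n m u = web_arrow n k (WComp t u)"
proof -
  have "(\<Union>t'\<in>web_class (ez m) (ez k) t. \<Union>u'\<in>web_class (ez n) (ez m) u. web_class (ez n) (ez k) (WComp t' u'))
    = web_class (ez n) (ez k) (WComp t u)" (is "?L = ?R")
  proof
    show "?L \<subseteq> ?R" using web_eq.cong_comp web_eq.eq_trans by (auto simp: web_class_def) blast
    have "t \<in> web_class (ez m) (ez k) t" "u \<in> web_class (ez n) (ez m) u"
      using assms by (auto simp: web_class_def intro: web_eq.eq_refl)
    then show "?R \<subseteq> ?L" by blast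
  qed
  then show ?thesis by (simp add: SC_Webs_def web_arrow_def)
qed

lemma web_arrow_TArr:
  assumes "web_hom (ez n) (ez m) t" "web_hom (ez n') (ez m') u"
  shows "web_arrow n m t \<boxtimes>\<^bsub>Wb\<^esub> web_arrow n' m' u = web_arrow (n @ n') (m @ m') (WTens t u)"
proof -
  have "(\<Union>t'\<in>web_class (ez n) (ez m) t. \<Union>u'\<in>web_class (ez n') (ez m') u.
      web_class (ez (n @ n')) (ez (m @ m')) (WTens t' u'))
    = web_class (ez (n @ n')) (ez (m @ m')) (WTens t u)" (is "?L = ?R")
  proof
    show "?L \<subseteq> ?R" using web_eq.cong_tens web_eq.eq_trans by (auto simp: web_class_def) blast
    have "t \<in> web_class (ez n) (ez m) t" "u \<in> web_class (ez n') (ez m') u"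
      using assms by (auto simp: web_class_def intro: web_eq.eq_refl)
    then show "?R \<subseteq> ?L" by blast
  qed
  then show ?thesis by (simp add: SC_Webs_def web_arrow_def)
qed

lemma web_hom_WId_ez: "web_hom (ez n) (ez n) (WId (ez n))"
  by (rule hom_id) simp

lemma strict_monoidal_SC_Webs: "strict_monoidal_category Wb"
proof (unfold_locales, unfold SC_Webs_Obj SC_Webs_Unit SC_Webs_TObj)
  show Idt: "Idt Wb X \<in> Hom Wb X X" for X
    unfolding SC_Webs_Idt using web_hom_WId_ez by (rule web_arrow_Hom)
  show "g \<cdot>\<^bsub>Wb\<^esub> f \<in> Hom Wb X Z" if "g \<in> Hom Wb Y Z" "f \<in> Hom Wb X Y" for f g X Y Z
    using that by (elim HomE_web_arrow) (simp add: web_arrow_Comp web_arrow_Hom hom_comp)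
  show "f \<cdot>\<^bsub>Wb\<^esub> Idt Wb X = f" "Idt Wb Y \<cdot>\<^bsub>Wb\<^esub> f = f" if "f \<in> Hom Wb X Y" for f X Y
    using that unfolding SC_Webs_Idt
    by (auto elim!: HomE_web_arrow simp: web_arrow_Comp web_hom_WId_ez intro!: web_arrow_eqI web_eq.id_right web_eq.id_left)
  show "(h \<cdot>\<^bsub>Wb\<^esub> g) \<cdot>\<^bsub>Wb\<^esub> f = h \<cdot>\<^bsub>Wb\<^esub> (g \<cdot>\<^bsub>Wb\<^esub> f)"
    if "h \<in> Hom Wb Z W" "g \<in> Hom Wb Y Z" "f \<in> Hom Wb X Y" for h g f X Y Z W
    using that by (elim HomE_web_arrow) (simp add: web_arrow_Comp hom_comp, blast intro: web_arrow_eqI web_eq.comp_assoc)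
  show "f \<boxtimes>\<^bsub>Wb\<^esub> f' \<in> Hom Wb (X @ X') (Y @ Y')"
    if "f \<in> Hom Wb X Y" "f' \<in> Hom Wb X' Y'" for f f' X Y X' Y'
    using that by (elim HomE_web_arrow) (simp add: web_arrow_TArr web_arrow_Hom hom_tens)
  show "Idt Wb X \<boxtimes>\<^bsub>Wb\<^esub> Idt Wb Y = Idt Wb (X @ Y)" for X Y
    unfolding SC_Webs_Idt web_arrow_TArr[OF web_hom_WId_ez web_hom_WId_ez]
    using web_eq.tens_id[of "ez X" "ez Y"] by (intro web_arrow_eqI) simp
  show "(g \<cdot>\<^bsub>Wb\<^esub> f) \<boxtimes>\<^bsub>Wb\<^esub> (g' \<cdot>\<^bsub>Wb\<^esub> f') = (g \<boxtimes>\<^bsub>Wb\<^esub> g') \<cdot>\<^bsub>Wb\<^esub> (f \<boxtimes>\<^bsub>Wb\<^esub> f')"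
    if "g \<in> Hom Wb Y Z" "f \<in> Hom Wb X Y" "g' \<in> Hom Wb Y' Z'" "f' \<in> Hom Wb X' Y'"
    for g f g' f' X Y Z X' Y' Z'
    using that
    by (elim HomE_web_arrow) (simp add: web_arrow_TArr web_arrow_Comp hom_tens hom_comp, rule web_arrow_eqI, simp add: web_eq.interchange)
  fix f assume "f \<in> Arr Wb"
  then obtain n m t where f: "f = web_arrow n m t" "web_hom (ez n) (ez m) t" by (auto simp: SC_Webs_Arr)
  have e: "ez [] = []" by (simp add: erase_zeros_def)
  have h: "web_hom (ez []) (ez []) (WId [])" by (simp add: e hom_id)
  show "f \<boxtimes>\<^bsub>Wb\<^esub> Idt Wb [] = f" "Idt Wb [] \<boxtimes>\<^bsub>Wb\<^esub> f = f"
    unfolding f(1) SC_Webs_Idt e using web_arrow_TArr[OF f(2) h] web_arrow_TArr[OF h f(2)] f(2)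
    by (simp_all add: web_arrow_eqI web_eq.unit_right web_eq.unit_left)
  fix g h assume "g \<in> Arr Wb" "h \<in> Arr Wb"
  then obtain n' m' t' n'' m'' t'' where g: "g = web_arrow n' m' t'" "web_hom (ez n') (ez m') t'"
    and h: "h = web_arrow n'' m'' t''" "web_hom (ez n'') (ez m'') t''" by (auto simp: SC_Webs_Arr)
  have 1: "web_hom (ez (n @ n')) (ez (m @ m')) (WTens t t')" "web_hom (ez (n' @ n'')) (ez (m' @ m'')) (WTens t' t'')"
    using f g h by (auto intro: hom_tens)
  show "(f \<boxtimes>\<^bsub>Wb\<^esub> g) \<boxtimes>\<^bsub>Wb\<^esub> h = f \<boxtimes>\<^bsub>Wb\<^esub> g \<boxtimes>\<^bsub>Wb\<^esub> h"
    unfolding f(1) g(1) h(1) web_arrow_TArr[OF f(2) g(2)] web_arrow_TArr[OF g(2) h(2)] web_arrow_TArr[OF 1(1) h(2)] web_arrow_TArr[OF f(2) 1(2)]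
    using web_eq.tens_assoc[OF f(2) g(2) h(2)] by (simp add: web_arrow_eqI)
qed auto

section \<open>Crossing diagrams\<close>

text \<open>What the calculations with diagrams use of the category of webs. The squares are
  parametrized by their labels, with \<open>c = N - a - b\<close> in the first one, and \<open>c = a + b - N\<close>, \<open>d =
  N - a\<close>, \<open>e = N - b\<close> in the second one, so that no subtraction occurs.\<close>

locale web_model = strict_monoidal_category C for C :: "(nat list, 'a) moncat" (structure) +
  fixes mg sp :: "nat \<Rightarrow> nat \<Rightarrow> 'a"
  assumes Obj_UNIV: "Obj C = UNIV" and TObj_append: "TObj C = (@)" and Unit_Nil: "Unit C = []"
    and mg_Hom: "\<lbrakk>1 \<le> a; 1 \<le> b\<rbrakk> \<Longrightarrow> mg a b \<in> Hom C [a, b] [a + b]"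
    and sp_Hom: "\<lbrakk>1 \<le> a; 1 \<le> b\<rbrakk> \<Longrightarrow> sp a b \<in> Hom C [a + b] [a, b]"
    and mg_sp: "\<lbrakk>1 \<le> a; 1 \<le> b\<rbrakk> \<Longrightarrow> mg a b \<cdot> sp a b = Idt C [a + b]"
    and mg_assoc: "\<lbrakk>1 \<le> a; 1 \<le> b; 1 \<le> c\<rbrakk> \<Longrightarrow>
      mg (a + b) c \<cdot> (mg a b \<boxtimes> Idt C [c]) = mg a (b + c) \<cdot> (Idt C [a] \<boxtimes> mg b c)"
    and sp_coassoc: "\<lbrakk>1 \<le> a; 1 \<le> b; 1 \<le> c\<rbrakk> \<Longrightarrow>
      (sp a b \<boxtimes> Idt C [c]) \<cdot> sp (a + b) c = (Idt C [a] \<boxtimes> sp b c) \<cdot> sp a (b + c)"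
    and square_lt: "\<lbrakk>1 \<le> a; 1 \<le> b; 1 \<le> c\<rbrakk> \<Longrightarrow>
      (Idt C [b] \<boxtimes> mg a c) \<cdot> (sp b a \<boxtimes> Idt C [c]) \<cdot> (mg a b \<boxtimes> Idt C [c]) \<cdot> (Idt C [a] \<boxtimes> sp b c)
        = sp b (a + c) \<cdot> mg a (b + c)"
    and square_gt: "\<lbrakk>1 \<le> c; 1 \<le> d; 1 \<le> e\<rbrakk> \<Longrightarrow>
      (mg c d \<boxtimes> Idt C [e]) \<cdot> (Idt C [c] \<boxtimes> sp d e) \<cdot> (Idt C [c] \<boxtimes> mg e d) \<cdot> (sp c e \<boxtimes> Idt C [d])
        = sp (c + d) e \<cdot> mg (c + e) d"
begin

lemma mg_arr [simp]:
  assumes "1 \<le> a" "1 \<le> b"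
  shows "mg a b \<in> Arr C" "Dom C (mg a b) = [a, b]" "Cod C (mg a b) = [a + b]"
  using mg_Hom[OF assms] by (auto simp: Hom_def)

lemma sp_arr [simp]:
  assumes "1 \<le> a" "1 \<le> b"
  shows "sp a b \<in> Arr C" "Dom C (sp a b) = [a + b]" "Cod C (sp a b) = [a, b]"
  using sp_Hom[OF assms] by (auto simp: Hom_def)

abbreviation I :: "nat list \<Rightarrow> 'a" where
  "I \<equiv> Idt C"

lemma I_arr [simp]: "I n \<in> Arr C" "Dom C (I n) = n" "Cod C (I n) = n"
  using Idt_arr[of n] by (simp_all add: Obj_UNIV)

lemma T_arr [simp]:
  assumes "f \<in> Arr C" "g \<in> Arr C"
  shows "f \<boxtimes> g \<in> Arr C" "Dom C (f \<boxtimes> g) = Dom C f @ Dom C g" "Cod C (f \<boxtimes> g) = Cod C f @ Cod C g"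
  using TArr_arr[OF assms] by (simp_all add: TObj_append)

declare Comp_arr [simp]

lemma I_tens [simp]: "I n \<boxtimes> I m = I (n @ m)"
  using TArr_Idt[of n m] by (simp add: Obj_UNIV TObj_append)

lemma tens_Nil [simp]: "f \<in> Arr C \<Longrightarrow> f \<boxtimes> I [] = f" "f \<in> Arr C \<Longrightarrow> I [] \<boxtimes> f = f"
  using TArr_Unit Unit_TArr by (simp_all add: Unit_Nil)

lemma I_tens_assoc: "f \<in> Arr C \<Longrightarrow> I n \<boxtimes> (I m \<boxtimes> f) = I (n @ m) \<boxtimes> f"
  using TArr_assoc[of "I n" "I m" f] by simp

lemma tens_comp_append_assoc:
  "g \<in> Arr C \<Longrightarrow> f \<in> Arr C \<Longrightarrow> g' \<in> Arr C \<Longrightarrow> f' \<in> Arr C \<Longrightarrow> Dom C g = Cod C f \<Longrightarrow> Dom C g' = Cod C f'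
    \<Longrightarrow> h \<in> Arr C \<Longrightarrow> Cod C h = Dom C f @ Dom C f'
    \<Longrightarrow> (g \<boxtimes> g') \<cdot> ((f \<boxtimes> f') \<cdot> h) = ((g \<cdot> f) \<boxtimes> (g' \<cdot> f')) \<cdot> h"
  by (rule tens_comp_assoc) (auto simp: TObj_append)

definition crossing :: 'a where
  "crossing = sp 1 1 \<cdot> mg 1 1"

lemma crossing_arr [simp]: "crossing \<in> Arr C" "Dom C crossing = [1, 1]" "Cod C crossing = [1, 1]"
  by (simp_all add: crossing_def)

lemma crossing_idem: "crossing \<cdot> crossing = crossing"
proof -
  have "crossing \<cdot> crossing = sp 1 1 \<cdot> ((mg 1 1 \<cdot> sp 1 1) \<cdot> mg 1 1)"
    by (simp add: crossing_def comp_assoc')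
  also have "\<dots> = crossing" by (simp add: mg_sp idt_left crossing_def)
  finally show ?thesis .
qed

abbreviation ones :: "nat \<Rightarrow> nat list" where "ones k \<equiv> replicate k 1"

definition crossing_at :: "nat \<Rightarrow> nat \<Rightarrow> 'a" where
  "crossing_at N i = I (ones (i - 1)) \<boxtimes> (crossing \<boxtimes> I (ones (N - i - 1)))"

lemma ones_split: "1 \<le> i \<Longrightarrow> i < N \<Longrightarrow> ones (i - 1) @ 1 # 1 # ones (N - i - 1) = ones N"
proof -
  assume i: "1 \<le> i" "i < N"
  have "ones (i - 1) @ 1 # 1 # ones (N - i - 1) = ones (i - 1) @ ones (2 + (N - i - 1))" by (simp add: numeral_2_eq_2)
  also have "\<dots> = ones (i - 1 + (2 + (N - i - 1)))" by (rule replicate_add[symmetric])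
  also have "i - 1 + (2 + (N - i - 1)) = N" using i by simp
  finally show ?thesis .
qed

lemma crossing_at_arr [simp]:
  assumes "1 \<le> i" "i < N"
  shows "crossing_at N i \<in> Arr C" "Dom C (crossing_at N i) = ones N" "Cod C (crossing_at N i) = ones N"
  using ones_split[OF assms] by (simp_all add: crossing_at_def)

lemma crossing_at_tens_left:
  assumes "1 \<le> i" "i < N"
  shows "crossing_at (N + M) i = crossing_at N i \<boxtimes> I (ones M)"
proof -
  have e: "N + M - i - 1 = (N - i - 1) + M" using assms by simp
  show ?thesis unfolding crossing_at_def e replicate_add
    by (simp add: TArr_assoc)
qed

lemma crossing_at_tens_right:
  assumes "1 \<le> j" "j < M"
  shows "crossing_at (N + M) (N + j) = I (ones N) \<boxtimes> crossing_at M j"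
proof -
  have e: "N + j - 1 = N + (j - 1)" "N + M - (N + j) - 1 = M - j - 1" using assms by simp_all
  show ?thesis unfolding crossing_at_def e replicate_add
    by (simp add: I_tens_assoc)
qed

definition crossings :: "nat \<Rightarrow> nat list \<Rightarrow> 'a" where
  "crossings N u = foldr (\<lambda>i f. crossing_at N i \<cdot> f) u (I (ones N))"

lemma crossings_Nil [simp]: "crossings N [] = I (ones N)"
  by (simp add: crossings_def)

lemma crossings_Cons [simp]: "crossings N (i # u) = crossing_at N i \<cdot> crossings N u"
  by (simp add: crossings_def)

lemma crossings_arr [simp]:
  assumes "set u \<subseteq> {1..<N}"
  shows "crossings N u \<in> Arr C \<and> Dom C (crossings N u) = ones N \<and> Cod C (crossings N u) = ones N"
  using assms by (induction u) auto

lemma crossings_arrs: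
  assumes "set u \<subseteq> {1..<N}"
  shows "crossings N u \<in> Arr C" "Dom C (crossings N u) = ones N" "Cod C (crossings N u) = ones N"
  using crossings_arr[OF assms] by auto

lemma crossings_append:
  assumes "set u \<subseteq> {1..<N}" "set v \<subseteq> {1..<N}"
  shows "crossings N (u @ v) = crossings N u \<cdot> crossings N v"
  using assms(1)
proof (induction u)
  case Nil
  then show ?case by (simp add: idt_left crossings_arrs[OF assms(2)])
next
  case (Cons i u)
  then have i: "1 \<le> i" "i < N" and u: "set u \<subseteq> {1..<N}" by auto
  show ?case using Cons.IH[OF u] crossings_arrs[OF u] crossings_arrs[OF assms(2)] crossing_at_arr[OF i] by (simp add: comp_assoc')
qed

lemma crossings_tens_left:
  "set u \<subseteq> {1..<N} \<Longrightarrow> crossings (N + M) u = crossings N u \<boxtimes> I (ones M)"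
proof (induction u)
  case Nil
  show ?case by (simp add: replicate_add)
next
  case (Cons i u)
  then have i: "1 \<le> i" "i < N" and u: "set u \<subseteq> {1..<N}" by auto
  show ?case using Cons.IH[OF u] crossings_arrs[OF u] crossing_at_arr[OF i]
    by (simp add: crossing_at_tens_left[OF i] tens_comp idt_left)
qed

lemma crossings_tens_right:
  "set u \<subseteq> {1..<M} \<Longrightarrow> crossings (N + M) (map ((+) N) u) = I (ones N) \<boxtimes> crossings M u"
proof (induction u)
  case Nil
  show ?case by (simp add: replicate_add)
next
  case (Cons i u)
  then have i: "1 \<le> i" "i < M" and u: "set u \<subseteq> {1..<M}" by auto
  show ?case using Cons.IH[OF u] crossings_arrs[OF u] crossing_at_arr[OF i]
    by (simp add: crossing_at_tens_right[OF i] tens_comp idt_left)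
qed

lemma crossings_tens:
  assumes u: "set u \<subseteq> {1..<N}" and v: "set v \<subseteq> {1..<M}"
  shows "crossings (N + M) (u @ map ((+) N) v) = crossings N u \<boxtimes> crossings M v"
proof -
  have "crossings (N + M) (u @ map ((+) N) v) = crossings (N + M) u \<cdot> crossings (N + M) (map ((+) N) v)"
    using u v by (intro crossings_append) fastforce+
  then show ?thesis using crossings_arrs[OF u] crossings_arrs[OF v]
    by (simp add: crossings_tens_left[OF u] crossings_tens_right[OF v] tens_comp idt_left idt_right)
qed

lemma crossing_at_idem:
  assumes "1 \<le> i" "i < N"
  shows "crossing_at N i \<cdot> crossing_at N i = crossing_at N i"
  by (simp add: crossing_at_def tens_comp crossing_idem idt_left)

text \<open>The two crossings lie in different factors of a tensor product.\<close>

lemma crossing_at_far: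
  assumes "1 \<le> i" "Suc i < j" "j < N"
  shows "crossing_at N i \<cdot> crossing_at N j = crossing_at N j \<cdot> crossing_at N i"
proof -
  define M where "M = N - Suc i"
  define k where "k = j - Suc i"
  have k: "1 \<le> k" "k < M" and e: "N = Suc i + M" "j = Suc i + k"
    using assms by (auto simp: M_def k_def)
  have i: "1 \<le> i" "i < Suc i" using assms by auto
  show ?thesis unfolding e crossing_at_tens_left[OF i] crossing_at_tens_right[OF k]
    using crossing_at_arr[OF i] crossing_at_arr[OF k] by (simp add: tens_comp idt_left idt_right del: replicate.simps)
qed

text \<open>The square relations with \<open>N = 3\<close> contract the inner part of either side to a merge
  followed by a split, with labels \<open>(2, 1)\<close> on the left and \<open>(1, 2)\<close> on the right. Associativity
  and coassociativity then identify both sides with the merge of three strands followed by the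
  split into three strands.\<close>

lemma braid3: "crossing_at 3 1 \<cdot> crossing_at 3 2 \<cdot> crossing_at 3 1 = crossing_at 3 2 \<cdot> crossing_at 3 1 \<cdot> crossing_at 3 2"
proof -
  let ?x1 = "crossing \<boxtimes> I [1]" and ?x2 = "I [1] \<boxtimes> crossing"
  have s: "crossing_at 3 1 = ?x1" "crossing_at 3 2 = ?x2" by (simp_all add: crossing_at_def)
  have x1: "?x1 = (sp 1 1 \<boxtimes> I [1]) \<cdot> (mg 1 1 \<boxtimes> I [1])" by (simp add: crossing_def tens_comp idt_left)
  have x2: "?x2 = (I [1] \<boxtimes> sp 1 1) \<cdot> (I [1] \<boxtimes> mg 1 1)" by (simp add: crossing_def tens_comp idt_left)
  have "?x1 \<cdot> ?x2 \<cdot> ?x1 = (sp 1 1 \<boxtimes> I [1]) \<cdot> (((mg 1 1 \<boxtimes> I [1]) \<cdot> (I [1] \<boxtimes> sp 1 1) \<cdot>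
      (I [1] \<boxtimes> mg 1 1) \<cdot> (sp 1 1 \<boxtimes> I [1])) \<cdot> (mg 1 1 \<boxtimes> I [1]))"
    unfolding x1 x2 by (simp add: comp_assoc')
  also have "\<dots> = (sp 1 1 \<boxtimes> I [1]) \<cdot> ((sp (1 + 1) 1 \<cdot> mg (1 + 1) 1) \<cdot> (mg 1 1 \<boxtimes> I [1]))"
    using square_gt[of 1 1 1] by simp
  also have "\<dots> = ((sp 1 1 \<boxtimes> I [1]) \<cdot> sp (1 + 1) 1) \<cdot> (mg (1 + 1) 1 \<cdot> (mg 1 1 \<boxtimes> I [1]))"
    by (simp add: comp_assoc')
  also have "\<dots> = ((I [1] \<boxtimes> sp 1 1) \<cdot> sp 1 (1 + 1)) \<cdot> (mg 1 (1 + 1) \<cdot> (I [1] \<boxtimes> mg 1 1))"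
    using sp_coassoc[of 1 1 1] mg_assoc[of 1 1 1] by simp
  also have "\<dots> = (I [1] \<boxtimes> sp 1 1) \<cdot> ((sp 1 (1 + 1) \<cdot> mg 1 (1 + 1)) \<cdot> (I [1] \<boxtimes> mg 1 1))"
    by (simp add: comp_assoc')
  also have "\<dots> = (I [1] \<boxtimes> sp 1 1) \<cdot> (((I [1] \<boxtimes> mg 1 1) \<cdot> (sp 1 1 \<boxtimes> I [1]) \<cdot>
      (mg 1 1 \<boxtimes> I [1]) \<cdot> (I [1] \<boxtimes> sp 1 1)) \<cdot> (I [1] \<boxtimes> mg 1 1))"
    using square_lt[of 1 1 1] by simp
  also have "\<dots> = ?x2 \<cdot> ?x1 \<cdot> ?x2"
    unfolding x1 x2 by (simp add: comp_assoc')
  finally show ?thesis unfolding s .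
qed

lemma crossing_at_braid:
  assumes "1 \<le> i" "Suc i < N"
  shows "crossing_at N i \<cdot> crossing_at N (Suc i) \<cdot> crossing_at N i = crossing_at N (Suc i) \<cdot> crossing_at N i \<cdot> crossing_at N (Suc i)"
proof -
  define k where "k = i - 1"
  define M where "M = N - i - 2"
  have i: "i = k + 1" "Suc i = k + 2" and N: "N = k + (3 + M)" using assms by (auto simp: k_def M_def)
  have 1: "crossing_at N i = I (ones k) \<boxtimes> (crossing_at 3 1 \<boxtimes> I (ones M))"
    unfolding N i(1) using crossing_at_tens_right[of 1 "3 + M" k] crossing_at_tens_left[of 1 3 M] by simp
  have 2: "crossing_at N (Suc i) = I (ones k) \<boxtimes> (crossing_at 3 2 \<boxtimes> I (ones M))"
    unfolding N i(2) using crossing_at_tens_right[of 2 "3 + M" k] crossing_at_tens_left[of 2 3 M] by simp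
  have a: "crossing_at 3 1 \<in> Arr C" "Dom C (crossing_at 3 1) = ones 3" "Cod C (crossing_at 3 1) = ones 3"
    "crossing_at 3 2 \<in> Arr C" "Dom C (crossing_at 3 2) = ones 3" "Cod C (crossing_at 3 2) = ones 3"
    using crossing_at_arr[of 1 3] crossing_at_arr[of 2 3] by auto
  show ?thesis
    unfolding 1 2 using a braid3 by (simp add: tens_comp idt_left)
qed

lemma crossings_hecke:
  "u \<approx> v \<Longrightarrow> set u \<subseteq> {1..<N} \<Longrightarrow> crossings N u = crossings N v"
proof (induction rule: hecke.induct)
  case (hecke_sym u v)
  then show ?case using hecke_set by metis
next
  case (hecke_trans u v w)
  then show ?case using hecke_set by metis
next
  case (hecke_ctx u v p q)
  then have s: "set p \<subseteq> {1..<N}" "set u \<subseteq> {1..<N}" "set v \<subseteq> {1..<N}" "set q \<subseteq> {1..<N}"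
    using hecke_set[of u v] by auto
  have "set (u @ q) \<subseteq> {1..<N}" "set (v @ q) \<subseteq> {1..<N}" using s by auto
  then show ?case using s hecke_ctx.IH by (simp add: crossings_append)
next
  case (hecke_idem i)
  then show ?case using crossing_at_idem[of i N] by (simp add: idt_right)
next
  case (hecke_far i j)
  then show ?case using crossing_at_far[of i j N] by (simp add: idt_right)
next
  case (hecke_braid i)
  then show ?case using crossing_at_braid[of i N] by (simp add: idt_right)
qed simp

section \<open>Full merges and splits\<close>

fun full_merge :: "nat \<Rightarrow> 'a" where
  "full_merge 0 = I []"
| "full_merge (Suc 0) = I [1]"
| "full_merge (Suc (Suc k)) = mg 1 (Suc k) \<cdot> (I [1] \<boxtimes> full_merge (Suc k))"

fun full_split :: "nat \<Rightarrow> 'a" where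
  "full_split 0 = I []"
| "full_split (Suc 0) = I [1]"
| "full_split (Suc (Suc k)) = (I [1] \<boxtimes> full_split (Suc k)) \<cdot> sp 1 (Suc k)"

lemma full_merge_arr: "1 \<le> k \<Longrightarrow> full_merge k \<in> Arr C \<and> Dom C (full_merge k) = ones k \<and> Cod C (full_merge k) = [k]"
  by (induction k rule: full_merge.induct) auto

lemma full_split_arr: "1 \<le> k \<Longrightarrow> full_split k \<in> Arr C \<and> Dom C (full_split k) = [k] \<and> Cod C (full_split k) = ones k"
  by (induction k rule: full_split.induct) auto

lemma MS_arrs [simp]:
  assumes "1 \<le> k"
  shows "full_merge k \<in> Arr C" "Dom C (full_merge k) = ones k" "Cod C (full_merge k) = [k]"
    "full_split k \<in> Arr C" "Dom C (full_split k) = [k]" "Cod C (full_split k) = ones k"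
  using full_merge_arr[OF assms] full_split_arr[OF assms] by auto

lemma full_merge_Suc: "1 \<le> k \<Longrightarrow> full_merge (Suc k) = mg 1 k \<cdot> (I [1] \<boxtimes> full_merge k)"
  by (cases k) auto

lemma full_split_Suc: "1 \<le> k \<Longrightarrow> full_split (Suc k) = (I [1] \<boxtimes> full_split k) \<cdot> sp 1 k"
  by (cases k) auto

lemma full_merge_full_split: "1 \<le> k \<Longrightarrow> full_merge k \<cdot> full_split k = I [k]"
proof (induction k rule: nat_induct_at_least)
  case base
  then show ?case by (simp add: idt_left)
next
  case (Suc k)
  have "full_merge (Suc k) \<cdot> full_split (Suc k) = mg 1 k \<cdot> ((I [1] \<boxtimes> (full_merge k \<cdot> full_split k)) \<cdot> sp 1 k)"
    using Suc.hyps by (simp add: full_merge_Suc full_split_Suc comp_assoc' tens_comp_append_assoc idt_left)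
  also have "\<dots> = I [Suc k]" using Suc mg_sp[of 1 k] by (simp add: idt_left)
  finally show ?case .
qed

lemma w0_Suc: "1 \<le> k \<Longrightarrow> w0 (Suc k) = map ((+) 1) (w0 k) @ [1] @ map ((+) 1) (w0 k)"
  by (cases k) (simp_all add: plus_1_eq_Suc)

text \<open>Let \<open>e\<^sub>k\<close> be the full merge of \<open>k\<close> strands followed by the full split, and \<open>x\<close> the
  crossing. The square with \<open>a = b = 1\<close> turns the merge and the split of labels \<open>(1, k)\<close> in the
  middle of \<open>e\<^sub>k\<^sub>+\<^sub>1\<close> into a diagram around one crossing of the first two strands. This gives
  \<open>e\<^sub>k\<^sub>+\<^sub>1 = (1 \<otimes> e\<^sub>k) (x \<otimes> e\<^sub>k\<^sub>-\<^sub>1) (1 \<otimes> e\<^sub>k)\<close>, and \<open>e\<^sub>k\<close> absorbs \<open>1 \<otimes> e\<^sub>k\<^sub>-\<^sub>1\<close>.\<close>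

lemma full_split_full_merge: "1 \<le> k \<Longrightarrow> full_split k \<cdot> full_merge k = crossings k (w0 k)"
proof (induction k rule: nat_induct_at_least)
  case base
  then show ?case by (simp add: idt_left)
next
  case (Suc k)
  let ?V = "map ((+) 1) (w0 k)"
  have V: "set ?V \<subseteq> {1..<Suc k}" using set_w0[of k] by auto
  have IV: "crossings (Suc k) ?V = I [1] \<boxtimes> (full_split k \<cdot> full_merge k)"
    using crossings_tens_right[of "w0 k" k 1] set_w0[of k] Suc.IH by simp
  have w: "crossings (Suc k) (w0 (Suc k)) = crossings (Suc k) ?V \<cdot> crossing_at (Suc k) 1 \<cdot> crossings (Suc k) ?V"
    using Suc.hyps V crossings_append[of "?V" "Suc k" "1 # ?V"] by (simp add: w0_Suc)
  show ?case
  proof (cases "k = 1")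
    case True
    then show ?thesis unfolding w IV
      by (simp add: crossing_at_def idt_left idt_right crossing_def)
  next
    case False
    then obtain l where l: "k = Suc l" "1 \<le> l" using Suc.hyps by (cases k) auto
    let ?S = "full_split k" and ?M = "full_merge k" and ?x = "crossing"
    let ?e = "?S \<cdot> ?M"
    have sq: "sp 1 k \<cdot> mg 1 k = (I [1] \<boxtimes> mg 1 l) \<cdot> (?x \<boxtimes> I [l]) \<cdot> (I [1] \<boxtimes> sp 1 l)"
      using square_lt[of 1 1 l] l by (simp add: crossing_def tens_comp_append_assoc idt_left)
    \<comment> \<open>a partial merge is turned into a full one by splitting the remaining strands first\<close>
    have Sm: "?S \<cdot> mg 1 l = ?e \<cdot> (I [1] \<boxtimes> full_split l)"
    proof -
      have "?e \<cdot> (I [1] \<boxtimes> full_split l) = ?S \<cdot> (mg 1 l \<cdot> (I [1] \<boxtimes> (full_merge l \<cdot> full_split l)))"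
        using l by (simp add: full_merge_Suc comp_assoc' tens_comp idt_left)
      then show ?thesis using l by (simp add: full_merge_full_split idt_right)
    qed
    have sM: "sp 1 l \<cdot> ?M = (I [1] \<boxtimes> full_merge l) \<cdot> ?e"
    proof -
      have "(I [1] \<boxtimes> full_merge l) \<cdot> ?e = (I [1] \<boxtimes> (full_merge l \<cdot> full_split l)) \<cdot> (sp 1 l \<cdot> ?M)"
        using l by (simp add: full_split_Suc comp_assoc' tens_comp_append_assoc idt_left)
      then show ?thesis using l by (simp add: full_merge_full_split idt_left)
    qed
    have e: "?e \<in> Arr C" "Dom C ?e = ones k" "Cod C ?e = ones k" using Suc.hyps by simp_all
    have xe: "?x \<boxtimes> (full_split l \<cdot> full_merge l) = (?x \<boxtimes> I (ones l)) \<cdot> (I [1] \<boxtimes> (I [1] \<boxtimes> (full_split l \<cdot> full_merge l)))"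
      using l by (simp add: I_tens_assoc tens_comp idt_left idt_right)
    \<comment> \<open>the full split contains the full split of all strands but the first\<close>
    have ee: "(I [1] \<boxtimes> (full_split l \<cdot> full_merge l)) \<cdot> ?e = ?e"
    proof -
      have "(I [1] \<boxtimes> (full_split l \<cdot> full_merge l)) \<cdot> ?e = (I [1] \<boxtimes> (full_split l \<cdot> (full_merge l \<cdot> full_split l))) \<cdot> (sp 1 l \<cdot> ?M)"
        using l by (simp add: full_split_Suc comp_assoc' tens_comp_append_assoc idt_left)
      then show ?thesis using l by (simp add: full_merge_full_split idt_right full_split_Suc comp_assoc')
    qed
    have "full_split (Suc k) \<cdot> full_merge (Suc k) = (I [1] \<boxtimes> ?S) \<cdot> (sp 1 k \<cdot> mg 1 k) \<cdot> (I [1] \<boxtimes> ?M)"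
      using Suc.hyps by (simp add: full_split_Suc full_merge_Suc comp_assoc')
    also have "\<dots> = (I [1] \<boxtimes> (?S \<cdot> mg 1 l)) \<cdot> (?x \<boxtimes> I [l]) \<cdot> (I [1] \<boxtimes> (sp 1 l \<cdot> ?M))"
      unfolding sq using l by (simp add: comp_assoc' tens_comp_append_assoc tens_comp idt_left)
    also have "\<dots> = (I [1] \<boxtimes> ?e) \<cdot> (I [1] \<boxtimes> (I [1] \<boxtimes> full_split l)) \<cdot> (?x \<boxtimes> I [l]) \<cdot> (I [1] \<boxtimes> (I [1] \<boxtimes> full_merge l)) \<cdot> (I [1] \<boxtimes> ?e)"
      unfolding Sm sM using e l by (simp add: comp_assoc' tens_comp_append_assoc tens_comp idt_left)
    also have "\<dots> = (I [1] \<boxtimes> ?e) \<cdot> (?x \<boxtimes> (full_split l \<cdot> full_merge l)) \<cdot> (I [1] \<boxtimes> ?e)"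
      using e l by (simp add: I_tens_assoc comp_assoc' tens_comp_append_assoc tens_comp idt_left idt_right)
    also have "\<dots> = (I [1] \<boxtimes> ?e) \<cdot> (?x \<boxtimes> I (ones l)) \<cdot> (I [1] \<boxtimes> ((I [1] \<boxtimes> (full_split l \<cdot> full_merge l)) \<cdot> ?e))"
      unfolding xe using e l by (simp add: comp_assoc' tens_comp idt_left)
    also have "\<dots> = crossings (Suc k) ?V \<cdot> crossing_at (Suc k) 1 \<cdot> crossings (Suc k) ?V"
      unfolding ee IV using l by (simp add: crossing_at_def)
    finally show ?thesis unfolding w .
  qed
qed

text \<open>By associativity the full merge may be carried out on two groups of strands first.\<close>

lemma full_merge_add: "1 \<le> a \<Longrightarrow> 1 \<le> b \<Longrightarrow> full_merge (a + b) = mg a b \<cdot> (full_merge a \<boxtimes> full_merge b)"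
proof (induction a rule: nat_induct_at_least)
  case base
  then show ?case by (simp add: full_merge_Suc)
next
  case (Suc a)
  have "full_merge (Suc a + b) = mg 1 (a + b) \<cdot> (I [1] \<boxtimes> (mg a b \<cdot> (full_merge a \<boxtimes> full_merge b)))"
    using Suc by (simp add: full_merge_Suc)
  also have "\<dots> = (mg 1 (a + b) \<cdot> (I [1] \<boxtimes> mg a b)) \<cdot> (I [1] \<boxtimes> (full_merge a \<boxtimes> full_merge b))"
    using Suc by (simp add: comp_assoc' tens_comp idt_left)
  also have "\<dots> = (mg (1 + a) b \<cdot> (mg 1 a \<boxtimes> I [b])) \<cdot> (I [1] \<boxtimes> (full_merge a \<boxtimes> full_merge b))"
    using Suc mg_assoc[of 1 a b] by simp
  also have "\<dots> = mg (Suc a) b \<cdot> ((mg 1 a \<boxtimes> I [b]) \<cdot> ((I [1] \<boxtimes> full_merge a) \<boxtimes> full_merge b))"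
    using Suc by (simp add: comp_assoc' TArr_assoc)
  also have "\<dots> = mg (Suc a) b \<cdot> (full_merge (Suc a) \<boxtimes> full_merge b)"
    using Suc by (simp add: tens_comp idt_left full_merge_Suc)
  finally show ?case .
qed

lemma full_split_add: "1 \<le> a \<Longrightarrow> 1 \<le> b \<Longrightarrow> full_split (a + b) = (full_split a \<boxtimes> full_split b) \<cdot> sp a b"
proof (induction a rule: nat_induct_at_least)
  case base
  then show ?case by (simp add: full_split_Suc)
next
  case (Suc a)
  have "full_split (Suc a + b) = (I [1] \<boxtimes> ((full_split a \<boxtimes> full_split b) \<cdot> sp a b)) \<cdot> sp 1 (a + b)"
    using Suc by (simp add: full_split_Suc)
  also have "\<dots> = (I [1] \<boxtimes> (full_split a \<boxtimes> full_split b)) \<cdot> ((I [1] \<boxtimes> sp a b) \<cdot> sp 1 (a + b))"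
    using Suc by (simp add: tens_comp_append_assoc idt_left)
  also have "\<dots> = (I [1] \<boxtimes> (full_split a \<boxtimes> full_split b)) \<cdot> ((sp 1 a \<boxtimes> I [b]) \<cdot> sp (1 + a) b)"
    using Suc sp_coassoc[of 1 a b] by simp
  also have "\<dots> = ((I [1] \<boxtimes> full_split a) \<boxtimes> full_split b) \<cdot> ((sp 1 a \<boxtimes> I [b]) \<cdot> sp (Suc a) b)"
    using Suc by (simp add: TArr_assoc)
  also have "\<dots> = (full_split (Suc a) \<boxtimes> full_split b) \<cdot> sp (Suc a) b"
    using Suc by (simp add: tens_comp_append_assoc idt_right full_split_Suc)
  finally show ?case .
qed

fun merges :: "nat list \<Rightarrow> 'a" where
  "merges [] = I []"
| "merges (a # n) = full_merge a \<boxtimes> merges n"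

fun splits :: "nat list \<Rightarrow> 'a" where
  "splits [] = I []"
| "splits (a # n) = full_split a \<boxtimes> splits n"

lemma merges_splits_arr: "0 \<notin> set n \<Longrightarrow> merges n \<in> Arr C \<and> Dom C (merges n) = ones (sum_list n) \<and> Cod C (merges n) = n \<and>
    splits n \<in> Arr C \<and> Dom C (splits n) = n \<and> Cod C (splits n) = ones (sum_list n)"
  by (induction n) (simp_all add: replicate_add Suc_le_eq)

lemma merges_splits_arrs [simp]:
  assumes "0 \<notin> set n"
  shows "merges n \<in> Arr C" "Dom C (merges n) = ones (sum_list n)" "Cod C (merges n) = n"
    "splits n \<in> Arr C" "Dom C (splits n) = n" "Cod C (splits n) = ones (sum_list n)"
  using merges_splits_arr[OF assms] by auto

lemma merges_splits: "0 \<notin> set n \<Longrightarrow> merges n \<cdot> splits n = I n"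
  by (induction n) (simp_all add: idt_left tens_comp full_merge_full_split Suc_le_eq)

lemma splits_merges: "0 \<notin> set n \<Longrightarrow> splits n \<cdot> merges n = crossings (sum_list n) (young_word n)"
proof (induction n)
  case Nil
  then show ?case by (simp add: idt_left)
next
  case (Cons a n)
  then show ?case using crossings_tens[OF set_w0[of a] set_young_word_subset[of n]]
    by (simp add: tens_comp full_split_full_merge Suc_le_eq)
qed

lemma merges_append: "0 \<notin> set n \<Longrightarrow> 0 \<notin> set m \<Longrightarrow> merges (n @ m) = merges n \<boxtimes> merges m"
  by (induction n) (simp_all add: TArr_assoc Suc_le_eq)

lemma splits_append: "0 \<notin> set n \<Longrightarrow> 0 \<notin> set m \<Longrightarrow> splits (n @ m) = splits n \<boxtimes> splits m"
  by (induction n) (simp_all add: TArr_assoc Suc_le_eq)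

end

section \<open>The word of a web\<close>

fun web_strands :: "web \<Rightarrow> nat" where
  "web_strands (WId n) = sum_list n"
| "web_strands (Merge a b) = a + b"
| "web_strands (Split a b) = a + b"
| "web_strands (WComp t u) = web_strands u"
| "web_strands (WTens t u) = web_strands t + web_strands u"

text \<open>The identity of \<open>n\<close> is read as \<open>w\<^sub>n\<close> and not as the empty word, because \<open>w\<^sub>n\<close> is the
  maximal element of the identity double coset.\<close>

fun web_word :: "web \<Rightarrow> nat list" where
  "web_word (WId n) = young_word n"
| "web_word (Merge a b) = w0 (a + b)"
| "web_word (Split a b) = w0 (a + b)"
| "web_word (WComp t u) = web_word t @ web_word u"
| "web_word (WTens t u) = web_word t @ map ((+) (web_strands t)) (web_word u)"

lemma web_strands_web_hom: "web_hom n m t \<Longrightarrow> web_strands t = sum_list n"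
  by (induction rule: web_hom.induct) auto

lemma set_web_word: "web_hom n m t \<Longrightarrow> set (web_word t) \<subseteq> {1..<sum_list n}"
proof (induction rule: web_hom.induct)
  case (hom_id n)
  then show ?case using set_young_word_subset by simp
next
  case (hom_merge a b)
  then show ?case using set_w0[of "a + b"] by simp
next
  case (hom_split a b)
  then show ?case using set_w0[of "a + b"] by simp
next
  case (hom_comp m k t n u)
  then show ?case using web_hom_sum[of n m u] by simp
next
  case (hom_tens n m t n' m' t')
  then show ?case using web_strands_web_hom[of n m t] by fastforce
qed

fun web_value :: "(nat list, 'a) moncat \<Rightarrow> (nat \<Rightarrow> nat \<Rightarrow> 'a) \<Rightarrow> (nat \<Rightarrow> nat \<Rightarrow> 'a) \<Rightarrow> web \<Rightarrow> 'a" where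
  "web_value C mg sp (WId n) = Idt C n"
| "web_value C mg sp (Merge a b) = mg a b"
| "web_value C mg sp (Split a b) = sp a b"
| "web_value C mg sp (WComp t u) = web_value C mg sp t \<cdot>\<^bsub>C\<^esub> web_value C mg sp u"
| "web_value C mg sp (WTens t u) = web_value C mg sp t \<boxtimes>\<^bsub>C\<^esub> web_value C mg sp u"

context web_model
begin

abbreviation interp :: "web \<Rightarrow> 'a" where
  "interp \<equiv> web_value C mg sp"

lemma interp_arr: "web_hom n m t \<Longrightarrow> interp t \<in> Arr C \<and> Dom C (interp t) = n \<and> Cod C (interp t) = m"
  by (induction rule: web_hom.induct) auto

text \<open>At the intermediate object of a composite the full split followed by the full merge, an
  identity, is inserted. So only generators need a calculation, and there the two sides combine
  to full merges and splits.\<close>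

theorem sandwich:
  "web_hom n m t \<Longrightarrow> splits m \<cdot> interp t \<cdot> merges n = crossings (sum_list n) (web_word t)"
proof (induction rule: web_hom.induct)
  case (hom_id n)
  then show ?case by (simp add: idt_left splits_merges)
next
  case (hom_merge a b)
  then have "mg a b \<cdot> (full_merge a \<boxtimes> full_merge b) = full_merge (a + b)" using full_merge_add by simp
  then show ?case using hom_merge full_split_full_merge[of "a + b"] by simp
next
  case (hom_split a b)
  then have "(full_split a \<boxtimes> full_split b) \<cdot> (sp a b \<cdot> full_merge (a + b)) = full_split (a + b) \<cdot> full_merge (a + b)"
    using full_split_add by (simp add: comp_assoc')
  then show ?case using hom_split full_split_full_merge[of "a + b"] by simp
next
  case (hom_comp m k t n u)
  note nz = web_hom_nonzero[OF hom_comp(1)] web_hom_nonzero[OF hom_comp(2)]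
  note ar = interp_arr[OF hom_comp(1)] interp_arr[OF hom_comp(2)]
  have s: "sum_list m = sum_list n" using web_hom_sum[OF hom_comp(2)] by simp
  have "splits k \<cdot> (interp t \<cdot> interp u) \<cdot> merges n = splits k \<cdot> interp t \<cdot> ((merges m \<cdot> splits m) \<cdot> (interp u \<cdot> merges n))"
    using nz ar by (simp add: comp_assoc' merges_splits idt_left)
  also have "\<dots> = (splits k \<cdot> interp t \<cdot> merges m) \<cdot> (splits m \<cdot> interp u \<cdot> merges n)"
    using nz ar s by (simp add: comp_assoc')
  also have "\<dots> = crossings (sum_list n) (web_word t @ web_word u)"
    using hom_comp.IH s crossings_append[of "web_word t" "sum_list n" "web_word u"] set_web_word[OF hom_comp(1)] set_web_word[OF hom_comp(2)]
    by simp
  finally show ?case by simp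
next
  case (hom_tens n m t n' m' t')
  note nz = web_hom_nonzero[OF hom_tens(1)] web_hom_nonzero[OF hom_tens(2)]
  note ar = interp_arr[OF hom_tens(1)] interp_arr[OF hom_tens(2)]
  have "splits (m @ m') \<cdot> (interp t \<boxtimes> interp t') \<cdot> merges (n @ n')
      = (splits m \<cdot> interp t \<cdot> merges n) \<boxtimes> (splits m' \<cdot> interp t' \<cdot> merges n')"
    using nz ar by (simp add: merges_append splits_append tens_comp)
  also have "\<dots> = crossings (sum_list (n @ n')) (web_word t @ map ((+) (sum_list n)) (web_word t'))"
    using hom_tens.IH crossings_tens[OF set_web_word[OF hom_tens(1)] set_web_word[OF hom_tens(2)]] by simp
  finally show ?case using web_strands_web_hom[OF hom_tens(1)] by simp
qed

text \<open>Nothing is lost in the sandwich, because the full split followed by the full merge is the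
  identity.\<close>

lemma recover:
  assumes "web_hom n m t"
  shows "merges m \<cdot> (splits m \<cdot> interp t \<cdot> merges n) \<cdot> splits n = interp t"
proof -
  note nz = web_hom_nonzero[OF assms] and ar = interp_arr[OF assms]
  have "merges m \<cdot> (splits m \<cdot> interp t \<cdot> merges n) \<cdot> splits n = (merges m \<cdot> splits m) \<cdot> interp t \<cdot> (merges n \<cdot> splits n)"
    using nz ar by (simp add: comp_assoc')
  then show ?thesis using nz ar by (simp add: merges_splits idt_left idt_right)
qed

end

section \<open>Web relations between words\<close>

text \<open>The word of a web absorbs the longest elements of its source and target; hence the
  identity laws hold for words although identities are not read as empty words.\<close>

lemma web_word_absorb:
  "web_hom n m t \<Longrightarrow> (\<forall>i\<in>letters n. web_word t @ [i] \<approx> web_word t) \<and> (\<forall>i\<in>letters m. i # web_word t \<approx> web_word t)"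
proof (induction rule: web_hom.induct)
  case (hom_id n)
  then show ?case using young_word_absorb young_word_absorb_left by simp
next
  case (hom_merge a b)
  have "1 \<le> i \<and> i < a + b" if "i \<in> letters [a, b] \<union> letters [a + b]" for i
    using that by (auto simp: letters_def)
  then show ?case using w0_absorb w0_absorb_left by simp
next
  case (hom_split a b)
  have "1 \<le> i \<and> i < a + b" if "i \<in> letters [a, b] \<union> letters [a + b]" for i
    using that by (auto simp: letters_def)
  then show ?case using w0_absorb w0_absorb_left by simp
next
  case (hom_comp m k t n u)
  show ?case
  proof (intro conjI ballI)
    fix i assume "i \<in> letters n"
    then have "web_word t @ (web_word u @ [i]) \<approx> web_word t @ web_word u" using hom_comp.IH by (intro hecke_append hecke_refl) blast
    then show "web_word (WComp t u) @ [i] \<approx> web_word (WComp t u)" by simp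
  next
    fix i assume "i \<in> letters k"
    then have "(i # web_word t) @ web_word u \<approx> web_word t @ web_word u" using hom_comp.IH by (intro hecke_append hecke_refl) blast
    then show "i # web_word (WComp t u) \<approx> web_word (WComp t u)" by simp
  qed
next
  case (hom_tens n m t n' m' t')
  let ?N = "sum_list n"
  let ?U = "web_word t" and ?V = "map ((+) ?N) (web_word t')"
  have N: "web_strands t = ?N" "sum_list m = ?N" using web_strands_web_hom web_hom_sum hom_tens by simp_all
  have U: "set ?U \<subseteq> {1..<?N}" and V: "set ?V \<subseteq> {Suc ?N..}"
    using set_web_word[OF hom_tens(1)] set_web_word[OF hom_tens(2)] by fastforce+
  have shR: "?V @ [?N + j] \<approx> ?V" if "j \<in> letters n'" for j
    using hecke_shift[of "web_word t' @ [j]" "web_word t'" ?N] hom_tens.IH that by simp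
  have shL: "(?N + j) # ?V \<approx> ?V" if "j \<in> letters m'" for j
    using hecke_shift[of "j # web_word t'" "web_word t'" ?N] hom_tens.IH that by simp
  show ?case
    unfolding web_word.simps N letters_append
  proof (intro conjI ballI)
    fix i assume "i \<in> letters n \<union> (+) ?N ` letters n'"
    then consider "i \<in> letters n" | j where "i = ?N + j" "j \<in> letters n'" by auto
    then show "(?U @ ?V) @ [i] \<approx> ?U @ ?V"
    proof cases
      case 1
      then have "i < ?N" using letters_subset[of n] by auto
      then have "?U @ (?V @ [i]) \<approx> ?U @ (i # ?V)"
        using V by (intro hecke_append hecke_refl hecke_sym[OF hecke_far_letter]) auto
      also have "\<dots> = (?U @ [i]) @ ?V" by simp
      also have "\<dots> \<approx> ?U @ ?V" using 1 hom_tens.IH by (intro hecke_append hecke_refl) blast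
      finally show ?thesis by simp
    next
      case 2
      have "?U @ (?V @ [i]) \<approx> ?U @ ?V" using shR[OF 2(2)] 2(1) by (intro hecke_append hecke_refl) simp
      then show ?thesis by simp
    qed
  next
    fix i assume "i \<in> letters m \<union> (+) ?N ` letters m'"
    then consider "i \<in> letters m" | j where "i = ?N + j" "j \<in> letters m'" by auto
    then show "i # ?U @ ?V \<approx> ?U @ ?V"
    proof cases
      case 1
      then have "(i # ?U) @ ?V \<approx> ?U @ ?V" using hom_tens.IH by (intro hecke_append hecke_refl) blast
      then show ?thesis by simp
    next
      case 2
      have "1 \<le> j" using 2(2) letters_subset[of m'] by auto
      then have "?U @ [i] \<approx> [i] @ ?U" using U 2(1) by (intro hecke_far_words) auto
      then have "([i] @ ?U) @ ?V \<approx> (?U @ [i]) @ ?V" by (intro hecke_append[OF hecke_sym hecke_refl])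
      also have "\<dots> = ?U @ (i # ?V)" by simp
      also have "\<dots> \<approx> ?U @ ?V" using shL[OF 2(2)] 2(1) by (intro hecke_append hecke_refl) simp
      finally show ?thesis by simp
    qed
  qed
qed

lemma web_word_absorb_right: "web_hom n m t \<Longrightarrow> web_word t @ young_word n \<approx> web_word t"
  using web_word_absorb[of n m t] set_young_word[of n] by (intro hecke_absorb_word) auto

lemma web_word_absorb_left: "web_hom n m t \<Longrightarrow> young_word m @ web_word t \<approx> web_word t"
  using web_word_absorb[of n m t] set_young_word[of m] by (intro hecke_absorb_word_left) auto

lemma w0_absorb_word: "set u \<subseteq> {1..<k} \<Longrightarrow> w0 k @ u \<approx> w0 k"
  by (rule hecke_absorb_word, rule ballI, rule w0_absorb) auto

lemma w0_absorb_word_left: "set u \<subseteq> {1..<k} \<Longrightarrow> u @ w0 k \<approx> w0 k"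
  by (rule hecke_absorb_word_left, rule ballI, rule w0_absorb_left) auto

lemma set_w0_pair: "set (w0 a @ map ((+) a) (w0 b)) \<subseteq> {1..<a + b}"
  using set_young_word_subset[of "[a, b]"] by simp

lemma young_word_idem: "young_word n @ young_word n \<approx> young_word n"
  by (rule hecke_absorb_word) (use set_young_word[of n] young_word_absorb in blast)

lemma map_add_0: "map ((+) (0 :: nat)) u = u"
  by (rule map_idI) simp

text \<open>For associativity and coassociativity both sides contain the longest element on all
  strands, which absorbs the rest. The squares were dealt with above, except that the longest
  element in their middle occurs twice, once for the merge and once for the split. The remaining
  cases are structural.\<close>

theorem web_word_sound: "web_eq n m t u \<Longrightarrow> web_word t \<approx> web_word u"
proof (induction rule: web_eq.induct)
  case (eq_refl n m t)
  show ?case by (rule hecke_refl)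
next
  case (eq_sym n m t u)
  then show ?case by (blast intro: hecke_sym)
next
  case (eq_trans n m t u v)
  then show ?case by (blast intro: hecke_trans)
next
  case (cong_comp m k t t' n u u')
  then show ?case by (simp add: hecke_append)
next
  case (cong_tens n m t t' n' m' u u')
  have "web_strands t = web_strands t'" using web_eq_hom[OF cong_tens(1)] web_strands_web_hom by metis
  then show ?case using cong_tens by (simp add: hecke_append hecke_shift)
next
  case (id_right n m t)
  then show ?case by (simp add: web_word_absorb_right)
next
  case (id_left n m t)
  then show ?case by (simp add: web_word_absorb_left)
next
  case (tens_assoc n m t n' m' u n'' m'' v)
  have "map ((+) (web_strands t + web_strands u)) (web_word v) = map ((+) (web_strands t)) (map ((+) (web_strands u)) (web_word v))"
    by (simp add: add.assoc)
  then show ?case by (simp add: hecke_refl del: map_map)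
next
  case (tens_id n n')
  then show ?case by (simp add: hecke_refl young_word_append)
next
  case (interchange m k t n u m' k' t' n' u')
  have N: "web_strands t = sum_list n" "web_strands u = sum_list n"
    using web_strands_web_hom interchange web_hom_sum[of n m u] by simp_all
  let ?s = "map ((+) (sum_list n))"
  have "web_word u @ ?s (web_word t') \<approx> ?s (web_word t') @ web_word u"
    using set_web_word[OF interchange(2)] set_web_word[OF interchange(3)] by (intro hecke_far_words) fastforce
  then have "web_word t @ (web_word u @ ?s (web_word t')) @ ?s (web_word u') \<approx> web_word t @ (?s (web_word t') @ web_word u) @ ?s (web_word u')"
    by (rule hecke_append[OF hecke_refl hecke_append[OF _ hecke_refl]])
  then show ?case by (simp add: N)
next
  case (bigon a b)
  have "w0 (a + b) @ w0 (a + b) \<approx> w0 (a + b)" using set_w0 by (rule w0_absorb_word)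
  then show ?case by simp
next
  case (assoc a b c)
  have 1: "w0 (a + b + c) @ u \<approx> w0 (a + b + c)" if "set u \<subseteq> {1..<a + b + c}" for u
    using that by (rule w0_absorb_word)
  have "web_word (WComp (Merge (a + b) c) (WTens (Merge a b) (WId [c]))) \<approx> w0 (a + b + c)"
    using 1[OF set_w0_pair[of "a + b" c]] by simp
  moreover have "web_word (WComp (Merge a (b + c)) (WTens (WId [a]) (Merge b c))) \<approx> w0 (a + b + c)"
    using 1[OF set_w0_pair[of a "b + c", unfolded add.assoc[symmetric]]] by (simp add: add.assoc)
  ultimately show ?case by (blast intro: hecke_sym hecke_trans)
next
  case (coassoc a b c)
  have 1: "u @ w0 (a + b + c) \<approx> w0 (a + b + c)" if "set u \<subseteq> {1..<a + b + c}" for u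
    using that by (rule w0_absorb_word_left)
  have "web_word (WComp (WTens (Split a b) (WId [c])) (Split (a + b) c)) \<approx> w0 (a + b + c)"
    using 1[OF set_w0_pair[of "a + b" c]] by simp
  moreover have "web_word (WComp (WTens (WId [a]) (Split b c)) (Split a (b + c))) \<approx> w0 (a + b + c)"
    using 1[OF set_w0_pair[of a "b + c", unfolded add.assoc[symmetric]]] by (simp add: add.assoc)
  ultimately show ?case by (blast intro: hecke_sym hecke_trans)
next
  case (square_less a N b)
  let ?A = "young_word [b, N - b]" and ?B = "young_word [a + b, N - (a + b)]" and ?C = "young_word [a, N - a]"
  have e: "a + (N - a - b) = N - b" "b + (N - a - b) = N - a" "N - a - b = N - (a + b)" "a + (N - a) = N" "b + (N - b) = N"
    "a + (N - (a + b)) = N - b" "b + (N - (a + b)) = N - a" "b + a = a + b"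
    using square_less by auto
  have "?A @ (?B @ ?B) @ ?C \<approx> ?A @ ?B @ ?C" by (intro hecke_append hecke_refl young_word_idem)
  also have "\<dots> \<approx> w0 N" using square_less by (intro square_less_word) auto
  also have "\<dots> \<approx> w0 N @ w0 N" using set_w0 by (rule hecke_sym[OF w0_absorb_word])
  finally show ?case by (simp add: e)
next
  case (square_greater a N b)
  define c where "c = a + b - N"
  let ?A = "young_word [b, N - b]" and ?B = "young_word [c, N - c]" and ?C = "young_word [a, N - a]"
  have e: "c + (N - a) = b" "c + (N - b) = a" "N - b + (N - a) = N - c" "N - a + (N - b) = N - c"
    "a + (N - a) = N" "b + (N - b) = N"
    using square_greater by (auto simp: c_def)
  have "?A @ (?B @ ?B) @ ?C \<approx> ?A @ ?B @ ?C" by (intro hecke_append hecke_refl young_word_idem)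
  also have "\<dots> \<approx> w0 N" unfolding c_def using square_greater by (intro square_greater_word) auto
  also have "\<dots> \<approx> w0 N @ w0 N" using set_w0 by (rule hecke_sym[OF w0_absorb_word])
  finally show ?case unfolding c_def[symmetric] by (simp add: e)
next
  case (unit_right n m t)
  show ?case by (simp add: hecke_refl)
next
  case (unit_left n m t)
  have "web_word (WTens (WId []) t) = web_word t" by (simp only: web_word.simps young_word.simps web_strands.simps sum_list.Nil map_add_0 append_Nil)
  then show ?case by (simp only: hecke_refl)
qed (simp_all add: hecke_refl)

section \<open>Faithfulness and fullness\<close>

text \<open>The rules for sequences without zeros, from which nothing is erased.\<close>

lemma web_arrow_in_Hom:
  assumes "web_hom n m t"
  shows "web_arrow n m t \<in> Hom Wb n m"
  using assms web_hom_nonzero[OF assms] by (simp add: web_arrow_Hom ez_id)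

lemma web_arrow_Comp':
  "web_hom m k t \<Longrightarrow> web_hom n m u \<Longrightarrow> web_arrow m k t \<cdot>\<^bsub>Wb\<^esub> web_arrow n m u = web_arrow n k (WComp t u)"
  using web_hom_nonzero by (simp add: web_arrow_Comp ez_id)

lemma web_arrow_TArr':
  "web_hom n m t \<Longrightarrow> web_hom n' m' u \<Longrightarrow> web_arrow n m t \<boxtimes>\<^bsub>Wb\<^esub> web_arrow n' m' u = web_arrow (n @ n') (m @ m') (WTens t u)"
  using web_hom_nonzero by (simp add: web_arrow_TArr ez_id)

lemma web_arrow_eqI': "web_eq n m t u \<Longrightarrow> web_arrow n m t = web_arrow n m u"
  using web_eq_hom[of n m t u] web_hom_nonzero[of n m t] by (intro web_arrow_eqI) (simp add: ez_id)

lemma web_arrow_Idt': "0 \<notin> set n \<Longrightarrow> Idt Wb n = web_arrow n n (WId n)"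
  by (simp add: SC_Webs_Idt ez_id)

abbreviation wmerge :: "nat \<Rightarrow> nat \<Rightarrow> web_arr" where
  "wmerge a b \<equiv> web_arrow [a, b] [a + b] (Merge a b)"

abbreviation wsplit :: "nat \<Rightarrow> nat \<Rightarrow> web_arr" where
  "wsplit a b \<equiv> web_arrow [a + b] [a, b] (Split a b)"

lemma web_value_eq_web_arrow: "web_hom n m t \<Longrightarrow> web_value Wb wmerge wsplit t = web_arrow n m t"
proof (induction rule: web_hom.induct)
  case (hom_id n)
  then show ?case by (simp add: web_arrow_Idt')
next
  case (hom_comp m k t n u)
  then show ?case by (simp add: web_arrow_Comp')
next
  case (hom_tens n m t n' m' t')
  then show ?case by (simp add: web_arrow_TArr')
qed simp_all

text \<open>This turns the defining relations of webs into the equations that a model has to satisfy.\<close>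

lemma web_value_cong:
  "web_eq n m t u \<Longrightarrow> web_value Wb wmerge wsplit t = web_value Wb wmerge wsplit u"
  using web_eq_hom[of n m t u] web_value_eq_web_arrow[of n m t] web_value_eq_web_arrow[of n m u] web_arrow_eqI'[of n m t u] by simp

interpretation webs: web_model Wb wmerge wsplit
proof (rule web_model.intro[OF strict_monoidal_SC_Webs], unfold_locales)
  show "Obj Wb = UNIV" "TObj Wb = (@)" "Unit Wb = []" by simp_all
  fix a b c :: nat
  assume a: "1 \<le> a" and b: "1 \<le> b"
  then show "wmerge a b \<in> Hom Wb [a, b] [a + b]" "wsplit a b \<in> Hom Wb [a + b] [a, b]"
    by (simp_all add: web_arrow_in_Hom hom_merge hom_split)
  show "wmerge a b \<cdot>\<^bsub>Wb\<^esub> wsplit a b = Idt Wb [a + b]"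
    using web_value_cong[OF web_eq.bigon[OF a b]] by simp
  assume c: "1 \<le> c"
  show "wmerge (a + b) c \<cdot>\<^bsub>Wb\<^esub> (wmerge a b \<boxtimes>\<^bsub>Wb\<^esub> Idt Wb [c])
      = wmerge a (b + c) \<cdot>\<^bsub>Wb\<^esub> (Idt Wb [a] \<boxtimes>\<^bsub>Wb\<^esub> wmerge b c)"
    using web_value_cong[OF web_eq.assoc[OF a b c]] by simp
  show "(wsplit a b \<boxtimes>\<^bsub>Wb\<^esub> Idt Wb [c]) \<cdot>\<^bsub>Wb\<^esub> wsplit (a + b) c
      = (Idt Wb [a] \<boxtimes>\<^bsub>Wb\<^esub> wsplit b c) \<cdot>\<^bsub>Wb\<^esub> wsplit a (b + c)"
    using web_value_cong[OF web_eq.coassoc[OF a b c]] by simp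
  have "a + b + c - a = b + c" "a + b + c - b = a + c" "a + b + c - a - b = c" by auto
  note less = web_eq.square_less[of a "a + b + c" b, unfolded this]
  show "(Idt Wb [b] \<boxtimes>\<^bsub>Wb\<^esub> wmerge a c) \<cdot>\<^bsub>Wb\<^esub> (wsplit b a \<boxtimes>\<^bsub>Wb\<^esub> Idt Wb [c]) \<cdot>\<^bsub>Wb\<^esub>
      (wmerge a b \<boxtimes>\<^bsub>Wb\<^esub> Idt Wb [c]) \<cdot>\<^bsub>Wb\<^esub> (Idt Wb [a] \<boxtimes>\<^bsub>Wb\<^esub> wsplit b c)
        = wsplit b (a + c) \<cdot>\<^bsub>Wb\<^esub> wmerge a (b + c)"
    using web_value_cong[OF less] a b c by simp
next
  fix c d e :: nat
  assume "1 \<le> c" "1 \<le> d" "1 \<le> e"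
  moreover have "c + e + (c + d) - (c + d + e) = c" "c + d + e - (c + e) = d" "c + d + e - (c + d) = e" by auto
  note greater = web_eq.square_greater[of "c + e" "c + d + e" "c + d", unfolded this]
  ultimately show "(wmerge c d \<boxtimes>\<^bsub>Wb\<^esub> Idt Wb [e]) \<cdot>\<^bsub>Wb\<^esub> (Idt Wb [c] \<boxtimes>\<^bsub>Wb\<^esub> wsplit d e) \<cdot>\<^bsub>Wb\<^esub>
      (Idt Wb [c] \<boxtimes>\<^bsub>Wb\<^esub> wmerge e d) \<cdot>\<^bsub>Wb\<^esub> (wsplit c e \<boxtimes>\<^bsub>Wb\<^esub> Idt Wb [d])
        = wsplit (c + d) e \<cdot>\<^bsub>Wb\<^esub> wmerge (c + e) d"
    using web_value_cong[OF greater] by simp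
qed

text \<open>Words of equal value give the same crossing diagram, which is the sandwich of either web.\<close>

theorem web_eq_of_demazure_eq:
  assumes t: "web_hom n m t" and u: "web_hom n m u" and "demazure (web_word t) = demazure (web_word u)"
  shows "web_eq n m t u"
proof -
  have "web_word t \<approx> web_word u" using assms set_web_word by (intro demazure_eq_imp_hecke[of _ _ "sum_list n"]) blast+
  then have "webs.crossings (sum_list n) (web_word t) = webs.crossings (sum_list n) (web_word u)"
    using set_web_word[OF t] by (rule webs.crossings_hecke)
  then have "webs.interp t = webs.interp u"
    using webs.sandwich[OF t] webs.sandwich[OF u] webs.recover[OF t] webs.recover[OF u] by simp
  then have "web_arrow n m t = web_arrow n m u" using web_value_eq_web_arrow t u by simp
  then show ?thesis using t web_hom_nonzero[OF t] web_arrow_eq_iff[of n m t u] by (simp add: ez_id)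
qed

text \<open>Diagrams for \<open>crossings\<close>, needed in order to apply the soundness of the word of a web to
  crossing diagrams.\<close>

fun crossing_web :: "nat \<Rightarrow> nat list \<Rightarrow> web" where
  "crossing_web N [] = WId (replicate N 1)"
| "crossing_web N (i # u) = WComp (WTens (WId (replicate (i - 1) 1))
      (WTens (WComp (Split 1 1) (Merge 1 1)) (WId (replicate (N - i - 1) 1)))) (crossing_web N u)"

lemma young_word_ones [simp]: "young_word (replicate k (Suc 0)) = []"
  by (induction k) simp_all

lemma crossing_web_hom: "set u \<subseteq> {1..<N} \<Longrightarrow> web_hom (replicate N 1) (replicate N 1) (crossing_web N u)"
proof (induction u)
  case Nil
  show ?case by (simp add: hom_id)
next
  case (Cons i u)
  then have i: "1 \<le> i" "i < N" by auto
  have "web_hom (replicate (i - 1) 1 @ [1, 1] @ replicate (N - i - 1) 1) (replicate (i - 1) 1 @ [1, 1] @ replicate (N - i - 1) 1)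
    (WTens (WId (replicate (i - 1) 1)) (WTens (WComp (Split 1 1) (Merge 1 1)) (WId (replicate (N - i - 1) 1))))"
    by (intro hom_tens hom_id hom_comp[OF hom_split hom_merge]) auto
  then show ?case using Cons webs.ones_split[OF i] by (auto intro: hom_comp)
qed

lemma web_word_crossing_web: "set u \<subseteq> {1..<N} \<Longrightarrow> web_word (crossing_web N u) \<approx> u"
proof (induction u)
  case Nil
  show ?case by (simp add: hecke_refl)
next
  case (Cons i u)
  then have i: "1 \<le> i" by auto
  have "[i, i] @ web_word (crossing_web N u) \<approx> [i] @ u" using Cons by (intro hecke_append hecke_idem) auto
  then show ?case using i by (simp add: sum_list_replicate numeral_2_eq_2)
qed

lemma interp_crossing_web: "set u \<subseteq> {1..<N} \<Longrightarrow> webs.interp (crossing_web N u) = webs.crossings N u"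
proof (induction u)
  case (Cons i u)
  then show ?case by (simp add: webs.crossing_at_def webs.crossing_def)
qed simp

text \<open>The crossing diagram of \<open>u\<close> is composed with the full split of \<open>n\<close> below and the full
  merge of \<open>m\<close> above. The sandwich of the resulting web is the crossing diagram of \<open>w\<^sub>m u w\<^sub>n\<close>;
  by soundness, equal crossing diagrams have congruent words.\<close>

theorem web_of_word:
  assumes "0 \<notin> set n" "0 \<notin> set m" "sum_list n = sum_list m" "set u \<subseteq> {1..<sum_list n}"
  obtains t where "web_hom n m t" "web_word t \<approx> young_word m @ u @ young_word n"
proof -
  let ?N = "sum_list n"
  let ?f = "webs.merges m \<cdot>\<^bsub>Wb\<^esub> webs.crossings ?N u \<cdot>\<^bsub>Wb\<^esub> webs.splits n"
  note sa = webs.crossings_arrs[OF assms(4)]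
  have f: "?f \<in> Hom Wb n m"
    using assms sa by (simp add: Hom_def)
  then obtain t where t: "?f = web_arrow n m t" "web_hom n m t"
    using assms by (elim HomE_web_arrow) (simp add: ez_id)
  have w: "set (young_word m) \<subseteq> {1..<?N}" "set (young_word n) \<subseteq> {1..<?N}"
    using set_young_word_subset[of m] set_young_word_subset[of n] assms by auto
  have v: "set (young_word m @ u @ young_word n) \<subseteq> {1..<?N}" using w assms by auto
  have "webs.crossings ?N (web_word t) = webs.splits m \<cdot>\<^bsub>Wb\<^esub> ?f \<cdot>\<^bsub>Wb\<^esub> webs.merges n"
    using webs.sandwich[OF t(2)] web_value_eq_web_arrow[OF t(2)] t(1) by simp
  also have "\<dots> = (webs.splits m \<cdot>\<^bsub>Wb\<^esub> webs.merges m) \<cdot>\<^bsub>Wb\<^esub> webs.crossings ?N u \<cdot>\<^bsub>Wb\<^esub> (webs.splits n \<cdot>\<^bsub>Wb\<^esub> webs.merges n)"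
    using assms sa by (simp add: webs.comp_assoc')
  also have "\<dots> = webs.crossings ?N (young_word m @ u @ young_word n)"
    using assms w webs.crossings_append[OF w(1), of "u @ young_word n"] webs.crossings_append[OF assms(4) w(2)]
    by (simp add: webs.splits_merges)
  finally have "webs.interp (crossing_web ?N (web_word t)) = webs.interp (crossing_web ?N (young_word m @ u @ young_word n))"
    using interp_crossing_web[OF set_web_word[OF t(2)]] interp_crossing_web[OF v] by simp
  then have "web_eq (replicate ?N 1) (replicate ?N 1) (crossing_web ?N (web_word t)) (crossing_web ?N (young_word m @ u @ young_word n))"
    using crossing_web_hom[OF set_web_word[OF t(2)]] crossing_web_hom[OF v] web_value_eq_web_arrow
      web_arrow_eq_iff[of "replicate ?N 1" "replicate ?N 1" "crossing_web ?N (web_word t)" "crossing_web ?N (young_word m @ u @ young_word n)"]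
    by (simp add: ez_id)
  then have "web_word (crossing_web ?N (web_word t)) \<approx> web_word (crossing_web ?N (young_word m @ u @ young_word n))" by (rule web_word_sound)
  then have "web_word t \<approx> young_word m @ u @ young_word n"
    using web_word_crossing_web[OF set_web_word[OF t(2)]] web_word_crossing_web[OF v] by (meson hecke_sym hecke_trans)
  then show ?thesis using t that by blast
qed

section \<open>From webs to double cosets\<close>

lemma cuts_ez [simp]: "cuts (ez n) = cuts n"
  by (induction n) (auto simp: erase_zeros_def insert_absorb)

lemma sum_list_ez [simp]: "sum_list (ez n) = sum_list n"
  by (induction n) (auto simp: erase_zeros_def)

lemma young_word_ez [simp]: "young_word (ez n) = young_word n"
proof (induction n)
  case (Cons a n)
  then show ?case by (cases "a = 0") (simp_all only: erase_zeros_def filter.simps young_word.simps w0.simps append_Nil map_add_0 if_True if_False not_not simp_thms)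
qed (simp add: erase_zeros_def)

lemma young_ez [simp]: "young (ez n) = young n"
  by (simp add: young_eq_cuts)

lemma letters_ez [simp]: "letters (ez n) = letters n"
  by (simp add: letters_def)

abbreviation young_coset :: "nat list \<Rightarrow> nat list \<Rightarrow> (nat \<Rightarrow> nat) \<Rightarrow> (nat \<Rightarrow> nat) set" where
  "young_coset n m w \<equiv> double_coset (sym_group (sum_list n)) (young m) w (young n)"

lemma young_coset_eqI:
  assumes "x \<in> young_coset n m y"
  shows "young_coset n m x = young_coset n m y"
proof -
  obtain a b where x: "x = a \<circ> y \<circ> b" and a: "a \<in> young m" and b: "b \<in> young n"
    using assms by (auto simp: double_coset_eq)
  have ao: "inv' a \<circ> a = id" "b \<circ> inv' b = id"
    using permutes_inv_o[OF young_permutes[OF a]] permutes_inv_o[OF young_permutes[OF b]] by auto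
  have y: "y = inv' a \<circ> x \<circ> inv' b"
  proof -
    have "inv' a \<circ> x \<circ> inv' b = (inv' a \<circ> a) \<circ> y \<circ> (b \<circ> inv' b)" unfolding x by (simp only: Fun.comp_assoc)
    then show ?thesis unfolding ao by simp
  qed
  have sub: "young_coset n m (c \<circ> z \<circ> d) \<subseteq> young_coset n m z" if "c \<in> young m" "d \<in> young n" for c d z
  proof
    fix v assume "v \<in> young_coset n m (c \<circ> z \<circ> d)"
    then obtain e f where ef: "v = e \<circ> (c \<circ> z \<circ> d) \<circ> f" "e \<in> young m" "f \<in> young n"
      by (auto simp: double_coset_eq)
    have "v = (e \<circ> c) \<circ> z \<circ> (d \<circ> f)" unfolding ef(1) by (simp only: Fun.comp_assoc)
    then show "v \<in> young_coset n m z" using young_comp[OF ef(2) that(1)] young_comp[OF that(2) ef(3)]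
      unfolding double_coset_eq by blast
  qed
  show ?thesis
    using sub[OF a b, of y, folded x] sub[OF young_inv[OF a] young_inv[OF b], of x, folded y] by blast
qed

text \<open>All representatives of a web give the same double coset; the union avoids a choice.\<close>

definition web_to_coset :: "web_arr \<Rightarrow> sc_arr" where
  "web_to_coset = (\<lambda>(n, m, c). (n, m, \<Union>t\<in>c. young_coset n m (demazure (web_word t))))"

lemma web_to_coset_web_arrow:
  assumes "web_hom (ez n) (ez m) t"
  shows "web_to_coset (web_arrow n m t) = (n, m, young_coset n m (demazure (web_word t)))"
proof -
  have c: "demazure (web_word u) = demazure (web_word t)" if "u \<in> web_class (ez n) (ez m) t" for u
    using that hecke_imp_demazure[OF web_word_sound] by (auto simp: web_class_def)
  have "t \<in> web_class (ez n) (ez m) t"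
    using assms by (simp add: web_class_def web_eq.eq_refl)
  moreover have "(\<Union>u\<in>web_class (ez n) (ez m) t. young_coset n m (demazure (web_word u)))
      = (\<Union>u\<in>web_class (ez n) (ez m) t. young_coset n m (demazure (web_word t)))"
    using c by (intro SUP_cong) simp_all
  ultimately have "(\<Union>u\<in>web_class (ez n) (ez m) t. young_coset n m (demazure (web_word u))) = young_coset n m (demazure (web_word t))"
    by blast
  then show ?thesis by (simp add: web_to_coset_def web_arrow_def)
qed

lemma coset_max_web:
  assumes "web_hom (ez n) (ez m) t"
  shows "demazure (coset_max m n (web_word t)) = demazure (web_word t)"
proof -
  have "young_word m @ (web_word t @ young_word n) \<approx> young_word m @ web_word t"
    using web_word_absorb_right[OF assms] by (intro hecke_append hecke_refl) simp
  also have "\<dots> \<approx> web_word t" using web_word_absorb_left[OF assms] by simp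
  finally show ?thesis unfolding coset_max_def by (rule hecke_imp_demazure)
qed

text \<open>The word of a web from \<open>n\<close> to \<open>m\<close> absorbs \<open>w\<^sub>n\<close> and \<open>w\<^sub>m\<close>, so its value is the maximal
  element of the double coset that it represents.\<close>

lemma bruhat_max_web:
  assumes "web_hom (ez n) (ez m) t"
  shows "bruhat_max (sym_group (sum_list n)) (simple_transpositions (sum_list n)) (young_coset n m (demazure (web_word t))) = demazure (web_word t)"
  using bruhat_max_double_coset[of m n "web_word t"] web_hom_sum[OF assms] set_web_word[OF assms] coset_max_web[OF assms]
  by simp

lemma Hom_SC_Sym:
  "Hom SC_Sym n m = {(n, m, young_coset n m w) | w. sum_list n = sum_list m \<and> w permutes {1..sum_list n}}"
  by (auto simp: Hom_def SC_Sym_def double_cosets_def sym_group_carrier)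

lemma web_to_coset_functor: "identity_on_objects_functor Wb SC_Sym web_to_coset"
proof
  show "Obj SC_Sym = Obj Wb" "Unit SC_Sym = Unit Wb" "TObj SC_Sym = TObj Wb"
    by (simp_all add: SC_Sym_def)
  show "web_to_coset f \<in> Hom SC_Sym X Y" if "f \<in> Hom Wb X Y" for f X Y
    using that
  proof (rule HomE_web_arrow)
    fix t assume t: "f = web_arrow X Y t" "web_hom (ez X) (ez Y) t"
    show ?thesis using web_to_coset_web_arrow[OF t(2)] web_hom_sum[OF t(2)] demazure_permutes[OF set_web_word[OF t(2)]]
      unfolding t(1) Hom_SC_Sym by auto
  qed
  show "web_to_coset (Idt Wb X) = Idt SC_Sym X" for X
  proof -
    have "demazure (young_word X) \<in> young_coset X X id"
      using demazure_young[OF set_young_word, of X] id_young[of X] unfolding double_coset_eq mem_Collect_eq by (metis comp_id)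
    then show ?thesis
      using web_to_coset_web_arrow[OF web_hom_WId_ez, of X] young_coset_eqI[of "demazure (young_word X)" X X id]
      by (simp add: SC_Webs_Idt SC_Sym_def)
  qed
  show "web_to_coset (g \<cdot>\<^bsub>Wb\<^esub> f) = web_to_coset g \<cdot>\<^bsub>SC_Sym\<^esub> web_to_coset f"
    if "g \<in> Hom Wb Y Z" "f \<in> Hom Wb X Y" for g f X Y Z
  proof -
    obtain t where t: "g = web_arrow Y Z t" "web_hom (ez Y) (ez Z) t" using \<open>g \<in> _\<close> by (rule HomE_web_arrow)
    obtain u where u: "f = web_arrow X Y u" "web_hom (ez X) (ez Y) u" using \<open>f \<in> _\<close> by (rule HomE_web_arrow)
    have s: "sum_list X = sum_list Y" using web_hom_sum[OF u(2)] by simp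
    have "sc_comp (sym_group (sum_list X)) (simple_transpositions (sum_list X)) (young Z) (young X)
        (young_coset Y Z (demazure (web_word t))) (young_coset X Y (demazure (web_word u))) = young_coset X Z (demazure (web_word (WComp t u)))"
      unfolding sc_comp_def
      using bruhat_max_web[OF t(2)] bruhat_max_web[OF u(2)] set_web_word[OF t(2)] set_web_word[OF u(2)] s
      by (simp add: star_product_demazure)
    then show ?thesis
      unfolding t(1) u(1) web_arrow_Comp[OF t(2) u(2)] web_to_coset_web_arrow[OF t(2)] web_to_coset_web_arrow[OF u(2)]
        web_to_coset_web_arrow[OF hom_comp[OF t(2) u(2)]]
      by (simp add: SC_Sym_def)
  qed
  show "web_to_coset (f \<boxtimes>\<^bsub>Wb\<^esub> f') = web_to_coset f \<boxtimes>\<^bsub>SC_Sym\<^esub> web_to_coset f'"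
    if "f \<in> Hom Wb X Y" "f' \<in> Hom Wb X' Y'" for f f' X Y X' Y'
  proof -
    obtain t where t: "f = web_arrow X Y t" "web_hom (ez X) (ez Y) t" using \<open>f \<in> _\<close> by (rule HomE_web_arrow)
    obtain u where u: "f' = web_arrow X' Y' u" "web_hom (ez X') (ez Y') u" using \<open>f' \<in> _\<close> by (rule HomE_web_arrow)
    have h: "web_hom (ez (X @ X')) (ez (Y @ Y')) (WTens t u)" using hom_tens[OF t(2) u(2)] by simp
    have s: "sum_list Y = sum_list X" "sum_list Y' = sum_list X'"
      using web_hom_sum[OF u(2)] web_hom_sum[OF t(2)] by simp_all
    have 0: "0 \<notin> set (web_word u)" using set_web_word[OF u(2)] by auto
    have te: "set (web_word t) \<subseteq> {1..<sum_list X}" using set_web_word[OF t(2)] by simp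
    have "demazure (web_word t) permutes {1..sum_list X}" "demazure (web_word u) permutes {1..sum_list X'}"
      using demazure_permutes[OF set_web_word[OF t(2)]] demazure_permutes[OF set_web_word[OF u(2)]] by simp_all
    then have "{perm_sum (sum_list X) x y | x y. x \<in> young_coset X Y (demazure (web_word t)) \<and> y \<in> young_coset X' Y' (demazure (web_word u))}
      = young_coset (X @ X') (Y @ Y') (perm_sum (sum_list X) (demazure (web_word t)) (demazure (web_word u)))"
      by (rule double_coset_perm_sum[OF s])
    also have "perm_sum (sum_list X) (demazure (web_word t)) (demazure (web_word u)) = demazure (web_word (WTens t u))"
      using perm_sum_demazure[OF te 0] web_strands_web_hom[OF t(2)] by simp
    finally show ?thesis
      unfolding t(1) u(1) web_arrow_TArr[OF t(2) u(2)] web_to_coset_web_arrow[OF t(2)] web_to_coset_web_arrow[OF u(2)]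
        web_to_coset_web_arrow[OF h]
      by (simp add: SC_Sym_def)
  qed
qed

lemma web_to_coset_bij: "bij_betw web_to_coset (Arr Wb) (Arr SC_Sym)"
  unfolding bij_betw_def
proof
  show "inj_on web_to_coset (Arr Wb)"
  proof (rule inj_onI)
    fix f g assume "f \<in> Arr Wb" "g \<in> Arr Wb" and eq: "web_to_coset f = web_to_coset g"
    then obtain n m t n' m' u where t: "f = web_arrow n m t" "web_hom (ez n) (ez m) t"
      and u: "g = web_arrow n' m' u" "web_hom (ez n') (ez m') u" by (auto simp: SC_Webs_Arr)
    have e: "n' = n" "m' = m" "young_coset n m (demazure (web_word t)) = young_coset n' m' (demazure (web_word u))"
      using eq unfolding t(1) u(1) web_to_coset_web_arrow[OF t(2)] web_to_coset_web_arrow[OF u(2)] by auto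
    have u': "web_hom (ez n) (ez m) u" using u e by simp
    have e3: "young_coset n m (demazure (web_word t)) = young_coset n m (demazure (web_word u))" using e(3) unfolding e(1,2) .
    have "demazure (web_word t) = demazure (web_word u)"
      using bruhat_max_web[OF t(2), unfolded e3] bruhat_max_web[OF u'] by (rule trans[OF sym])
    then have "web_eq (ez n) (ez m) t u" using t(2) u' by (intro web_eq_of_demazure_eq)
    then show "f = g" unfolding t(1) u(1) e by (rule web_arrow_eqI)
  qed
  interpret F: identity_on_objects_functor Wb SC_Sym web_to_coset by (rule web_to_coset_functor)
  show "web_to_coset ` Arr Wb = Arr SC_Sym"
  proof (intro Set.equalityI subsetI)
    fix g assume "g \<in> web_to_coset ` Arr Wb"
    then obtain f where "g = web_to_coset f" "f \<in> Hom Wb (Dom Wb f) (Cod Wb f)"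
      by (auto simp: Hom_def)
    then show "g \<in> Arr SC_Sym" using F.map_Hom by (fastforce simp: Hom_def)
  next
    fix g assume g: "g \<in> Arr SC_Sym"
    then have "g \<in> Hom SC_Sym (Dom SC_Sym g) (Cod SC_Sym g)" by (simp add: Hom_def)
    then obtain n m w where w: "g = (n, m, young_coset n m w)" "sum_list n = sum_list m" "w permutes {1..sum_list n}"
      unfolding Hom_SC_Sym by auto
    obtain v where v: "set v \<subseteq> {1..<sum_list n}" "demazure v = w" using exists_reduced[OF w(3)] by blast
    obtain t where t: "web_hom (ez n) (ez m) t" "web_word t \<approx> young_word (ez m) @ v @ young_word (ez n)"
      using web_of_word[of "ez n" "ez m" v] v w by auto
    have "demazure (web_word t) = demazure (coset_max m n v)" using hecke_imp_demazure[OF t(2)] by (simp add: coset_max_def)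
    then have "demazure (web_word t) \<in> young_coset n m w" using demazure_coset_max_in[of m n v] v w(2) by simp
    then have "web_to_coset (web_arrow n m t) = g" using web_to_coset_web_arrow[OF t(1)] young_coset_eqI w(1) by simp
    then show "g \<in> web_to_coset ` Arr Wb" using t(1) by (auto simp: SC_Webs_Arr)
  qed
qed

theorem proposition7p6:
  shows "monoidally_equivalent SC_Sym SC_Webs"
  using strict_monoidal_SC_Webs web_to_coset_functor web_to_coset_bij
  by (rule monoidally_equivalent_of_bijective)

end
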